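(* Let $N\ge 2$ and let $W(x)=-\mathcal{N}(x)+W_a(x)$ on $\mathbb{R}^N$, where $\mathcal{N}$ is the Newtonian kernel and $W_a$ satisfies (W1), (W2), (W-RAD) and (W-CONF). Then for every $\bar R_0>0$ and $L>0$ there exists $\bar R>0$, depending only on $W_a$, $\bar R_0$, $N$ and $L$, such that the following holds. Let $\rho_0\in\mathcal{W}^{2,\infty}(\mathbb{R}^N)$ be nonnegative with $\operatorname{supp}\rho_0\subset B(0,\bar R_0)$, $\int_{\mathbb{R}^N}\rho_0\,dx=1$, $\int_{\mathbb{R}^N}x\rho_0(x)\,dx=0$ and $\|\rho_0\|_{L^\infty}\le L$. Then the classical solution $\rho$ of $$\rho_t=\nabla\cdot\big(\rho(\nabla W*\rho)\big),\qquad x\in\mathbb{R}^N,\ t>0,$$ with $\rho(0,\cdot)=\rho_0$ satisfies $\operatorname{supp}\rho(t,\cdot)\subset B(0,\bar R)$ for all $t\ge 0$.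
   Context: $B(0,r)=B_r(0)$ is the ball of radius $r$ centered at $0$. $\mathcal{W}^{k,\infty}$ denotes the usual Sobolev space. The Newtonian kernel $\mathcal{N}$ is the fundamental solution of the Laplacian ($\Delta\mathcal{N}=\delta_0$): $\mathcal{N}(x)=\frac{1}{2\pi}\ln|x|$ if $N=2$, and $\mathcal{N}(x)=-\frac{1}{N(N-2)c_N}|x|^{2-N}$ if $N\ge 3$, where $c_N$ is the volume of the unit ball of $\mathbb{R}^N$. The assumptions on $W_a$ are: (W1) $\Delta W_a\in L^1_{loc}(\mathbb{R}^N)$. (W2) $\Delta W_a$ is bounded in $\mathbb{R}^N\setminus B_\epsilon(0)$ for any $\epsilon>0$. (W-RAD) $W_a(x)=w(|x|)$ with $w\in C^1((0,\infty))$ and $w'(r)\ge 0$ for $r>0$. (W-CONF) $\lim_{r\to\infty}w'(r)\,r^{1/N}=+\infty$. Classical solution: $\rho\in C^1([0,T]\times\mathbb{R}^N)$ for every $T>0$, $\rho\in\mathcal{W}^{1,\infty}_{loc}(\mathbb{R}_+,\mathcal{W}^{1,\infty}(\mathbb{R}^N))$, satisfying the equation pointwise. It is known that for compactly supported nonnegative $\rho_0\in\mathcal{W}^{2,\infty}(\mathbb{R}^N)$ there is a unique such solution; its velocity field $v=-\nabla W*\rho$ is Lipschitz in space and time, it is given by characteristics, $\rho(t,x)=\rho_0(X_t^{-1}(x))\det(DX_t^{-1}(x))$ with $\frac{d}{dt}X_t=-(\nabla W*\rho)(t,X_t)$, $X_0=\mathrm{id}$, and $\rho(t,\cdot)$ has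 compact support for each $t$ (a priori possibly growing with $t$). *)

theory Defs
  imports "HOL-Analysis.Analysis"
begin

definition supp :: "('a::topological_space \<Rightarrow> real) \<Rightarrow> 'a set" where
  "supp f = closure {x. f x \<noteq> 0}"

text \<open>Test functions \<open>C\<^sub>c\<^sup>\<infinity>\<close> and weak derivatives. Basis vectors \<open>b \<in> Basis\<close> index the coordinates.\<close>

definition partial_deriv :: "'a \<Rightarrow> ('a::euclidean_space \<Rightarrow> real) \<Rightarrow> 'a \<Rightarrow> real" where
  "partial_deriv b f x = frechet_derivative f (at x) b"

primrec C_k :: "nat \<Rightarrow> ('a::euclidean_space \<Rightarrow> real) \<Rightarrow> bool" where
  "C_k 0 f \<longleftrightarrow> continuous_on UNIV f"
| "C_k (Suc k) f \<longleftrightarrow>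
     (\<forall>x. f differentiable (at x)) \<and> (\<forall>b\<in>Basis. C_k k (partial_deriv b f))"

definition test_function :: "('a::euclidean_space \<Rightarrow> real) \<Rightarrow> bool" where
  "test_function \<phi> \<longleftrightarrow> (\<forall>k. C_k k \<phi>) \<and> compact (supp \<phi>)"

definition laplacian :: "('a::euclidean_space \<Rightarrow> real) \<Rightarrow> 'a \<Rightarrow> real" where
  "laplacian \<phi> x = (\<Sum>b\<in>Basis. partial_deriv b (partial_deriv b \<phi>) x)"

definition locally_integrable :: "('a::euclidean_space \<Rightarrow> real) \<Rightarrow> bool" where
  "locally_integrable f \<longleftrightarrow> (\<forall>K. compact K \<longrightarrow> f absolutely_integrable_on K)"

definition weak_partial :: "'a \<Rightarrow> ('a::euclidean_space \<Rightarrow> real) \<Rightarrow> ('a \<Rightarrow> real) \<Rightarrow> bool" where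
  "weak_partial b f g \<longleftrightarrow> locally_integrable f \<and> locally_integrable g \<and>
     (\<forall>\<phi>. test_function \<phi> \<longrightarrow>
        (LINT x|lebesgue. f x * partial_deriv b \<phi> x) = - (LINT x|lebesgue. g x * \<phi> x))"

text \<open>\<open>weak_laplacian f g\<close>: the distribution \<open>\<Delta>f\<close> on the whole space, including the origin,
  is the locally integrable function \<open>g\<close>.\<close>

definition weak_laplacian :: "('a::euclidean_space \<Rightarrow> real) \<Rightarrow> ('a \<Rightarrow> real) \<Rightarrow> bool" where
  "weak_laplacian f g \<longleftrightarrow> locally_integrable f \<and> locally_integrable g \<and>
     (\<forall>\<phi>. test_function \<phi> \<longrightarrow>
        (LINT x|lebesgue. f x * laplacian \<phi> x) = (LINT x|lebesgue. g x * \<phi> x))"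

text \<open>\<open>sobolev_inf_bound k C f\<close>: all weak derivatives of \<open>f\<close> of order at most \<open>k\<close> exist and are
  bounded by \<open>C\<close> almost everywhere, i.e. the \<open>W\<^sup>k\<^sup>,\<^sup>\<infinity>\<close> norm of \<open>f\<close>
  (maximum over the derivatives) is at most \<open>C\<close>.\<close>

primrec sobolev_inf_bound :: "nat \<Rightarrow> real \<Rightarrow> ('a::euclidean_space \<Rightarrow> real) \<Rightarrow> bool" where
  "sobolev_inf_bound 0 C f \<longleftrightarrow>
     f \<in> borel_measurable lebesgue \<and> (AE x in lebesgue. \<bar>f x\<bar> \<le> C)"
| "sobolev_inf_bound (Suc k) C f \<longleftrightarrow>
     f \<in> borel_measurable lebesgue \<and> (AE x in lebesgue. \<bar>f x\<bar> \<le> C) \<and>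
     (\<forall>b\<in>Basis. \<exists>g. weak_partial b f g \<and> sobolev_inf_bound k C g)"

definition sobolev_inf :: "nat \<Rightarrow> ('a::euclidean_space \<Rightarrow> real) \<Rightarrow> bool" where
  "sobolev_inf k f \<longleftrightarrow> (\<exists>C. sobolev_inf_bound k C f)"

text \<open>The potential. Its values at the origin play no role.\<close>

definition newtonian :: "'a::euclidean_space \<Rightarrow> real" where
  "newtonian x =
     (if DIM('a) = 2 then 1 / (2 * pi) * ln (norm x)
      else - 1 / (real DIM('a) * (real DIM('a) - 2) * measure lborel (ball (0::'a) 1))
             * norm x powr (2 - real DIM('a)))"

definition W1 :: "('a::euclidean_space \<Rightarrow> real) \<Rightarrow> bool" where
  "W1 Wa \<longleftrightarrow> (\<exists>g. weak_laplacian Wa g)"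

definition W2 :: "('a::euclidean_space \<Rightarrow> real) \<Rightarrow> bool" where
  "W2 Wa \<longleftrightarrow> (\<exists>g. weak_laplacian Wa g \<and>
     (\<forall>\<epsilon>>0. \<exists>C. AE x in lebesgue. x \<notin> ball 0 \<epsilon> \<longrightarrow> \<bar>g x\<bar> \<le> C))"

definition W_RAD :: "('a::euclidean_space \<Rightarrow> real) \<Rightarrow> (real \<Rightarrow> real) \<Rightarrow> bool" where
  "W_RAD Wa w \<longleftrightarrow> (\<forall>x. x \<noteq> 0 \<longrightarrow> Wa x = w (norm x)) \<and>
     w C1_differentiable_on {0<..} \<and> (\<forall>r>0. deriv w r \<ge> 0)"

definition W_CONF :: "nat \<Rightarrow> (real \<Rightarrow> real) \<Rightarrow> bool" where
  "W_CONF N w \<longleftrightarrow> filterlim (\<lambda>r. deriv w r * r powr (1 / real N)) at_top at_top"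

text \<open>The gradient is the classical one, which for the potentials considered exists away from the
  origin; under (W1) and (W-RAD) it is locally integrable and is also the distributional gradient.\<close>

definition gradient :: "('a::euclidean_space \<Rightarrow> real) \<Rightarrow> 'a \<Rightarrow> 'a" where
  "gradient f x = (THE D. GDERIV f x :> D)"

definition grad_conv :: "('a::euclidean_space \<Rightarrow> real) \<Rightarrow> ('a \<Rightarrow> real) \<Rightarrow> 'a \<Rightarrow> 'a" where
  "grad_conv W u x = (LINT y|lebesgue. u y *\<^sub>R gradient W (x - y))"

definition has_divergence :: "('a::euclidean_space \<Rightarrow> 'a) \<Rightarrow> real \<Rightarrow> 'a \<Rightarrow> bool" where
  "has_divergence F d x \<longleftrightarrow>
     (\<exists>F'. (F has_derivative F') (at x) \<and> d = (\<Sum>b\<in>Basis. F' b \<bullet> b))"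

definition C1_on :: "'a::real_normed_vector set \<Rightarrow> ('a \<Rightarrow> 'b::real_normed_vector) \<Rightarrow> bool" where
  "C1_on S f \<longleftrightarrow> (\<exists>f' :: 'a \<Rightarrow> 'a \<Rightarrow>\<^sub>L 'b.
     (\<forall>z\<in>S. (f has_derivative blinfun_apply (f' z)) (at z within S)) \<and> continuous_on S f')"

text \<open>\<open>W\<^sup>1\<^sup>,\<^sup>\<infinity>\<close> in time, with values in the Banach space \<open>W\<^sup>1\<^sup>,\<^sup>\<infinity>\<close>, locally on \<open>[0, \<infinity>)\<close>:
  read as bounded and Lipschitz in that norm on each \<open>[0, T]\<close>. (Strong Bochner measurability of
  the time derivative is not asked for; it fails in general, since \<open>L\<^sup>\<infinity>\<close> is not separable.)\<close>

definition sobolev_time_loc :: "(real \<Rightarrow> 'a::euclidean_space \<Rightarrow> real) \<Rightarrow> bool" where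
  "sobolev_time_loc \<rho> \<longleftrightarrow> (\<forall>T>0. \<exists>C.
     (\<forall>t\<in>{0..T}. sobolev_inf_bound 1 C (\<rho> t)) \<and>
     (\<forall>s\<in>{0..T}. \<forall>t\<in>{0..T}. sobolev_inf_bound 1 (C * \<bar>t - s\<bar>) (\<lambda>x. \<rho> t x - \<rho> s x)))"

text \<open>The support is compact, locally uniformly in time but with no bound as the time tends to
  infinity. Solutions transported by the flow of a Lipschitz velocity field from compactly
  supported data have this property, and it makes the convolution \<open>\<nabla>W * \<rho>\<close> meaningful.\<close>

definition compact_support_loc :: "(real \<Rightarrow> 'a::euclidean_space \<Rightarrow> real) \<Rightarrow> bool" where
  "compact_support_loc \<rho> \<longleftrightarrow> (\<forall>T>0. \<exists>K. compact K \<and> (\<forall>t\<in>{0..T}. supp (\<rho> t) \<subseteq> K))"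

definition classical_solution ::
  "('a::euclidean_space \<Rightarrow> real) \<Rightarrow> ('a \<Rightarrow> real) \<Rightarrow> (real \<Rightarrow> 'a \<Rightarrow> real) \<Rightarrow> bool" where
  "classical_solution W \<rho>0 \<rho> \<longleftrightarrow>
     (\<forall>T>0. C1_on ({0..T} \<times> UNIV) (\<lambda>(t, x). \<rho> t x)) \<and>
     sobolev_time_loc \<rho> \<and>
     compact_support_loc \<rho> \<and>
     (\<forall>x. \<rho> 0 x = \<rho>0 x) \<and>
     (\<forall>t>0. \<forall>x. \<exists>d. ((\<lambda>s. \<rho> s x) has_real_derivative d) (at t) \<and>
        has_divergence (\<lambda>y. \<rho> t y *\<^sub>R grad_conv W (\<rho> t) y) d x)"

end

theory Submission
  imports Defs
begin

text \<open>
  Write \<open>K\<close> for the gradient of the potential, \<open>V = K * \<rho>\<close>, \<open>\<sigma>\<close> for the area of the unit sphere and \<open>N\<close>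
  for the dimension. The equation reads \<open>\<rho>\<^sub>t = div (\<rho> V) = \<nabla>\<rho> \<bullet> V + \<rho> div V\<close>, and no flow is needed.

  Testing the weak Laplacian \<open>g\<close> of \<open>W\<^sub>a\<close> with radial functions gives
  \<open>\<sigma> r\<^sup>N\<^sup>-\<^sup>1 w'(r) = \<integral> g\<close> over the ball of radius \<open>r\<close>, so \<open>K\<close> is locally integrable and \<open>div V = - \<rho> + g * \<rho>\<close>,
  in an averaged sense. The maximum principle keeps \<open>\<rho>\<close> nonnegative, and bounds it by a constant \<open>M\<close>, because
  \<open>div V \<le> - max \<rho> / 2 + C\<close> at a maximum point. Mass and centre of mass are conserved.

  While the support stays in the ball of radius \<open>R\<close>, \<open>w'(r) \<ge> k = A (2R)\<^sup>-\<^sup>1\<^sup>/\<^sup>N\<close> for \<open>r0 \<le> r \<le> 2R\<close>, and symmetrising the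
  virial of order four bounds the derivative of the fourth moment \<open>M4\<close> by \<open>- k M3 + C / k\<^sup>2\<close>; as \<open>M3 \<ge> M4 / R\<close>, this gives \<open>M4 \<le> C R\<^sup>3\<close>.
  Hence the mass outside the ball of radius \<open>R / 2\<close> is \<open>O(1 / R)\<close>, the repulsion felt at \<open>|x| = R\<close> is
  \<open>O(R\<^sup>-\<^sup>1\<^sup>/\<^sup>N)\<close> with a constant independent of \<open>A\<close>, and the attraction, at least of order \<open>A R\<^sup>-\<^sup>1\<^sup>/\<^sup>N\<close> by the
  centring of the mass, wins for \<open>A\<close> large. Then \<open>\<integral> ((|x|\<^sup>2 - R\<^sup>2)\<^sup>+)\<^sup>2 \<rho>\<close> cannot leave \<open>0\<close>.
\<close>

section \<open>Integration on Euclidean space\<close>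

text \<open>The order of the moment is dictated by scaling. If mass m of bounded density lies within
  |x| / 2 of a point with |x| = R, splitting at distance d bounds its repulsion by a multiple of d +
  m / d^(N-1), which is m^(1/N) at the best d. An attraction of size R^(-1/N) therefore asks for m =
  O(1/R). A virial of order two would only give M2 = O(R / k), so m = O(R^(1/N - 1)). Order four
  gives M4 = O(R / k^3), and N >= 2 keeps 1 / k^3 below a multiple of R^2.

  The obstacle is circularity: k bounds the attraction only on the distances met inside a support
  already confined to radius R. So R stays fixed, the estimates are proved up to a time at which the
  support is still confined, and the support is continued past it. The constants are fixed in the
  order density bound, virial, moment, drift, A, r0, R; the moment constant does not involve A,
  since 1 / k^3 is bounded using A >= 1 only.

  Near the origin the Laplacian of the attractive part is merely integrable, so the kernel is never
  differentiated: derivatives fall on the density, and the divergence is expressed through spherical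
  means of the density.\<close>

lemma ball_measurable[measurable]:
  "ball (x::'a::euclidean_space) r \<in> sets borel" "cball x r \<in> sets borel"
  by auto

lemma lborel_reflect:
  fixes x :: "'a::euclidean_space"
  shows "distr lborel borel (\<lambda>y. x - y) = (lborel :: 'a measure)"
  using lborel_affine[of "-1" x] by (simp add: density_1)

lemma integral_reflect:
  fixes f :: "'a::euclidean_space \<Rightarrow> 'b::{banach, second_countable_topology}"
  assumes "f \<in> borel_measurable borel"
  shows "(\<integral>y. f (x - y) \<partial>lborel) = (\<integral>y. f y \<partial>lborel)"
  by (subst (2) lborel_reflect[of x, symmetric]) (simp add: integral_distr assms)

lemma integrable_reflect:
  fixes f :: "'a::euclidean_space \<Rightarrow> 'b::{banach, second_countable_topology}"
  assumes "f \<in> borel_measurable borel"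
  shows "integrable lborel (\<lambda>y. f (x - y)) \<longleftrightarrow> integrable lborel f"
  by (subst (2) lborel_reflect[of x, symmetric]) (simp add: integrable_distr_eq assms)

lemma integral_translate:
  fixes f :: "'a::euclidean_space \<Rightarrow> 'b::{banach, second_countable_topology}"
  assumes "f \<in> borel_measurable borel"
  shows "(\<integral>y. f (y + x) \<partial>lborel) = (\<integral>y. f y \<partial>lborel)"
proof -
  have "distr lborel borel (\<lambda>y. x + y) = (lborel :: 'a measure)"
    using lborel_affine[of 1 x] by (simp add: density_1)
  then have "(\<integral>y. f y \<partial>lborel) = (\<integral>y. f y \<partial>distr lborel borel (\<lambda>y. x + y))" by simp
  then show ?thesis by (simp add: integral_distr assms add.commute)
qed

text \<open>Only difference quotients based at \<open>t\<close> are dominated, and only a derivative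
  at \<open>t\<close> is asked for; a Lipschitz bound in the parameter therefore suffices, with no
  control of derivatives at nearby parameters.\<close>

lemma has_real_derivative_integral:
  fixes f :: "real \<Rightarrow> 'a \<Rightarrow> real"
  assumes "0 < d"
    and int: "\<And>s. \<bar>s - t\<bar> < d \<Longrightarrow> integrable M (f s)"
    and der: "AE x in M. ((\<lambda>s. f s x) has_real_derivative f' x) (at t)"
    and B: "integrable M B" and f': "f' \<in> borel_measurable M"
    and bd: "\<And>s x. \<bar>s - t\<bar> < d \<Longrightarrow> \<bar>f s x - f t x\<bar> \<le> B x * \<bar>s - t\<bar>"
  shows "((\<lambda>s. \<integral>x. f s x \<partial>M) has_real_derivative (\<integral>x. f' x \<partial>M)) (at t)"
    and "integrable M f'"
proof -
  let ?q = "\<lambda>h x. (f (t + h) x - f t x) / h"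
  have key: "(\<lambda>n. \<integral>x. ?q (X n) x \<partial>M) \<longlonglongrightarrow> (\<integral>x. f' x \<partial>M) \<and> integrable M f'"
    if X: "X \<longlonglongrightarrow> 0" "\<And>n. X n \<noteq> 0" "\<And>n. \<bar>X n\<bar> < d" for X :: "nat \<Rightarrow> real"
  proof -
    have 1: "?q (X n) \<in> borel_measurable M" for n
      using int[of "t + X n"] int[of t] X(3)[of n] \<open>0 < d\<close> by auto
    have 2: "AE x in M. (\<lambda>n. ?q (X n) x) \<longlonglongrightarrow> f' x"
      using der
    proof eventually_elim
      case (elim x)
      then have "((\<lambda>h. ?q h x) \<longlongrightarrow> f' x) (at 0)"
        by (simp add: DERIV_def)
      then show ?case
        by (rule filterlim_compose) (use X in \<open>auto simp: filterlim_at\<close>)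
    qed
    have 3: "AE x in M. norm (?q (X n) x) \<le> B x" for n
      using bd[of "t + X n"] X(2,3)[of n] by (auto simp: divide_le_eq)
    show ?thesis
      using integral_dominated_convergence[OF f' 1 B 2 3] integrable_dominated_convergence[OF f' 1 B 2 3]
      by blast
  qed
  \<comment> \<open>A sample null sequence, from which integrability of the limit \<open>f'\<close>
    is read off.\<close>
  define X0 where "X0 n = d / (real n + 2)" for n
  have "X0 \<longlonglongrightarrow> 0"
    using tendsto_mult[OF tendsto_const[of d] LIMSEQ_Suc[OF LIMSEQ_inverse_real_of_nat]]
    by (simp add: X0_def[abs_def] field_simps)
  moreover have "X0 n \<noteq> 0" "\<bar>X0 n\<bar> < d" for n
    using \<open>0 < d\<close> mult_strict_left_mono[of 1 "real n + 2" d] by (auto simp: X0_def divide_less_eq)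
  ultimately show "integrable M f'" using key by blast
  have "((\<lambda>h. (\<integral>x. ?q h x \<partial>M)) \<longlongrightarrow> (\<integral>x. f' x \<partial>M)) (at 0 within {-d<..<d})"
    unfolding tendsto_at_iff_sequentially
  proof (intro allI impI)
    fix X :: "nat \<Rightarrow> real" assume X: "\<forall>i. X i \<in> {- d<..<d} - {0}" "X \<longlonglongrightarrow> 0"
    then have "\<bar>X n\<bar> < d \<and> X n \<noteq> 0" for n by (auto simp: abs_less_iff) (smt (verit))+
    then show "((\<lambda>h. \<integral>x. ?q h x \<partial>M) \<circ> X) \<longlonglongrightarrow> integral\<^sup>L M f'"
      using key[of X] X by (simp add: o_def)
  qed
  then have lim: "((\<lambda>h. (\<integral>x. ?q h x \<partial>M)) \<longlongrightarrow> (\<integral>x. f' x \<partial>M)) (at 0)"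
    using at_within_open[of "0::real" "{-d<..<d}"] \<open>0 < d\<close> by simp
  have "eventually (\<lambda>h. (\<integral>x. ?q h x \<partial>M) = ((\<integral>x. f (t+h) x \<partial>M) - (\<integral>x. f t x \<partial>M)) / h) (at 0)"
    unfolding eventually_at
    by (rule exI[of _ d]) (use \<open>0 < d\<close> in \<open>auto simp: int\<close>)
  then show "((\<lambda>s. \<integral>x. f s x \<partial>M) has_real_derivative (\<integral>x. f' x \<partial>M)) (at t)"
    unfolding DERIV_def using lim by (rule Lim_transform_eventually[rotated])
qed

lemma integrable_cball_indicator:
  "integrable lborel (\<lambda>x::'a::euclidean_space. c * indicator (cball 0 r) x :: real)"
  using emeasure_lborel_cball_finite[of "0::'a" r] by simp

lemma integrable_continuous_compact_support:
  fixes f :: "'a::euclidean_space \<Rightarrow> 'b::{banach, second_countable_topology}"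
  assumes "continuous_on UNIV f" "\<And>x. r \<le> norm x \<Longrightarrow> f x = 0"
  shows "integrable lborel f"
proof -
  have "integrable lborel (\<lambda>x. indicator (cball 0 r) x *\<^sub>R f x)"
    by (rule borel_integrable_compact) (auto intro: continuous_on_subset[OF assms(1)])
  moreover have "(\<lambda>x. indicator (cball 0 r) x *\<^sub>R f x) = f"
    using assms(2) by (auto simp: fun_eq_iff indicator_def)
  ultimately show ?thesis by simp
qed

text \<open>By translation invariance the integral of \<open>F (x + s *\<^sub>R e)\<close> does not
  depend on \<open>s\<close>; differentiating under the integral at \<open>s = 0\<close> gives the
  claim. Asking for the derivative only almost everywhere admits Lipschitz fields with a kink on a
  sphere.\<close>

lemma integral_directional_derivative_eq_0:
  fixes F :: "'a::euclidean_space \<Rightarrow> real"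
  assumes lip: "\<And>x y. \<bar>F x - F y\<bar> \<le> C * norm (x - y)"
    and supp: "\<And>x. r \<le> norm x \<Longrightarrow> F x = 0"
    and der: "AE x in lborel. ((\<lambda>s. F (x + s *\<^sub>R e)) has_real_derivative F' x) (at 0)"
    and [measurable]: "F' \<in> borel_measurable borel"
  shows "(\<integral>x. F' x \<partial>lborel) = 0" and "integrable lborel F'"
proof -
  have cont: "continuous_on UNIV F"
  proof (cases "C \<le> 0")
    case True
    then have "F x = F 0" for x using lip[of x 0] by (smt (verit) mult_nonpos_nonneg norm_ge_zero)
    then show ?thesis by (metis continuous_on_const continuous_on_cong)
  next
    case False
    then have "C-lipschitz_on UNIV F" using lip by (auto simp: lipschitz_on_def dist_norm)
    then show ?thesis by (rule lipschitz_on_continuous_on)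
  qed
  then have [measurable]: "F \<in> borel_measurable borel" by (rule borel_measurable_continuous_onI)
  have C0: "0 \<le> C * norm v" for v :: 'a using lip[of v 0] by simp
  have i: "integrable lborel (\<lambda>x. F (x + s *\<^sub>R e))" for s
    by (rule integrable_continuous_compact_support[where r="\<bar>r\<bar> + \<bar>s\<bar> * norm e"])
      (auto intro!: continuous_on_compose2[OF cont] continuous_intros supp,
       use norm_triangle_ineq4[of "x + s *\<^sub>R e" "s *\<^sub>R e" for x] in \<open>smt (verit) add_diff_cancel_right' norm_scaleR\<close>)
  \<comment> \<open>Translates by at most \<open>norm e\<close> stay supported in the enlarged ball,
    so one indicator dominates all \<open>s\<close> with |s| < 1.\<close>
  let ?B = "\<lambda>x. C * norm e * indicator (cball 0 (\<bar>r\<bar> + norm e)) x"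
  have bd: "\<bar>F (x + s *\<^sub>R e) - F (x + 0 *\<^sub>R e)\<bar> \<le> ?B x * \<bar>s - 0\<bar>" if "\<bar>s - 0\<bar> < 1" for s x
  proof (cases "x \<in> cball 0 (\<bar>r\<bar> + norm e)")
    case True
    then show ?thesis using lip[of "x + s *\<^sub>R e" x] by (simp add: algebra_simps)
  next
    case False
    then have "norm x > \<bar>r\<bar> + norm e" by auto
    moreover have "norm x \<le> norm (x + s *\<^sub>R e) + \<bar>s\<bar> * norm e"
      using norm_triangle_ineq4[of "x + s *\<^sub>R e" "s *\<^sub>R e"] by simp
    moreover have "\<bar>s\<bar> * norm e \<le> norm e" using that by (simp add: mult_left_le_one_le)
    ultimately have "F (x + s *\<^sub>R e) = 0" "F x = 0"
      using supp[of x] supp[of "x + s *\<^sub>R e"] norm_ge_zero[of e] by linarith+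
    then show ?thesis using False by simp
  qed
  note D = has_real_derivative_integral[where f="\<lambda>s x. F (x + s *\<^sub>R e)" and t=0 and d=1 and M=lborel and B="?B" and f'=F',
      OF _ i der integrable_cball_indicator _ bd]
  show "integrable lborel F'" using D(2) by simp
  have "((\<lambda>s. \<integral>x. F x \<partial>lborel) has_real_derivative (\<integral>x. F' x \<partial>lborel)) (at 0)"
    using D(1) by (simp add: integral_translate)
  moreover have "((\<lambda>s. \<integral>x. F x \<partial>lborel) has_real_derivative 0) (at 0)" by simp
  ultimately show "(\<integral>x. F' x \<partial>lborel) = 0" using DERIV_unique by blast
qed

section \<open>Polar coordinates for radial functions\<close>

definition sphere_area :: "'a::euclidean_space itself \<Rightarrow> real" where
  "sphere_area _ = real DIM('a) * unit_ball_vol (real DIM('a))"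

lemma sphere_area_pos: "sphere_area TYPE('a::euclidean_space) > 0"
  by (simp add: sphere_area_def)

text \<open>Half-lines generate the Borel sets, and both measures give \<open>{..r}\<close> the
  volume of the ball of radius r, on the right by integrating the derivative of that volume. Radial
  integrals thus reduce to the line without a measure on the sphere.\<close>

lemma distr_norm_lborel:
  "distr lborel borel (norm :: 'a::euclidean_space \<Rightarrow> real) =
    density lborel (\<lambda>r. ennreal (sphere_area TYPE('a) * r ^ (DIM('a) - 1)) * indicator {0<..} r)"
    (is "?M = ?D")
proof (rule measure_eqI_generator_eq_countable[where \<Omega>=UNIV and E="range atMost" and A="range (\<lambda>n::nat. {..real n})"])
  let ?N = "DIM('a)"
  show "Int_stable (range (atMost :: real \<Rightarrow> _))" by (auto simp: Int_stable_def)
  have b: "borel = sigma UNIV (range (atMost :: real \<Rightarrow> _))" by (rule borel_eq_atMost)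
  show "sets ?M = sigma_sets UNIV (range atMost)" by (simp add: b)
  show "sets ?D = sigma_sets UNIV (range atMost)" by (simp add: b)
  have M: "emeasure ?M {..r} = ennreal (if r \<ge> 0 then unit_ball_vol ?N * r ^ ?N else 0)" for r
  proof -
    have "norm -` {..r} \<inter> space lborel = cball (0::'a) r" by auto
    then show ?thesis
      using emeasure_cball[of r "0::'a"] by (auto simp: emeasure_distr)
  qed
  show "emeasure ?M X = emeasure ?D X" if "X \<in> range atMost" for X
  proof -
    obtain r where X: "X = {..r}" using \<open>X \<in> range atMost\<close> by auto
    have "emeasure ?D {..r} = (\<integral>\<^sup>+x. ennreal (sphere_area TYPE('a) * x ^ (?N - 1)) * indicator {0..r} x \<partial>lborel)"
    proof -
      have "AE x in lborel. x \<noteq> (0::real)" by (rule AE_lborel_singleton)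
      then show ?thesis
        by (subst emeasure_density) (auto intro!: nn_integral_cong_AE simp: indicator_def elim!: eventually_mono)
    qed
    also have "\<dots> = ennreal (if r \<ge> 0 then unit_ball_vol ?N * r ^ ?N else 0)"
    proof (cases "r \<ge> 0")
      case True
      have "(\<integral>\<^sup>+x. ennreal (sphere_area TYPE('a) * x ^ (?N - 1)) * indicator {0..r} x \<partial>lborel)
        = ennreal (unit_ball_vol ?N * r ^ ?N - unit_ball_vol ?N * 0 ^ ?N)"
        by (rule nn_integral_FTC_Icc[where F="\<lambda>x. unit_ball_vol ?N * x ^ ?N"])
          (use True in \<open>auto intro!: derivative_eq_intros simp: sphere_area_def\<close>)
      then show ?thesis using True by (simp add: zero_power)
    qed simp
    finally show ?thesis using M X by metis
  qed
  show "emeasure ?M a \<noteq> \<infinity>" if "a \<in> range (\<lambda>n::nat. {..real n})" for a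
    using that M by auto
  show "\<Union> (range (\<lambda>n::nat. {..real n})) = UNIV"
    using real_arch_simple by fastforce
qed auto

lemma integrable_radial_iff:
  fixes f :: "real \<Rightarrow> real"
  assumes [measurable]: "f \<in> borel_measurable borel"
  shows "integrable lborel (\<lambda>x::'a::euclidean_space. f (norm x)) \<longleftrightarrow>
    integrable lborel (\<lambda>r. (sphere_area TYPE('a) * r ^ (DIM('a) - 1) * indicator {0<..} r) * f r)"
proof -
  have "density lborel (\<lambda>r. ennreal (sphere_area TYPE('a) * r ^ (DIM('a) - 1)) * indicator {0<..} r)
     = density lborel (\<lambda>r. ennreal (sphere_area TYPE('a) * r ^ (DIM('a) - 1) * indicator {0<..} r))"
    by (auto intro!: density_cong simp: indicator_def)
  note e = distr_norm_lborel[where 'a='a, unfolded this]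
  have "integrable lborel (\<lambda>x::'a. f (norm x)) \<longleftrightarrow> integrable (distr lborel borel (norm :: 'a \<Rightarrow> real)) f"
    by (simp add: integrable_distr_eq)
  also have "\<dots> \<longleftrightarrow> integrable lborel (\<lambda>r. (sphere_area TYPE('a) * r ^ (DIM('a) - 1) * indicator {0<..} r) *\<^sub>R f r)"
    unfolding e by (subst integrable_density)
      (use sphere_area_pos[where 'a='a] in \<open>auto simp: indicator_def\<close>)
  finally show ?thesis by simp
qed

lemma integral_radial:
  fixes f :: "real \<Rightarrow> real"
  assumes [measurable]: "f \<in> borel_measurable borel"
  shows "(\<integral>x. f (norm (x::'a::euclidean_space)) \<partial>lborel) =
    (\<integral>r. (sphere_area TYPE('a) * r ^ (DIM('a) - 1) * indicator {0<..} r) * f r \<partial>lborel)"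
proof -
  have "density lborel (\<lambda>r. ennreal (sphere_area TYPE('a) * r ^ (DIM('a) - 1)) * indicator {0<..} r)
     = density lborel (\<lambda>r. ennreal (sphere_area TYPE('a) * r ^ (DIM('a) - 1) * indicator {0<..} r))"
    by (auto intro!: density_cong simp: indicator_def)
  note e = distr_norm_lborel[where 'a='a, unfolded this]
  have "(\<integral>x. f (norm (x::'a)) \<partial>lborel) = (\<integral>r. f r \<partial>distr lborel borel (norm :: 'a \<Rightarrow> real))"
    by (simp add: integral_distr)
  also have "\<dots> = (\<integral>r. (sphere_area TYPE('a) * r ^ (DIM('a) - 1) * indicator {0<..} r) *\<^sub>R f r \<partial>lborel)"
    unfolding e by (subst integral_density)
      (use sphere_area_pos[where 'a='a] in \<open>auto simp: indicator_def\<close>)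
  finally show ?thesis by simp
qed

text \<open>At the origin \<open>inverse 0 = 0\<close> is harmless, a point being a null set.\<close>

lemma
  assumes "0 \<le> d"
  shows integrable_inverse_norm_power:
      "integrable lborel (\<lambda>z::'a::euclidean_space. indicator (cball 0 d) z * inverse (norm z ^ (DIM('a) - 1)))"
    and integral_inverse_norm_power:
      "(\<integral>z. indicator (cball 0 d) (z::'a) * inverse (norm z ^ (DIM('a) - 1)) \<partial>lborel) = sphere_area TYPE('a) * d"
proof -
  let ?f = "\<lambda>r::real. indicator {..d} r * inverse (r ^ (DIM('a) - 1))"
  have e: "(\<lambda>z::'a. indicator (cball 0 d) z * inverse (norm z ^ (DIM('a) - 1))) = (\<lambda>z. ?f (norm z))"
    by (auto simp: fun_eq_iff indicator_def)
  have e2: "(\<lambda>r. (sphere_area TYPE('a) * r ^ (DIM('a) - 1) * indicator {0<..} r) * ?f r)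
    = (\<lambda>r. sphere_area TYPE('a) * indicator {0<..d} r)"
    by (auto simp: fun_eq_iff indicator_def field_simps)
  have "integrable lborel (\<lambda>r. sphere_area TYPE('a) * indicator {0<..d} r)"
    using assms by (auto intro!: integrable_real_indicator)
  then show "integrable lborel (\<lambda>z::'a. indicator (cball 0 d) z * inverse (norm z ^ (DIM('a) - 1)))"
    unfolding e by (subst integrable_radial_iff) (simp_all only: e2, measurable)
  show "(\<integral>z. indicator (cball 0 d) (z::'a) * inverse (norm z ^ (DIM('a) - 1)) \<partial>lborel) = sphere_area TYPE('a) * d"
    unfolding e by (subst integral_radial, measurable, unfold e2) (use assms in simp)
qed

lemma AE_norm_neq: "AE x in lborel. norm (x::'a::euclidean_space) \<noteq> b"
proof (rule AE_I[where N="sphere 0 b"])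
  show "emeasure lborel (sphere (0::'a) b) = 0"
    using negligible_sphere[of "0::'a" b] negligible_iff_null_sets[of "sphere (0::'a) b"]
    by (simp add: null_sets_completion_iff null_sets_def)
qed auto

lemma open_AE_empty:
  fixes S :: "'a::euclidean_space set"
  assumes "open S" "AE x in lborel. x \<notin> S"
  shows "S = {}"
proof (rule ccontr)
  assume "S \<noteq> {}"
  have "emeasure lborel S = 0"
    using assms by (subst (asm) AE_iff_measurable[OF _ refl]) (auto simp: borel_open)
  then have "negligible S"
    using assms(1) unfolding negligible_iff_null_sets by (intro null_sets_completionI) (auto simp: null_sets_def borel_open)
  then show False using open_not_negligible[OF assms(1) \<open>S \<noteq> {}\<close>] by simp
qed

section \<open>Radial derivatives of compactly supported functions\<close>

lemma lipschitz_mult_bounded: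
  fixes f g :: "'a::real_normed_vector \<Rightarrow> real"
  assumes "\<And>x y. \<bar>f x - f y\<bar> \<le> A * norm (x - y)" "\<And>x y. \<bar>g x - g y\<bar> \<le> B * norm (x - y)"
    and "\<And>x. \<bar>f x\<bar> \<le> a" "\<And>x. \<bar>g x\<bar> \<le> b"
  shows "\<bar>f x * g x - f y * g y\<bar> \<le> (A * b + a * B) * norm (x - y)"
proof -
  have "f x * g x - f y * g y = (f x - f y) * g x + f y * (g x - g y)" by (simp add: algebra_simps)
  also have "\<bar>\<dots>\<bar> \<le> \<bar>f x - f y\<bar> * \<bar>g x\<bar> + \<bar>f y\<bar> * \<bar>g x - g y\<bar>"
    by (metis abs_mult abs_triangle_ineq)
  also have "\<dots> \<le> (A * norm (x - y)) * b + a * (B * norm (x - y))"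
    using assms order_trans[OF abs_ge_zero assms(1)] order_trans[OF abs_ge_zero assms(3)]
    by (intro add_mono mult_mono) auto
  finally show ?thesis by (simp add: algebra_simps)
qed

locale C1_compact_support =
  fixes \<phi> :: "'a::euclidean_space \<Rightarrow> real" and G :: "'a \<Rightarrow> 'a" and r :: real
  assumes der: "\<And>x. (\<phi> has_derivative (\<lambda>h. G x \<bullet> h)) (at x)"
    and cont_G: "continuous_on UNIV G"
    and zero: "\<And>x. r \<le> norm x \<Longrightarrow> \<phi> x = 0"
begin

lemma cont: "continuous_on UNIV \<phi>"
  by (rule has_derivative_continuous_on[OF has_derivative_at_withinI[OF der]])

lemma measurable_\<phi>[measurable]: "\<phi> \<in> borel_measurable borel"
  using cont by (rule borel_measurable_continuous_onI)

lemma measurable_G[measurable]: "G \<in> borel_measurable borel"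
  using cont_G by (rule borel_measurable_continuous_onI)

lemma G_zero: assumes "r < norm x" shows "G x = 0"
proof -
  have "(\<phi> has_derivative (\<lambda>h. 0)) (at x)"
  proof (rule has_derivative_transform_within_open[of "\<lambda>_. 0" _ _ UNIV "- cball 0 r"])
    show "x \<in> - cball 0 r" using assms by auto
  qed (use zero in \<open>auto simp: not_le\<close>)
  then have "(\<lambda>h. G x \<bullet> h) = (\<lambda>h. 0)" by (rule has_derivative_unique[OF der])
  then show ?thesis by (metis inner_eq_zero_iff)
qed

lemma bounded_G: obtains C where "0 < C" "\<And>x. norm (G x) \<le> C"
proof -
  have "compact (G ` cball 0 r)"
    by (intro compact_continuous_image continuous_on_subset[OF cont_G]) auto
  then obtain C where C: "0 < C" "\<And>y. y \<in> G ` cball 0 r \<Longrightarrow> norm y \<le> C"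
    using compact_imp_bounded bounded_pos by metis
  show thesis
  proof
    show "norm (G x) \<le> C" for x
      using C G_zero[of x] by (cases "x \<in> cball 0 r") (auto simp: not_le)
  qed (fact C(1))
qed

lemma bounded_\<phi>: obtains C where "0 < C" "\<And>x. \<bar>\<phi> x\<bar> \<le> C"
proof -
  have "compact (\<phi> ` cball 0 r)"
    by (intro compact_continuous_image continuous_on_subset[OF cont]) auto
  then obtain C where C: "0 < C" "\<And>y. y \<in> \<phi> ` cball 0 r \<Longrightarrow> norm y \<le> C"
    using compact_imp_bounded bounded_pos by metis
  show thesis
  proof
    show "\<bar>\<phi> x\<bar> \<le> C" for x
      using C zero[of x] by (cases "x \<in> cball 0 r") (auto simp: not_le)
  qed (fact C(1))
qed

lemma lipschitz: obtains C where "0 < C" "\<And>x y. \<bar>\<phi> x - \<phi> y\<bar> \<le> C * norm (x - y)"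
proof -
  obtain C where C: "0 < C" "\<And>x. norm (G x) \<le> C" using bounded_G by blast
  have "norm (\<phi> x - \<phi> y) \<le> C * norm (x - y)" for x y
  proof (rule differentiable_bound[of UNIV \<phi> "\<lambda>x h. G x \<bullet> h"])
    show "onorm (\<lambda>h. G x \<bullet> h) \<le> C" for x
      using C(2)[of x] by (intro onorm_le) (metis Cauchy_Schwarz_ineq2 mult_right_mono norm_ge_zero order_trans real_norm_def)
  qed (use der in \<open>auto simp: has_derivative_at_withinI\<close>)
  then show thesis using that C by auto
qed

lemma integrable_\<phi>: "integrable lborel \<phi>"
  by (rule integrable_continuous_compact_support[OF cont zero])

lemma DERIV_line:
  "((\<lambda>s. \<phi> (x + s *\<^sub>R e)) has_real_derivative (G (x + s *\<^sub>R e) \<bullet> e)) (at s)"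
proof -
  have "((\<lambda>s. \<phi> (x + s *\<^sub>R e)) has_derivative (\<lambda>h. G (x + s *\<^sub>R e) \<bullet> (h *\<^sub>R e))) (at s)"
    by (rule has_derivative_compose[OF _ der]) (auto intro!: derivative_eq_intros)
  then show ?thesis by (simp add: has_field_derivative_def mult.commute[of _ "_ \<bullet> e"])
qed

text \<open>The divergence theorem for \<open>\<phi>\<close> times the Lipschitz field \<open>u (b / max |u| b)\<^sup>N\<close>,
  whose divergence is \<open>N\<close> inside the ball of radius \<open>b\<close> and \<open>0\<close> outside.\<close>

lemma integral_truncated_radial_derivative:
  fixes b :: real
  assumes "0 \<le> b"
  shows "(\<integral>u. (u \<bullet> G u) * (b / max (norm u) b) ^ DIM('a) \<partial>lborel)
      = - real DIM('a) * (\<integral>u. indicator (ball 0 b) u * \<phi> u \<partial>lborel)" (is ?A)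
    and "integrable lborel (\<lambda>u. (u \<bullet> G u) * (b / max (norm u) b) ^ DIM('a))" (is ?B)
proof -
  define N where "N = DIM('a)"
  obtain C where C: "0 < C" "\<And>x. norm (G x) \<le> C" using bounded_G by blast
  show ?B
  proof (rule Bochner_Integration.integrable_bound)
    show "integrable lborel (\<lambda>x::'a. (\<bar>r\<bar> * C) * indicator (cball 0 r) x)" by (rule integrable_cball_indicator)
    show "AE u in lborel. norm ((u \<bullet> G u) * (b / max (norm u) b) ^ DIM('a)) \<le> norm ((\<bar>r\<bar> * C) * indicator (cball 0 r) u)"
    proof (rule AE_I2)
      fix u :: 'a
      have "\<bar>u \<bullet> G u\<bar> \<le> (\<bar>r\<bar> * C) * indicator (cball 0 r) u"
      proof (cases "norm u \<le> r")
        case True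
        then show ?thesis using C(2)[of u] C(1) Cauchy_Schwarz_ineq2[of u "G u"]
          by (auto intro!: order_trans[OF Cauchy_Schwarz_ineq2 mult_mono])
      qed (use G_zero[of u] in auto)
      moreover have "\<bar>(b / max (norm u) b) ^ DIM('a)\<bar> \<le> 1"
        using assms by (auto intro!: power_le_one simp: divide_le_eq max_def power_abs)
      ultimately show "norm ((u \<bullet> G u) * (b / max (norm u) b) ^ DIM('a)) \<le> norm ((\<bar>r\<bar> * C) * indicator (cball 0 r) u)"
        using mult_mono[of "\<bar>u \<bullet> G u\<bar>" "(\<bar>r\<bar> * C) * indicator (cball 0 r) u" "\<bar>(b / max (norm u) b) ^ DIM('a)\<bar>" 1] C(1)
        by (simp add: abs_mult)
    qed
  qed measurable
  show ?A
  proof (cases "b = 0")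
    case False
    then have b: "0 < b" using assms by simp
    define m where "m u = (b / max (norm u) b) ^ N" for u :: 'a
    have [measurable]: "m \<in> borel_measurable borel" unfolding m_def by measurable
    have m01: "0 \<le> m u" "m u \<le> 1" for u
      using b by (auto simp: m_def divide_le_eq intro!: power_le_one)
    have mlip: "\<bar>m u - m v\<bar> \<le> (real N / b) * norm (u - v)" for u v
    proof -
      have *: "\<bar>m u - m v\<bar> \<le> real N * \<bar>b / max (norm u) b - b / max (norm v) b\<bar>"
        unfolding m_def
        using norm_power_diff[of "b / max (norm u) b" "b / max (norm v) b" N] b by (simp add: divide_le_eq)
      have "\<bar>b / max (norm u) b - b / max (norm v) b\<bar>
         = b * \<bar>max (norm v) b - max (norm u) b\<bar> / (max (norm u) b * max (norm v) b)"
        using b by (simp add: diff_frac_eq abs_mult right_diff_distrib[symmetric])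
      also have "\<dots> \<le> b * norm (u - v) / (b * b)"
      proof (intro frac_le mult_mono)
        show "\<bar>max (norm v) b - max (norm u) b\<bar> \<le> norm (u - v)"
          using norm_triangle_ineq3[of u v] by (auto simp: max_def)
      qed (use b in auto)
      finally show ?thesis using * b mult_left_mono[of _ "norm (u - v) / b" "real N"]
        by (fastforce intro: order_trans)
    qed
    \<comment> \<open>Pointwise derivative along \<open>e\<close> of the \<open>e\<close>-component
      of \<phi> m u, valid off the sphere of radius \<open>b\<close>.\<close>
    define F' where "F' e u = (G u \<bullet> e) * (u \<bullet> e) * m u + \<phi> u * m u
        - (if b < norm u then \<phi> u * (u \<bullet> e)\<^sup>2 * N * m u / (norm u)\<^sup>2 else 0)" for e u :: 'a
    have main: "(\<integral>u. F' e u \<partial>lborel) = 0 \<and> integrable lborel (F' e)" if e: "e \<in> Basis" for e :: 'a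
    proof -
      define p where "p u = \<phi> u * (u \<bullet> e)" for u
      obtain C where C: "0 < C" "\<And>x y. \<bar>\<phi> x - \<phi> y\<bar> \<le> C * norm (x - y)" using lipschitz by blast
      obtain S where S: "0 < S" "\<And>x. \<bar>\<phi> x\<bar> \<le> S" using bounded_\<phi> by blast
      \<comment> \<open>The coordinate is truncated to make it bounded as well as Lipschitz; on the
        support of \<phi> the truncation changes nothing.\<close>
      define t where "t u = max (- \<bar>r\<bar>) (min \<bar>r\<bar> (u \<bullet> e))" for u
      have pt: "p u = \<phi> u * t u" for u
      proof (cases "r \<le> norm u")
        case False
        then have "\<bar>u \<bullet> e\<bar> \<le> \<bar>r\<bar>" using e Basis_le_norm[of e u] by linarith
        then show ?thesis by (auto simp: p_def t_def)
      qed (simp add: p_def zero)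
      have "\<bar>u \<bullet> e - v \<bullet> e\<bar> \<le> norm (u - v)" for u v
        using Basis_le_norm[OF e, of "u - v"] by (simp add: inner_diff_left)
      then have tl: "\<bar>t u - t v\<bar> \<le> 1 * norm (u - v)" for u v
        unfolding t_def by (smt (verit, ccfv_SIG))
      have tb: "\<bar>t u\<bar> \<le> \<bar>r\<bar>" for u unfolding t_def by auto
      have pb: "\<bar>p u\<bar> \<le> S * \<bar>r\<bar>" for u
        unfolding pt abs_mult using S tb by (intro mult_mono) auto
      have pl: "\<bar>p u - p v\<bar> \<le> (C * \<bar>r\<bar> + S * 1) * norm (u - v)" for u v
        unfolding pt by (rule lipschitz_mult_bounded[OF C(2) tl S(2) tb])
      have ml: "\<bar>m u\<bar> \<le> 1" for u using m01[of u] by simp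
      note lip = lipschitz_mult_bounded[OF pl mlip pb ml]
      have z: "r \<le> norm x \<Longrightarrow> p x * m x = 0" for x by (simp add: p_def zero)
      have ee: "e \<bullet> e = 1" using e by (simp add: inner_Basis)
      have d: "((\<lambda>s. p (u + s *\<^sub>R e) * m (u + s *\<^sub>R e)) has_real_derivative F' e u) (at 0)" if "norm u \<noteq> b" for u
      proof -
        have dp: "((\<lambda>s. p (u + s *\<^sub>R e)) has_real_derivative (G u \<bullet> e) * (u \<bullet> e) + \<phi> u) (at 0)"
          unfolding p_def using DERIV_line[of u e 0]
          by (auto intro!: derivative_eq_intros simp: ee inner_add_left)
        have n: "((\<lambda>s. norm (u + s *\<^sub>R e)) \<longlongrightarrow> norm u) (at 0)"
          by (auto intro!: tendsto_eq_intros)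
        show ?thesis
        proof (cases "norm u < b")
          case True
          have ev: "eventually (\<lambda>s. norm (u + s *\<^sub>R e) < b) (nhds 0)"
            using order_tendstoD(2)[OF n True] True by (simp add: eventually_nhds_conv_at)
          have "((\<lambda>s. m (u + s *\<^sub>R e)) has_real_derivative 0) (at 0)"
            by (subst DERIV_cong_ev[OF refl eventually_mono[OF ev] refl, of _ "\<lambda>_. 1"]) (use b in \<open>auto simp: m_def\<close>)
          from DERIV_mult[OF dp this] show ?thesis using True b by (simp add: F'_def m_def)
        next
          case False
          then have u: "b < norm u" using that by simp
          then have u0: "u \<noteq> 0" using b by auto
          have ev: "eventually (\<lambda>s. b < norm (u + s *\<^sub>R e)) (nhds 0)"
            using order_tendstoD(1)[OF n u] u by (simp add: eventually_nhds_conv_at)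
          have "((\<lambda>s. norm (u + s *\<^sub>R e)) has_derivative (\<lambda>h. (h *\<^sub>R e) \<bullet> sgn u)) (at 0)"
            by (rule has_derivative_compose[of "\<lambda>s. u + s *\<^sub>R e" _ _ _ norm "\<lambda>h. h \<bullet> sgn u"])
              (use u0 in \<open>auto intro!: derivative_eq_intros has_derivative_norm\<close>)
          then have dn: "((\<lambda>s. norm (u + s *\<^sub>R e)) has_real_derivative (u \<bullet> e) / norm u) (at 0)"
            unfolding has_field_derivative_def
            by (rule has_derivative_eq_rhs) (auto simp: sgn_div_norm inner_commute divide_inverse)
          have N0: "0 < N" by (simp add: N_def)
          have "((\<lambda>s. (b / norm (u + s *\<^sub>R e)) ^ N) has_real_derivative
              N * (b / norm u) ^ (N - 1) * (- b * ((u \<bullet> e) / norm u) / (norm u)\<^sup>2)) (at 0)"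
            using u0 dn by (auto intro!: derivative_eq_intros simp: power2_eq_square)
          also have "N * (b / norm u) ^ (N - 1) * (- b * ((u \<bullet> e) / norm u) / (norm u)\<^sup>2)
              = - ((u \<bullet> e) * N * m u / (norm u)\<^sup>2)"
            using N0 u u0 b by (cases N) (auto simp: m_def power2_eq_square)
          finally have "((\<lambda>s. m (u + s *\<^sub>R e)) has_real_derivative - ((u \<bullet> e) * N * m u / (norm u)\<^sup>2)) (at 0)"
            by (subst DERIV_cong_ev[OF refl eventually_mono[OF ev] refl, of _ "\<lambda>s. (b / norm (u + s *\<^sub>R e)) ^ N"])
              (auto simp: m_def max_def)
          from DERIV_mult[OF dp this] show ?thesis
            by (rule DERIV_cong) (use u in \<open>auto simp: F'_def p_def power2_eq_square algebra_simps\<close>)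
        qed
      qed
      have [measurable]: "F' e \<in> borel_measurable borel" unfolding F'_def by measurable
      have "AE u in lborel. ((\<lambda>s. p (u + s *\<^sub>R e) * m (u + s *\<^sub>R e)) has_real_derivative F' e u) (at 0)"
        using AE_norm_neq[of b] by eventually_elim (rule d)
      then show ?thesis
        using integral_directional_derivative_eq_0[where F="\<lambda>u. p u * m u" and e=e and F'="F' e", OF lip z]
          \<open>F' e \<in> borel_measurable borel\<close> by blast
    qed
    \<comment> \<open>Summing over \<open>e\<close> gives the divergence. Beyond radius
      \<open>b\<close>, where m is a multiple of |u|^(-N), the term N \<phi> m from div u cancels
      against the radial derivative of m.\<close>
    have sum: "(\<Sum>e\<in>Basis. F' e u) = (u \<bullet> G u) * m u + N * (indicator (ball 0 b) u * \<phi> u)" if "norm u \<noteq> b" for u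
    proof -
      have "(\<Sum>e\<in>Basis. (G u \<bullet> e) * (u \<bullet> e)) = u \<bullet> G u"
        by (subst euclidean_inner[of u "G u"]) (simp add: mult.commute)
      moreover have "(\<Sum>e\<in>Basis. (u \<bullet> e)\<^sup>2) = (norm u)\<^sup>2"
        unfolding power2_norm_eq_inner by (subst euclidean_inner[of u u]) (simp add: power2_eq_square)
      moreover have "(\<Sum>e\<in>Basis. F' e u) = (\<Sum>e\<in>Basis. (G u \<bullet> e) * (u \<bullet> e)) * m u + N * (\<phi> u * m u)
         - (if b < norm u then \<phi> u * (\<Sum>e\<in>Basis. (u \<bullet> e)\<^sup>2) * N * m u / (norm u)\<^sup>2 else 0)"
        unfolding F'_def by (simp add: sum.distrib sum_subtractf sum_distrib_left sum_distrib_right sum_divide_distrib N_def)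
      moreover have "m u = 1" if "norm u < b" using that b by (simp add: m_def)
      ultimately show ?thesis using that b by (auto simp: not_less)
    qed
    have "0 = (\<Sum>e\<in>Basis. \<integral>u. F' e u \<partial>lborel)" using main by simp
    also have "\<dots> = (\<integral>u. (\<Sum>e\<in>Basis. F' e u) \<partial>lborel)"
      by (rule Bochner_Integration.integral_sum[symmetric]) (use main in simp)
    also have "\<dots> = (\<integral>u. (u \<bullet> G u) * m u + N * (indicator (ball 0 b) u * \<phi> u) \<partial>lborel)"
    proof (rule integral_cong_AE)
      show "(\<lambda>x. \<Sum>e\<in>Basis. F' e x) \<in> borel_measurable lborel" unfolding F'_def by measurable
      show "(\<lambda>u. (u \<bullet> G u) * m u + N * (indicator (ball 0 b) u * \<phi> u)) \<in> borel_measurable lborel"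
        unfolding measurable_lborel1 by measurable
    qed (use AE_norm_neq[of b] sum in \<open>auto elim: eventually_mono\<close>)
    also have "\<dots> = (\<integral>u. (u \<bullet> G u) * m u \<partial>lborel) + (\<integral>u. N * (indicator (ball 0 b) u * \<phi> u) \<partial>lborel)"
      by (rule Bochner_Integration.integral_add) (use \<open>?B\<close> in \<open>auto simp: m_def N_def intro!: integrable_mult_right
            integrable_real_mult_indicator[OF _ integrable_\<phi>, simplified mult.commute[of "\<phi> _"]]\<close>)
    finally show ?thesis by (simp add: m_def N_def)
  qed simp
qed

lemma integral_inner_gradient: "(\<integral>u. u \<bullet> G u \<partial>lborel) = - real DIM('a) * (\<integral>u. \<phi> u \<partial>lborel)"
proof -
  let ?b = "\<bar>r\<bar> + 1"
  have 1: "(u \<bullet> G u) * (?b / max (norm u) ?b) ^ DIM('a) = u \<bullet> G u" for u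
  proof (cases "r < norm u")
    case False
    then have "max (norm u) ?b = ?b" by simp
    then show ?thesis by simp
  qed (simp add: G_zero)
  have 2: "indicator (ball 0 ?b) u * \<phi> u = \<phi> u" for u
    using zero[of u] by (auto simp: indicator_def)
  show "(\<integral>u. u \<bullet> G u \<partial>lborel) = - real DIM('a) * (\<integral>u. \<phi> u \<partial>lborel)"
    using integral_truncated_radial_derivative(1)[of ?b] unfolding 1 2 by auto
qed

text \<open>Minus the flux of \<open>\<nabla>\<phi>\<close> against \<open>u / |u|\<^sup>N\<close> outside the ball of radius \<open>a\<close>; it equals
  the area of the unit sphere times the mean of \<open>\<phi>\<close> on the sphere of radius \<open>a\<close>.\<close>

definition flux :: "real \<Rightarrow> real" where
  "flux a = - (\<integral>u. indicator {u. a < norm u} u * ((u \<bullet> G u) / norm u ^ DIM('a)) \<partial>lborel)"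

lemma radial_derivative_bound:
  obtains C where "0 < C"
    "\<And>u. \<bar>(u \<bullet> G u) / norm u ^ DIM('a)\<bar> \<le> C * (indicator (cball 0 \<bar>r\<bar>) u * inverse (norm u ^ (DIM('a) - 1)))"
proof -
  obtain C where C: "0 < C" "\<And>x. norm (G x) \<le> C" using bounded_G by blast
  show thesis
  proof
    fix u
    show "\<bar>(u \<bullet> G u) / norm u ^ DIM('a)\<bar> \<le> C * (indicator (cball 0 \<bar>r\<bar>) u * inverse (norm u ^ (DIM('a) - 1)))"
    proof (cases "u = 0 \<or> r < norm u")
      case False
      have "\<bar>u \<bullet> G u\<bar> \<le> norm u * C"
        using C(2)[of u] by (intro order_trans[OF Cauchy_Schwarz_ineq2] mult_left_mono) auto
      then have "\<bar>u \<bullet> G u\<bar> / norm u ^ DIM('a) \<le> norm u * C / norm u ^ DIM('a)"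
        by (rule divide_right_mono) simp
      also have "\<dots> = C * inverse (norm u ^ (DIM('a) - 1))"
        using False DIM_positive[where 'a='a] by (cases "DIM('a)") (auto simp: field_simps)
      finally show ?thesis using False abs_ge_self[of r] by (simp add: indicator_def)
    next
      case True
      then show ?thesis using C G_zero[of u] by (auto simp: zero_power)
    qed
  qed (fact C(1))
qed

lemma integrable_flux:
  "integrable lborel (\<lambda>u. indicator {u. a < norm u} u * ((u \<bullet> G u) / norm u ^ DIM('a)))"
proof -
  obtain C where C: "0 < C"
    "\<And>u. \<bar>(u \<bullet> G u) / norm u ^ DIM('a)\<bar> \<le> C * (indicator (cball 0 \<bar>r\<bar>) u * inverse (norm u ^ (DIM('a) - 1)))"
    by (rule radial_derivative_bound) blast
  show ?thesis
  proof (rule Bochner_Integration.integrable_bound)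
    show "integrable lborel (\<lambda>u::'a. C * (indicator (cball 0 \<bar>r\<bar>) u * inverse (norm u ^ (DIM('a) - 1))))"
      by (intro integrable_mult_right integrable_inverse_norm_power) simp
    show "AE u in lborel. norm (indicator {u. a < norm u} u * ((u \<bullet> G u) / norm u ^ DIM('a)))
       \<le> norm (C * (indicator (cball 0 \<bar>r\<bar>) u * inverse (norm u ^ (DIM('a) - 1))))"
    proof (rule AE_I2)
      fix u :: 'a
      have "norm (indicator {u. a < norm u} u * ((u \<bullet> G u) / norm u ^ DIM('a))) \<le> \<bar>(u \<bullet> G u) / norm u ^ DIM('a)\<bar>"
        by (auto simp: indicator_def)
      then show "norm (indicator {u. a < norm u} u * ((u \<bullet> G u) / norm u ^ DIM('a)))
       \<le> norm (C * (indicator (cball 0 \<bar>r\<bar>) u * inverse (norm u ^ (DIM('a) - 1))))"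
        using C(2)[of u] unfolding real_norm_def by linarith
    qed
  qed measurable
qed

text \<open>Subtract \<open>integral_truncated_radial_derivative\<close> at the radii
  \<open>a\<close> and \<open>b n\<close> and divide by the difference of the N-th powers. For u
  other than 0 the quotients of the cut-offs are dominated by |u|^(-N), tend to it outside radius
  \<open>a\<close>, and vanish inside. Presenting \<open>flux\<close> as a limit of shell averages
  transfers bounds on \<phi> to it without surface integrals.\<close>

lemma shell_averages_tendsto_flux:
  assumes a: "0 \<le> a"
  defines "b \<equiv> \<lambda>n. a + 1 / (real n + 1)"
  shows "(\<lambda>n. real DIM('a) * (\<integral>u. indicator (ball 0 (b n) - ball 0 a) u * \<phi> u \<partial>lborel)
       / (b n ^ DIM('a) - a ^ DIM('a))) \<longlonglongrightarrow> flux a"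
proof -
  define N where "N = DIM('a)"
  have N: "0 < N" by (simp add: N_def)
  define s where "s c u = (c / max (norm u) c) ^ N" for c and u :: 'a
  define q where "q n u = (s (b n) u - s a u) / (b n ^ N - a ^ N)" for n u
  have b: "a < b n" for n by (simp add: b_def)
  have bN: "a ^ N < b n ^ N" for n using b[of n] a N by (simp add: power_strict_mono)
  have blim: "b \<longlonglongrightarrow> a"
    using tendsto_add[OF tendsto_const[of a] LIMSEQ_inverse_real_of_nat] by (simp add: b_def[abs_def] field_simps)
  obtain C where C: "0 < C"
    "\<And>u. \<bar>(u \<bullet> G u) / norm u ^ DIM('a)\<bar> \<le> C * (indicator (cball 0 \<bar>r\<bar>) u * inverse (norm u ^ (DIM('a) - 1)))"
    by (rule radial_derivative_bound) blast
  have s_in: "s c u = 1" if "norm u \<le> c" "u \<noteq> 0" for c u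
    using that by (auto simp: s_def max_def)
  have s_out: "s c u = c ^ N / norm u ^ N" if "c < norm u" for c u
    using that by (simp add: s_def max_def power_divide)
  have q_bound: "\<bar>q n u\<bar> \<le> 1 / norm u ^ N" if "u \<noteq> 0" for n u
  proof -
    consider "norm u \<le> a" | "a < norm u" "norm u \<le> b n" | "b n < norm u" using b[of n] by linarith
    then show ?thesis
    proof cases
      case 1
      then show ?thesis using that b[of n] s_in[of u a] s_in[of u "b n"] by (simp add: q_def)
    next
      case 2
      then have "norm u ^ N \<le> b n ^ N" "a ^ N \<le> norm u ^ N" by (auto intro: power_mono a)
      moreover have "q n u = ((norm u ^ N - a ^ N) / (b n ^ N - a ^ N)) / norm u ^ N"
        using 2 that s_in[of u "b n"] s_out[of a u] by (simp add: q_def diff_divide_distrib)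
      moreover have "0 \<le> (norm u ^ N - a ^ N) / (b n ^ N - a ^ N)" "(norm u ^ N - a ^ N) / (b n ^ N - a ^ N) \<le> 1"
        using bN[of n] calculation by (auto simp: divide_le_eq)
      ultimately show ?thesis by (simp add: abs_mult divide_right_mono del: divide_divide_eq_left)
    next
      case 3
      then show ?thesis
        using s_out[of "b n" u] s_out[of a u] b[of n] bN[of n] by (simp add: q_def diff_divide_distrib[symmetric])
    qed
  qed
  have q_lim: "(\<lambda>n. q n u) \<longlonglongrightarrow> indicator {u. a < norm u} u / norm u ^ N" if "u \<noteq> 0" for u
  proof (cases "a < norm u")
    case True
    have "eventually (\<lambda>n. b n < norm u) sequentially" using order_tendstoD(2)[OF blim True] .
    then have "eventually (\<lambda>n. q n u = indicator {u. a < norm u} u / norm u ^ N) sequentially"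
    proof eventually_elim
      case (elim n)
      then show ?case using True bN[of n]
          s_out[of "b n" u] s_out[of a u] by (simp add: q_def diff_divide_distrib[symmetric])
    qed
    then show ?thesis by (rule tendsto_eventually)
  next
    case False
    then have "q n u = 0" for n using that b[of n] s_in[of u a] s_in[of u "b n"] by (simp add: q_def)
    then show ?thesis using False by simp
  qed
  have AE0: "AE u in lborel. u \<noteq> (0::'a)" by (rule AE_lborel_singleton)
  have "(\<lambda>n. \<integral>u. (u \<bullet> G u) * q n u \<partial>lborel) \<longlonglongrightarrow> (\<integral>u. indicator {u. a < norm u} u * ((u \<bullet> G u) / norm u ^ N) \<partial>lborel)"
  proof (rule integral_dominated_convergence)
    show "integrable lborel (\<lambda>u::'a. C * (indicator (cball 0 \<bar>r\<bar>) u * inverse (norm u ^ (DIM('a) - 1))))"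
      by (intro integrable_mult_right integrable_inverse_norm_power) simp
    show "AE u in lborel. (\<lambda>n. (u \<bullet> G u) * q n u) \<longlonglongrightarrow> indicator {u. a < norm u} u * ((u \<bullet> G u) / norm u ^ N)"
      using AE0
    proof eventually_elim
      case (elim u)
      then show ?case using tendsto_mult[OF tendsto_const[of "u \<bullet> G u"] q_lim[OF elim]] by (simp add: mult.commute)
    qed
    show "AE u in lborel. norm ((u \<bullet> G u) * q n u) \<le> C * (indicator (cball 0 \<bar>r\<bar>) u * inverse (norm u ^ (DIM('a) - 1)))" for n
      using AE0
    proof eventually_elim
      case (elim u)
      have "norm ((u \<bullet> G u) * q n u) \<le> \<bar>u \<bullet> G u\<bar> * (1 / norm u ^ N)"
        unfolding real_norm_def abs_mult by (intro mult_left_mono q_bound elim) simp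
      then show ?case using C(2)[of u] by (simp add: N_def)
    qed
    show "(\<lambda>u. (u \<bullet> G u) * q n u) \<in> borel_measurable lborel" for n
      unfolding q_def s_def by measurable
  qed (unfold N_def, measurable)
  then have lim: "(\<lambda>n. - (\<integral>u. (u \<bullet> G u) * q n u \<partial>lborel)) \<longlonglongrightarrow> flux a"
    unfolding flux_def N_def by (rule tendsto_minus)
  have int: "integrable lborel (\<lambda>u. indicator (ball 0 c) u * \<phi> u)" for c
    using integrable_real_mult_indicator[OF _ integrable_\<phi>, of "ball 0 c"] by (simp add: mult.commute)
  have "- (\<integral>u. (u \<bullet> G u) * q n u \<partial>lborel) = real N * (\<integral>u. indicator (ball 0 (b n) - ball 0 a) u * \<phi> u \<partial>lborel)
       / (b n ^ N - a ^ N)" for n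
  proof -
    have b0: "0 \<le> b n" using b[of n] a by simp
    note I = integral_truncated_radial_derivative[OF b0, folded N_def] integral_truncated_radial_derivative[OF a, folded N_def]
    have "(\<integral>u. (u \<bullet> G u) * q n u \<partial>lborel) = (\<integral>u. ((u \<bullet> G u) * s (b n) u - (u \<bullet> G u) * s a u) / (b n ^ N - a ^ N) \<partial>lborel)"
      by (simp add: q_def algebra_simps diff_divide_distrib)
    also have "\<dots> = ((\<integral>u. (u \<bullet> G u) * s (b n) u \<partial>lborel) - (\<integral>u. (u \<bullet> G u) * s a u \<partial>lborel)) / (b n ^ N - a ^ N)"
      using I(2,4) by (simp add: s_def)
    also have "\<dots> = - (real N * ((\<integral>u. indicator (ball 0 (b n)) u * \<phi> u \<partial>lborel) - (\<integral>u. indicator (ball 0 a) u * \<phi> u \<partial>lborel)) / (b n ^ N - a ^ N))"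
      unfolding s_def I(1,3) by (simp add: algebra_simps minus_divide_left)
    also have "(\<integral>u. indicator (ball 0 (b n)) u * \<phi> u \<partial>lborel) - (\<integral>u. indicator (ball 0 a) u * \<phi> u \<partial>lborel)
      = (\<integral>u. indicator (ball 0 (b n) - ball 0 a) u * \<phi> u \<partial>lborel)"
      using b[of n] by (subst Bochner_Integration.integral_diff[symmetric, OF int int])
        (auto intro!: Bochner_Integration.integral_cong simp: indicator_def)
    finally show ?thesis by simp
  qed
  with lim show ?thesis by (simp add: N_def)
qed

lemma measure_shell:
  assumes "0 \<le> a" "a \<le> b"
  shows "(\<integral>u. indicator (ball 0 b - ball 0 a) (u::'a) \<partial>lborel) = unit_ball_vol DIM('a) * (b ^ DIM('a) - a ^ DIM('a))"
proof -
  have i: "integrable lborel (indicator (ball 0 c) :: 'a \<Rightarrow> real)" for c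
    using emeasure_lborel_ball_finite[of "0::'a" c] by simp
  have "(\<integral>u. indicator (ball 0 b - ball 0 a) (u::'a) \<partial>lborel) = (\<integral>u. indicator (ball 0 b) (u::'a) - indicator (ball 0 a) u \<partial>lborel)"
    using assms by (auto intro!: Bochner_Integration.integral_cong simp: indicator_def)
  also have "\<dots> = measure lborel (ball (0::'a) b) - measure lborel (ball (0::'a) a)"
    using i by simp
  finally show ?thesis
    using assms content_ball[of b "0::'a"] content_ball[of a "0::'a"] by (simp add: algebra_simps)
qed

text \<open>An average of \<phi> over a shell lies between 0 and \<open>S\<close>, and the volume of
  the shell is the divisor up to the factor \<open>unit_ball_vol\<close>; both bounds pass to the
  limit.\<close>

lemma
  assumes a: "0 \<le> a" and \<phi>: "\<And>u. 0 \<le> \<phi> u" "\<And>u. \<phi> u \<le> S"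
  shows flux_nonneg: "0 \<le> flux a" and flux_le: "flux a \<le> sphere_area TYPE('a) * S"
proof -
  define b where "b n = a + 1 / (real n + 1)" for n
  define x where "x n = real DIM('a) * (\<integral>u. indicator (ball 0 (b n) - ball 0 a) u * \<phi> u \<partial>lborel)
       / (b n ^ DIM('a) - a ^ DIM('a))" for n
  have lim: "x \<longlonglongrightarrow> flux a" unfolding x_def[abs_def] b_def by (rule shell_averages_tendsto_flux[OF a])
  have b: "a < b n" for n by (simp add: b_def)
  have bN: "a ^ DIM('a) < b n ^ DIM('a)" for n using b[of n] a by (simp add: power_strict_mono)
  have "0 \<le> x n" for n
    unfolding x_def using bN[of n] \<phi> by (intro divide_nonneg_nonneg mult_nonneg_nonneg Bochner_Integration.integral_nonneg) auto
  then show "0 \<le> flux a" by (intro LIMSEQ_le_const[OF lim]) auto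
  have "x n \<le> sphere_area TYPE('a) * S" for n
  proof -
    have fin: "emeasure lborel (ball (0::'a) (b n) - ball 0 a) < \<infinity>"
      using emeasure_mono[of "ball (0::'a) (b n) - ball 0 a" "ball 0 (b n)" lborel] emeasure_lborel_ball_finite[of "0::'a" "b n"]
      by (auto simp: le_less_trans)
    have "(\<integral>u. indicator (ball 0 (b n) - ball 0 a) u * \<phi> u \<partial>lborel) \<le> (\<integral>u. indicator (ball 0 (b n) - ball 0 a) (u::'a) * S \<partial>lborel)"
      using \<phi> fin
      by (intro integral_mono) (auto intro!: mult_left_mono integrable_mult_left integrable_real_indicator
          integrable_real_mult_indicator[OF _ integrable_\<phi>, simplified mult.commute[of "\<phi> _"]])
    also have "\<dots> = unit_ball_vol DIM('a) * (b n ^ DIM('a) - a ^ DIM('a)) * S"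
      using measure_shell[of a "b n"] a b[of n] by simp
    finally show ?thesis
      using bN[of n] by (simp add: x_def divide_le_eq sphere_area_def) (simp add: algebra_simps)
  qed
  then show "flux a \<le> sphere_area TYPE('a) * S" by (intro LIMSEQ_le_const2[OF lim]) auto
qed

text \<open>The shells at radius 0 are shrinking balls, so continuity of \<phi> at the origin
  identifies the limit. This expresses that the Newtonian kernel is a fundamental solution, and it
  is the source of the term - \<rho> in div V.\<close>

lemma flux_0: "flux 0 = sphere_area TYPE('a) * \<phi> 0"
proof -
  define b where "b n = 0 + 1 / (real n + 1)" for n
  define x where "x n = real DIM('a) * (\<integral>u. indicator (ball 0 (b n) - ball 0 0) u * \<phi> u \<partial>lborel)
       / (b n ^ DIM('a) - 0 ^ DIM('a))" for n
  have lim: "x \<longlonglongrightarrow> flux 0" unfolding x_def[abs_def] b_def by (rule shell_averages_tendsto_flux) simp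
  have b: "0 < b n" for n by (simp add: b_def)
  have blim: "b \<longlonglongrightarrow> 0"
    using LIMSEQ_inverse_real_of_nat by (simp add: b_def[abs_def] field_simps)
  let ?s = "sphere_area TYPE('a)"
  have "x \<longlonglongrightarrow> ?s * \<phi> 0"
  proof (rule LIMSEQ_I)
    fix e :: real assume "0 < e"
    define e' where "e' = e / (2 * ?s)"
    have e': "0 < e'" "?s * e' < e" using \<open>0 < e\<close> sphere_area_pos[where 'a='a] by (auto simp: e'_def)
    obtain d where d: "0 < d" "\<And>u. norm u < d \<Longrightarrow> \<bar>\<phi> u - \<phi> 0\<bar> < e'"
      using cont e'(1) unfolding continuous_on_iff by (metis UNIV_I dist_norm diff_zero real_norm_def)
    obtain n0 where n0: "\<And>n. n \<ge> n0 \<Longrightarrow> b n < d"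
      using order_tendstoD(2)[OF blim d(1)] by (auto simp: eventually_sequentially)
    have "norm (x n - ?s * \<phi> 0) < e" if n: "n \<ge> n0" for n
    proof -
      define B where "B = ball (0::'a) (b n)"
      have fin: "emeasure lborel B < \<infinity>" unfolding B_def by (rule emeasure_lborel_ball_finite)
      have mB: "measure lborel B = unit_ball_vol DIM('a) * b n ^ DIM('a)"
        unfolding B_def using b[of n] content_ball[of "b n" "0::'a"] by simp
      have i1: "integrable lborel (\<lambda>u. indicator B u * c)" for c :: real
        using fin by (auto intro!: integrable_mult_left integrable_real_indicator simp: B_def)
      have i2: "integrable lborel (\<lambda>u. indicator B u * \<phi> u)"
        using integrable_real_mult_indicator[OF _ integrable_\<phi>, of B] by (simp add: mult.commute B_def)
      have "(\<integral>u. indicator B u * \<phi> u \<partial>lborel) - measure lborel B * \<phi> 0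
         = (\<integral>u. indicator B u * \<phi> u - indicator B u * \<phi> 0 \<partial>lborel)"
        using i1 i2 by (simp add: B_def)
      also have "\<bar>\<dots>\<bar> \<le> (\<integral>u. \<bar>indicator B u * \<phi> u - indicator B u * \<phi> 0\<bar> \<partial>lborel)"
        by (rule integral_abs_bound)
      also have "\<dots> \<le> (\<integral>u. indicator B u * e' \<partial>lborel)"
        by (rule integral_mono)
          (use i1 i2 d(2) n0[OF n] in \<open>auto simp: indicator_def B_def intro: less_imp_le\<close>)
      also have "\<dots> = measure lborel B * e'" by (simp add: B_def)
      finally have *: "\<bar>(\<integral>u. indicator B u * \<phi> u \<partial>lborel) - measure lborel B * \<phi> 0\<bar> \<le> measure lborel B * e'" .
      have x: "x n = real DIM('a) / b n ^ DIM('a) * (\<integral>u. indicator B u * \<phi> u \<partial>lborel)"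
        by (simp add: x_def B_def zero_power)
      have s: "?s = real DIM('a) / b n ^ DIM('a) * measure lborel B"
        using b[of n] by (simp add: mB sphere_area_def)
      have "x n - ?s * \<phi> 0 = real DIM('a) / b n ^ DIM('a) * ((\<integral>u. indicator B u * \<phi> u \<partial>lborel) - measure lborel B * \<phi> 0)"
        unfolding x s by (simp add: algebra_simps)
      then have "\<bar>x n - ?s * \<phi> 0\<bar> \<le> real DIM('a) / b n ^ DIM('a) * (measure lborel B * e')"
        using * b[of n] by (simp add: abs_mult mult_left_mono divide_right_mono)
      also have "\<dots> = ?s * e'" unfolding s by simp
      finally show ?thesis using e'(2) by simp
    qed
    then show "\<exists>no. \<forall>n\<ge>no. norm (x n - ?s * \<phi> 0) < e" by blast
  qed
  with lim show ?thesis by (rule LIMSEQ_unique)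
qed

end

section \<open>Smooth radial test functions\<close>

text \<open>The derivative is quantified instead of being \<open>deriv h\<close>, so that each
  closure lemma can supply an explicit formula for it.\<close>

primrec C_k_real :: "nat \<Rightarrow> (real \<Rightarrow> real) \<Rightarrow> bool" where
  "C_k_real 0 h \<longleftrightarrow> continuous_on UNIV h"
| "C_k_real (Suc k) h \<longleftrightarrow> (\<exists>h'. (\<forall>x. (h has_real_derivative h' x) (at x)) \<and> C_k_real k h')"

lemma C_k_real_Suc_imp: "C_k_real (Suc k) h \<Longrightarrow> C_k_real k h"
proof (induction k arbitrary: h)
  case 0
  then show ?case using DERIV_continuous_on[of UNIV h] by auto
next
  case (Suc k)
  then show ?case by (metis C_k_real.simps(2))
qed

lemma C_k_real_SucI:
  "(\<And>x. (h has_real_derivative h' x) (at x)) \<Longrightarrow> C_k_real k h' \<Longrightarrow> C_k_real (Suc k) h"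
  by auto

lemma C_k_real_uminus: "C_k_real k f \<Longrightarrow> C_k_real k (\<lambda>x. - f x)"
proof (induction k arbitrary: f)
  case (Suc k)
  then obtain f' where f: "\<And>x. (f has_real_derivative f' x) (at x)" "C_k_real k f'" by auto
  show ?case by (rule C_k_real_SucI[OF DERIV_minus[OF f(1)] Suc.IH[OF f(2)]])
qed (auto intro: continuous_intros)

lemma C_k_real_add: "C_k_real k f \<Longrightarrow> C_k_real k g \<Longrightarrow> C_k_real k (\<lambda>x. f x + g x)"
proof (induction k arbitrary: f g)
  case (Suc k)
  then obtain f' g' where f: "\<And>x. (f has_real_derivative f' x) (at x)" "C_k_real k f'"
    and g: "\<And>x. (g has_real_derivative g' x) (at x)" "C_k_real k g'" by auto
  show ?case by (rule C_k_real_SucI[OF DERIV_add[OF f(1) g(1)] Suc.IH[OF f(2) g(2)]])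
qed (auto intro: continuous_intros)

lemma C_k_real_mult: "C_k_real k f \<Longrightarrow> C_k_real k g \<Longrightarrow> C_k_real k (\<lambda>x. f x * g x)"
proof (induction k arbitrary: f g)
  case (Suc k)
  then obtain f' g' where f: "\<And>x. (f has_real_derivative f' x) (at x)" "C_k_real k f'"
    and g: "\<And>x. (g has_real_derivative g' x) (at x)" "C_k_real k g'" by auto
  have "C_k_real k (\<lambda>x. f' x * g x + g' x * f x)"
    using f(2) g(2) Suc.prems[THEN C_k_real_Suc_imp] by (intro C_k_real_add Suc.IH)
  then show ?case by (rule C_k_real_SucI[OF DERIV_mult[OF f(1) g(1)]])
qed (auto intro: continuous_intros)

lemma C_k_real_affine: "C_k_real k f \<Longrightarrow> C_k_real k (\<lambda>x. f (c * x + d))"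
proof (induction k arbitrary: f)
  case 0
  then show ?case by (auto intro!: continuous_on_compose2[of UNIV f] continuous_intros)
next
  case (Suc k)
  then obtain f' where f: "\<And>x. (f has_real_derivative f' x) (at x)" "C_k_real k f'" by auto
  have const: "C_k_real k (\<lambda>x. c)" for k and c :: real
    by (induction k arbitrary: c) (auto intro!: exI[of _ "\<lambda>x. 0"])
  have "((\<lambda>x. f (c * x + d)) has_real_derivative c * f' (c * x + d)) (at x)" for x
    by (rule DERIV_cong[OF DERIV_chain2[OF f(1)]]) (auto intro!: derivative_eq_intros)
  then show ?case by (rule C_k_real_SucI[OF _ C_k_real_mult[OF const[of k c] Suc.IH[OF f(2)]]])
qed

section \<open>The flat function exp(-1/x) and compactly supported bumps\<close>

primrec flat_poly :: "nat \<Rightarrow> real poly" where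
  "flat_poly 0 = 1"
| "flat_poly (Suc n) = [:0, 0, 1:] * (flat_poly n - pderiv (flat_poly n))"

definition flat_deriv :: "nat \<Rightarrow> real \<Rightarrow> real" where
  "flat_deriv n x = (if 0 < x then poly (flat_poly n) (1 / x) * exp (- (1 / x)) else 0)"

lemma poly_times_exp_minus_tendsto_0: "((\<lambda>u. poly p u * exp (- u)) \<longlongrightarrow> (0::real)) at_top"
proof -
  have "((\<lambda>u. \<Sum>i\<le>degree p. coeff p i * (u ^ i / exp u)) \<longlongrightarrow> (\<Sum>i\<le>degree p. coeff p i * 0)) at_top"
    by (intro tendsto_intros tendsto_power_div_exp_0)
  then show ?thesis by (simp add: poly_altdef exp_minus divide_inverse sum_distrib_right mult.assoc)
qed

text \<open>For x > 0 the derivative of p(1/x) exp(-1/x) is (1/x^2) (p - p')(1/x) exp(-1/x), which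
  is the recursion of \<open>flat_poly\<close>. At 0 the right difference quotient is again a
  polynomial in 1/x times exp(-1/x) and tends to 0, so every derivative extends by zero.\<close>

lemma flat_deriv_has_derivative: "(flat_deriv n has_real_derivative flat_deriv (Suc n) x) (at x)"
proof -
  consider "x < 0" | "0 < x" | "x = 0" by linarith
  then show ?thesis
  proof cases
    case 1
    have "eventually (\<lambda>y. y < 0) (nhds x)" using 1 eventually_nhds_in_open[of "{..<0}" x] by simp
    then have ev: "eventually (\<lambda>y. flat_deriv n y = (\<lambda>_. 0) y) (nhds x)" by eventually_elim (simp add: flat_deriv_def)
    show ?thesis using 1 by (subst DERIV_cong_ev[OF refl ev refl]) (simp add: flat_deriv_def)
  next
    case 2
    have "eventually (\<lambda>y. y \<in> {0<..}) (nhds x)" using 2 by (intro eventually_nhds_in_open) auto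
    then have ev: "eventually (\<lambda>y. flat_deriv n y = poly (flat_poly n) (1 / y) * exp (- (1 / y))) (nhds x)"
      by eventually_elim (simp add: flat_deriv_def)
    have inv: "((\<lambda>y. 1 / y) has_real_derivative - (1 / x\<^sup>2)) (at x)"
      using 2 by (auto intro!: derivative_eq_intros simp: power2_eq_square)
    have "((\<lambda>y. poly (flat_poly n) (1 / y)) has_real_derivative poly (pderiv (flat_poly n)) (1 / x) * - (1 / x\<^sup>2)) (at x)"
      by (rule DERIV_chain2[OF poly_DERIV inv])
    moreover have "((\<lambda>y. exp (- (1 / y))) has_real_derivative exp (- (1 / x)) * (1 / x\<^sup>2)) (at x)"
      using DERIV_fun_exp[OF DERIV_minus[OF inv]] by simp
    ultimately have "((\<lambda>y. poly (flat_poly n) (1 / y) * exp (- (1 / y))) has_real_derivative flat_deriv (Suc n) x) (at x)"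
      using 2 by (auto dest: DERIV_mult elim!: DERIV_cong simp: flat_deriv_def power2_eq_square algebra_simps)
    then show ?thesis by (subst DERIV_cong_ev[OF refl ev refl])
  next
    case 3
    have r: "((\<lambda>h. flat_deriv n h / h) \<longlongrightarrow> 0) (at_right 0)"
    proof -
      have "((\<lambda>h. poly ([:0, 1:] * flat_poly n) (inverse h) * exp (- (inverse h))) \<longlongrightarrow> 0) (at_right (0::real))"
        by (rule filterlim_compose[OF poly_times_exp_minus_tendsto_0 filterlim_inverse_at_top_right])
      moreover have "eventually (\<lambda>h. poly ([:0, 1:] * flat_poly n) (inverse h) * exp (- (inverse h)) = flat_deriv n h / h) (at_right (0::real))"
        using eventually_at_right_less[of 0] by eventually_elim (simp add: flat_deriv_def divide_inverse)
      ultimately show ?thesis by (rule Lim_transform_eventually)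
    qed
    have "eventually (\<lambda>h. 0 = flat_deriv n h / h) (at_left 0)"
      by (auto simp: eventually_at_left_field flat_deriv_def intro!: exI[of _ "-1"])
    then have "((\<lambda>h. flat_deriv n h / h) \<longlongrightarrow> 0) (at_left 0)"
      by (rule Lim_transform_eventually[rotated]) simp
    with r have "((\<lambda>h. flat_deriv n h / h) \<longlongrightarrow> 0) (at 0)" by (simp add: filterlim_at_split)
    then show ?thesis using 3 by (simp add: DERIV_def flat_deriv_def)
  qed
qed

lemma C_k_real_flat: "C_k_real k (flat_deriv n)"
proof (induction k arbitrary: n)
  case 0
  then show ?case using DERIV_continuous_on[of UNIV "flat_deriv n"] flat_deriv_has_derivative by auto
next
  case (Suc k)
  then show ?case using flat_deriv_has_derivative by auto
qed

definition bump :: "real \<Rightarrow> real \<Rightarrow> real \<Rightarrow> real" where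
  "bump a b s = flat_deriv 0 (s - a) * flat_deriv 0 (b - s)"

lemma C_k_real_bump: "C_k_real k (bump a b)"
proof -
  have "C_k_real k (\<lambda>s. flat_deriv 0 (1 * s + (- a)) * flat_deriv 0 ((-1) * s + b))"
    by (intro C_k_real_mult C_k_real_affine C_k_real_flat)
  then show ?thesis by (simp add: bump_def[abs_def])
qed

lemma bump_nonneg: "0 \<le> bump a b s"
  by (simp add: bump_def flat_deriv_def)

lemma bump_pos: "a < s \<Longrightarrow> s < b \<Longrightarrow> 0 < bump a b s"
  by (simp add: bump_def flat_deriv_def)

lemma bump_zero: "s \<le> a \<or> b \<le> s \<Longrightarrow> bump a b s = 0"
  by (auto simp: bump_def flat_deriv_def)

lemma bump_antiderivative:
  assumes "a \<le> b"
  obtains H where "\<And>s. (H has_real_derivative - bump a b s) (at s)" "\<And>s. b \<le> s \<Longrightarrow> H s = 0"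
    "\<And>s. s \<le> a \<Longrightarrow> H s = H a" "\<And>k. C_k_real k H"
proof -
  have c: "continuous_on UNIV (bump a b)" using C_k_real_bump[of 0 a b] by simp
  obtain F where F: "\<And>s. (F has_real_derivative bump a b s) (at s)"
    using einterval_antiderivative[of "-\<infinity>" \<infinity> "bump a b"] c
    by (auto simp: continuous_on_eq_continuous_at has_real_derivative_iff_has_vector_derivative)
  have const: "F s = F t" if "s \<le> t" "\<And>z. s < z \<Longrightarrow> z < t \<Longrightarrow> z \<le> a \<or> b \<le> z" for s t
  proof (cases "s = t")
    case False
    then have "\<exists>z>s. z < t \<and> F t - F s = (t - s) * bump a b z"
      using that(1) by (intro MVT2 F) auto
    then show ?thesis using that(2) by (auto simp: bump_zero)
  qed simp
  have der: "((\<lambda>s. F b - F s) has_real_derivative - bump a b s) (at s)" for s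
    using DERIV_diff[OF DERIV_const[of "F b"] F] by simp
  show thesis
  proof (rule that[OF der])
    show "F b - F s = 0" if "b \<le> s" for s
      using const[of b s] that by simp
    show "F b - F s = F b - F a" if "s \<le> a" for s
      using const[of s a] that by simp
    show "C_k_real k (\<lambda>s. F b - F s)" for k
      using C_k_real_SucI[OF der C_k_real_uminus[OF C_k_real_bump[of k]]] C_k_real_Suc_imp by blast
  qed
qed

section \<open>Several variables: products and radial functions\<close>

lemma partial_deriv_eq: "(f has_derivative f') (at x) \<Longrightarrow> partial_deriv b f x = f' b"
  by (simp add: partial_deriv_def frechet_derivative_at[symmetric])

lemma C_k_Suc_imp: "C_k (Suc k) f \<Longrightarrow> C_k k f"
proof (induction k arbitrary: f)
  case 0
  then show ?case by (auto intro!: continuous_at_imp_continuous_on differentiable_imp_continuous_within)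
next
  case (Suc k)
  then show ?case by (metis C_k.simps(2))
qed

lemma C_k_const: "C_k k (\<lambda>x. c)"
proof (induction k arbitrary: c)
  case (Suc k)
  have "partial_deriv b (\<lambda>x. c) = (\<lambda>x. 0)" for b :: 'a
    by (rule ext, rule partial_deriv_eq) (rule has_derivative_const)
  then show ?case using Suc by simp
qed simp

lemma C_k_inner: "C_k k (\<lambda>x. x \<bullet> v)"
proof (cases k)
  case (Suc j)
  have "partial_deriv b (\<lambda>x. x \<bullet> v) = (\<lambda>x. b \<bullet> v)" for b :: 'a
    by (rule ext, rule partial_deriv_eq[of _ "\<lambda>h. h \<bullet> v"]) (auto intro!: derivative_eq_intros)
  then show ?thesis using Suc by (auto simp: C_k_const)
qed (auto intro: continuous_intros)

lemma C_k_add: "C_k k f \<Longrightarrow> C_k k g \<Longrightarrow> C_k k (\<lambda>x. f x + g x)"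
proof (induction k arbitrary: f g)
  case (Suc k)
  have "partial_deriv b (\<lambda>x. f x + g x) = (\<lambda>x. partial_deriv b f x + partial_deriv b g x)" for b
  proof (rule ext)
    fix x
    have "((\<lambda>x. f x + g x) has_derivative (\<lambda>h. frechet_derivative f (at x) h + frechet_derivative g (at x) h)) (at x)"
      using Suc.prems by (intro has_derivative_add) (auto simp: frechet_derivative_works)
    from partial_deriv_eq[OF this] show "partial_deriv b (\<lambda>x. f x + g x) x = partial_deriv b f x + partial_deriv b g x"
      by (simp add: partial_deriv_def)
  qed
  then show ?case using Suc by (auto intro: derivative_intros)
qed (auto intro: continuous_intros)

lemma C_k_mult: "C_k k f \<Longrightarrow> C_k k g \<Longrightarrow> C_k k (\<lambda>x. f x * g x)"
proof (induction k arbitrary: f g)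
  case (Suc k)
  have eq: "partial_deriv b (\<lambda>x. f x * g x) = (\<lambda>x. f x * partial_deriv b g x + partial_deriv b f x * g x)" for b
  proof (rule ext)
    fix x
    have "((\<lambda>x. f x * g x) has_derivative (\<lambda>h. f x * frechet_derivative g (at x) h + frechet_derivative f (at x) h * g x)) (at x)"
      using Suc.prems by (intro has_derivative_mult) (auto simp: frechet_derivative_works)
    from partial_deriv_eq[OF this] show "partial_deriv b (\<lambda>x. f x * g x) x = f x * partial_deriv b g x + partial_deriv b f x * g x"
      by (simp add: partial_deriv_def)
  qed
  have "C_k k (partial_deriv b (\<lambda>x. f x * g x))" if "b \<in> Basis" for b
    unfolding eq using Suc.prems that C_k_Suc_imp[OF Suc.prems(1)] C_k_Suc_imp[OF Suc.prems(2)]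
    by (intro C_k_add Suc.IH) auto
  then show ?case using Suc.prems by (auto intro: derivative_intros)
qed (auto intro: continuous_intros)

lemma has_derivative_radial:
  fixes x :: "'a::real_inner"
  assumes "(h has_real_derivative h') (at (x \<bullet> x))"
  shows "((\<lambda>x. h (x \<bullet> x)) has_derivative (\<lambda>v. h' * (2 * (x \<bullet> v)))) (at x)"
proof -
  have "((\<lambda>x. x \<bullet> x) has_derivative (\<lambda>v. 2 * (x \<bullet> v))) (at x)"
    by (auto intro!: derivative_eq_intros simp: inner_commute)
  from has_derivative_compose[OF this assms[unfolded has_field_derivative_def]] show ?thesis by simp
qed

text \<open>Composing with the square \<open>x \<bullet> x\<close> rather than with the norm keeps
  smoothness at the origin. Each partial derivative is again a radial function times a linear one,
  which closes the induction.\<close>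

lemma C_k_radial: "C_k_real k h \<Longrightarrow> C_k k (\<lambda>x::'a::euclidean_space. h (x \<bullet> x))"
proof (induction k arbitrary: h)
  case 0
  then show ?case by (auto intro!: continuous_on_compose2[of UNIV h] continuous_intros)
next
  case (Suc k)
  then obtain h' where h: "\<And>x. (h has_real_derivative h' x) (at x)" "C_k_real k h'" by auto
  have eq: "partial_deriv b (\<lambda>x::'a. h (x \<bullet> x)) = (\<lambda>x. h' (x \<bullet> x) * (x \<bullet> (2 *\<^sub>R b)))" for b
    by (rule ext) (subst partial_deriv_eq[OF has_derivative_radial[OF h(1)]], simp)
  have "(\<lambda>x::'a. h (x \<bullet> x)) differentiable (at x)" for x
    using has_derivative_radial[OF h(1)] by (rule differentiableI)
  moreover have "C_k k (partial_deriv b (\<lambda>x::'a. h (x \<bullet> x)))" for b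
    unfolding eq by (intro C_k_mult Suc.IH h C_k_inner)
  ultimately show ?case by simp
qed

lemma laplacian_radial:
  fixes x :: "'a::euclidean_space"
  assumes "\<And>s. (h has_real_derivative h' s) (at s)" "\<And>s. (h' has_real_derivative h'' s) (at s)"
  shows "laplacian (\<lambda>x::'a. h (x \<bullet> x)) x = 4 * (norm x)\<^sup>2 * h'' ((norm x)\<^sup>2) + 2 * real DIM('a) * h' ((norm x)\<^sup>2)"
proof -
  have eq: "partial_deriv b (\<lambda>x::'a. h (x \<bullet> x)) = (\<lambda>x. h' (x \<bullet> x) * (2 * (x \<bullet> b)))" for b
    by (rule ext) (subst partial_deriv_eq[OF has_derivative_radial[OF assms(1)]], simp)
  have "partial_deriv b (partial_deriv b (\<lambda>x::'a. h (x \<bullet> x))) x = 4 * (x \<bullet> b)\<^sup>2 * h'' (x \<bullet> x) + 2 * h' (x \<bullet> x)"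
    if "b \<in> Basis" for b
  proof -
    have "((\<lambda>x. h' (x \<bullet> x) * (2 * (x \<bullet> b))) has_derivative
      (\<lambda>v. h' (x \<bullet> x) * (2 * (v \<bullet> b)) + h'' (x \<bullet> x) * (2 * (x \<bullet> v)) * (2 * (x \<bullet> b)))) (at x)"
      by (rule has_derivative_mult[OF has_derivative_radial[OF assms(2)]]) (auto intro!: derivative_eq_intros)
    from partial_deriv_eq[OF this] that show ?thesis
      by (simp add: eq inner_Basis power2_eq_square algebra_simps)
  qed
  then have "laplacian (\<lambda>x::'a. h (x \<bullet> x)) x = (\<Sum>b\<in>Basis. 4 * (x \<bullet> b)\<^sup>2 * h'' (x \<bullet> x) + 2 * h' (x \<bullet> x))"
    by (simp add: laplacian_def)
  also have "\<dots> = 4 * (\<Sum>b\<in>Basis. (x \<bullet> b)\<^sup>2) * h'' (x \<bullet> x) + 2 * real DIM('a) * h' (x \<bullet> x)"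
    by (simp add: sum.distrib sum_distrib_left sum_distrib_right)
  also have "(\<Sum>b\<in>Basis. (x \<bullet> b)\<^sup>2) = (norm x)\<^sup>2"
    unfolding power2_norm_eq_inner by (subst euclidean_inner[of x x]) (simp add: power2_eq_square)
  finally show ?thesis by (simp add: power2_norm_eq_inner)
qed

lemma test_function_radial:
  assumes "\<And>k. C_k_real k h" "\<And>s. b \<le> s \<Longrightarrow> h s = 0"
  shows "test_function (\<lambda>x::'a::euclidean_space. h (x \<bullet> x))"
proof -
  have "{x::'a. h (x \<bullet> x) \<noteq> 0} \<subseteq> cball 0 (sqrt \<bar>b\<bar>)"
  proof
    fix x :: 'a assume "x \<in> {x. h (x \<bullet> x) \<noteq> 0}"
    then have "x \<bullet> x \<le> \<bar>b\<bar>" using assms(2)[of "x \<bullet> x"] by force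
    then show "x \<in> cball 0 (sqrt \<bar>b\<bar>)" by (simp add: norm_eq_sqrt_inner)
  qed
  then have "bounded {x::'a. h (x \<bullet> x) \<noteq> 0}" using bounded_cball bounded_subset by blast
  then have "compact (supp (\<lambda>x::'a. h (x \<bullet> x)))" by (simp add: supp_def compact_closure)
  then show ?thesis using assms(1) by (simp add: test_function_def C_k_radial)
qed

section \<open>The radial derivative of a potential with locally integrable Laplacian\<close>

lemma integrable_product_times:
  fixes f :: "'a::euclidean_space \<Rightarrow> real" and g :: "'b::euclidean_space \<Rightarrow> real"
  assumes f: "integrable lborel f" and g: "integrable lborel g"
  shows "integrable (lborel \<Otimes>\<^sub>M lborel) (\<lambda>(x, y). f x * g y)"
proof (rule lborel_pair.Fubini_integrable)
  have [measurable]: "f \<in> borel_measurable borel" "g \<in> borel_measurable borel" using f g by auto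
  show "(\<lambda>(x, y). f x * g y) \<in> borel_measurable (lborel \<Otimes>\<^sub>M lborel)" by measurable
  show "integrable lborel (\<lambda>x. \<integral>y. norm (case (x, y) of (x, y) \<Rightarrow> f x * g y) \<partial>lborel)"
    using f g by (simp add: abs_mult integrable_abs)
  show "AE x in lborel. integrable lborel (\<lambda>y. case (x, y) of (x, y) \<Rightarrow> f x * g y)"
    using g by simp
qed

text \<open>Products and reflections are used with \<open>lborel\<close>, which calls for a Borel
  function, while a weak Laplacian is only Lebesgue measurable. Measurability of \<open>g0\<close>
  on the whole space comes from its truncations to balls.\<close>

lemma locally_integrable_borel_representative:
  fixes g0 :: "'a::euclidean_space \<Rightarrow> real"
  assumes "locally_integrable g0"
  obtains g where "g \<in> borel_measurable borel" "AE x in lborel. g0 x = g x" "g0 \<in> borel_measurable lebesgue"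
    "\<And>r. integrable lborel (\<lambda>x. indicator (cball 0 r) x * g x)"
proof -
  have i: "integrable lebesgue (\<lambda>x. indicator (cball 0 r) x * g0 x)" for r
    using assms by (auto simp: locally_integrable_def set_integrable_def)
  have m: "g0 \<in> borel_measurable lebesgue"
  proof (rule borel_measurable_LIMSEQ_real)
    show "(\<lambda>n. indicator (cball 0 (real n)) x * g0 x) \<longlonglongrightarrow> g0 x" for x
    proof (rule tendsto_eventually)
      show "\<forall>\<^sub>F n in sequentially. indicator (cball 0 (real n)) x * g0 x = g0 x"
        using eventually_ge_at_top[of "nat \<lceil>norm x\<rceil>"] by eventually_elim (auto simp: nat_le_iff ceiling_le_iff)
    qed
    show "(\<lambda>x. indicator (cball 0 (real n)) x * g0 x) \<in> borel_measurable lebesgue" for n using i[of n] by auto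
  qed
  obtain g where g: "g \<in> borel_measurable lborel" "AE x in lborel. g0 x = g x"
    using completion_ex_borel_measurable_real[OF m] by blast
  have [measurable]: "g \<in> borel_measurable borel" using g(1) by simp
  have "integrable lborel (\<lambda>x. indicator (cball 0 r) x * g x)" for r
  proof -
    have gm: "(\<lambda>x. indicator (cball 0 r) x * g x) \<in> borel_measurable lborel"
      unfolding measurable_lborel1 measurable_lborel2 by measurable
    have "integrable lebesgue (\<lambda>x. indicator (cball 0 r) x * g x)"
    proof (rule integrable_cong_AE_imp[OF i[of r]])
      show "(\<lambda>x. indicator (cball 0 r) x * g x) \<in> borel_measurable lebesgue"
        using gm by (rule measurable_completion)
      show "AE x in lebesgue. indicator (cball 0 r) x * g0 x = indicator (cball 0 r) x * g x"
        using AE_completion[OF g(2)] by eventually_elim simp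
    qed
    then show ?thesis using integrable_completion[OF gm] by simp
  qed
  with g m show thesis by (intro that[of g]) auto
qed

text \<open>Spheres are null sets, so the indicators converge almost everywhere when the radii
  converge; the integrand over a larger ball dominates.\<close>

lemma integral_truncated_ball_isCont:
  fixes g :: "'a::euclidean_space \<Rightarrow> real"
  assumes [measurable]: "g \<in> borel_measurable borel" and int: "\<And>r. integrable lborel (\<lambda>x. indicator (cball 0 r) x * g x)"
  shows "isCont (\<lambda>r. \<integral>x. indicator {x. norm x < r} x * g x \<partial>lborel) r0"
  unfolding continuous_at_sequentially
proof (intro allI impI)
  fix X assume X: "X \<longlonglongrightarrow> r0"
  then obtain R where R: "\<And>n. \<bar>X n\<bar> \<le> R" using convergent_imp_Bseq[of X] by (auto simp: convergent_def Bseq_def)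
  have "(\<lambda>n. \<integral>x. indicator {x. norm x < X n} x * g x \<partial>lborel) \<longlonglongrightarrow> (\<integral>x. indicator {x. norm x < r0} x * g x \<partial>lborel)"
  proof (rule integral_dominated_convergence)
    show "integrable lborel (\<lambda>x. \<bar>indicator (cball 0 R) x * g x\<bar>)" using int by (rule integrable_abs)
    show "AE x in lborel. norm (indicator {x. norm x < X n} x * g x) \<le> \<bar>indicator (cball 0 R) x * g x\<bar>" for n
      using R[of n] by (auto simp: indicator_def)
    have "AE x in lborel. norm (x::'a) \<noteq> r0" by (rule AE_norm_neq)
    then show "AE x in lborel. (\<lambda>n. indicator {x. norm x < X n} x * g x) \<longlonglongrightarrow> indicator {x. norm x < r0} x * g x"
    proof eventually_elim
      case (elim x)
      consider "norm x < r0" | "r0 < norm x" using elim by linarith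
      then have "eventually (\<lambda>n. indicator {x. norm x < X n} x * g x = indicator {x. norm x < r0} x * g x) sequentially"
      proof cases
        case 1
        show ?thesis using order_tendstoD(1)[OF X 1] by eventually_elim (use 1 in \<open>auto simp: indicator_def\<close>)
      next
        case 2
        show ?thesis using order_tendstoD(2)[OF X 2] by eventually_elim (use 2 in \<open>auto simp: indicator_def\<close>)
      qed
      then show ?case by (rule tendsto_eventually)
    qed
  qed measurable
  then show "((\<lambda>r. \<integral>x. indicator {x. norm x < r} x * g x \<partial>lborel) \<circ> X) \<longlonglongrightarrow> (\<integral>x. indicator {x. norm x < r0} x * g x \<partial>lborel)"
    by (simp add: o_def)
qed

text \<open>Testing the weak Laplacian against \<open>\<phi>(x) = H(|x|\<^sup>2)\<close> with \<open>H' = - bump\<close>, which is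
  constant near the origin, so that no a priori regularity of \<open>Wa\<close> there is needed.\<close>

lemma radial_weak_laplacian_tested:
  fixes Wa :: "'a::euclidean_space \<Rightarrow> real"
  assumes wl: "weak_laplacian Wa g0" and rad: "\<And>x. x \<noteq> 0 \<Longrightarrow> Wa x = w (norm x)"
    and w: "\<And>r. 0 < r \<Longrightarrow> (w has_real_derivative w' r) (at r)" "continuous_on {0<..} w'"
    and g[measurable]: "g \<in> borel_measurable borel" and g0: "AE x in lborel. g0 x = g x" "g0 \<in> borel_measurable lebesgue"
    and int: "\<And>r. integrable lborel (\<lambda>x. indicator (cball 0 r) x * g x)"
    and AB: "0 < A" "A < B"
  shows "(\<integral>r. indicator {A..B} r * (2 * r * bump (A\<^sup>2) (B\<^sup>2) (r\<^sup>2) * (sphere_area TYPE('a) * r ^ (DIM('a) - 1) * w' r)) \<partial>lborel)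
     = (\<integral>r. indicator {A..B} r * (2 * r * bump (A\<^sup>2) (B\<^sup>2) (r\<^sup>2) * (\<integral>x. indicator {x. norm x < r} x * g x \<partial>lborel)) \<partial>lborel)"
proof -
  let ?N = "DIM('a)"
  define \<sigma> where "\<sigma> = sphere_area TYPE('a)"
  define \<beta> where "\<beta> = bump (A\<^sup>2) (B\<^sup>2)"
  have AB2: "A\<^sup>2 \<le> B\<^sup>2" using AB by (simp add: power_mono)
  obtain H where H: "\<And>s. (H has_real_derivative - \<beta> s) (at s)" "\<And>s. B\<^sup>2 \<le> s \<Longrightarrow> H s = 0" "\<And>s. s \<le> A\<^sup>2 \<Longrightarrow> H s = H (A\<^sup>2)"
    "\<And>k. C_k_real k H"
    unfolding \<beta>_def using bump_antiderivative[OF AB2] by blast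
  have "C_k_real (Suc 0) \<beta>" unfolding \<beta>_def by (rule C_k_real_bump)
  then obtain \<beta>' where \<beta>': "\<And>s. (\<beta> has_real_derivative \<beta>' s) (at s)" "continuous_on UNIV \<beta>'" by auto
  have \<beta>c: "continuous_on UNIV \<beta>" by (rule DERIV_continuous_on) (rule \<beta>'(1))
  have \<beta>0: "\<beta> s = 0" if "s \<le> A\<^sup>2 \<or> B\<^sup>2 \<le> s" for s using that unfolding \<beta>_def by (rule bump_zero)
  \<comment> \<open>A zero of the nonnegative \<beta> is a minimum, so the derivative vanishes there
    too.\<close>
  have \<beta>'0: "\<beta>' s = 0" if "s \<le> A\<^sup>2 \<or> B\<^sup>2 \<le> s" for s
    by (rule DERIV_local_min[OF \<beta>'(1) zero_less_one]) (use \<beta>0[OF that] bump_nonneg in \<open>auto simp: \<beta>_def\<close>)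
  have sq: "r\<^sup>2 \<le> A\<^sup>2 \<or> B\<^sup>2 \<le> r\<^sup>2" if "r \<notin> {A..B}" "0 \<le> r" for r
    using that AB by (auto simp: not_le intro: power_mono less_imp_le)
  define L where "L r = - (4 * r\<^sup>2 * \<beta>' (r\<^sup>2)) - 2 * real ?N * \<beta> (r\<^sup>2)" for r
  \<comment> \<open>\<open>u\<close> is r^(N-1) times the radial derivative of \<phi>, so its
    derivative, r^(N-1) times the Laplacian of \<phi>, is the radial Laplacian in divergence
    form.\<close>
  define u where "u r = - 2 * r ^ ?N * \<beta> (r\<^sup>2)" for r
  define u' where "u' r = r ^ (?N - 1) * L r" for r
  define \<phi> where "\<phi> x = H (x \<bullet> x)" for x :: 'a
  have lap: "laplacian \<phi> x = L (norm x)" for x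
    unfolding \<phi>_def[abs_def] laplacian_radial[OF H(1) DERIV_minus[OF \<beta>'(1)]] by (simp add: L_def)
  have u: "(u has_real_derivative u' r) (at r)" for r
  proof -
    have "((\<lambda>r. \<beta> (r\<^sup>2)) has_real_derivative \<beta>' (r\<^sup>2) * (2 * r)) (at r)"
      by (rule DERIV_chain2[OF \<beta>'(1)]) (auto intro!: derivative_eq_intros)
    moreover have "((\<lambda>r. - 2 * r ^ ?N) has_real_derivative - 2 * (real ?N * r ^ (?N - 1))) (at r)"
      by (auto intro!: derivative_eq_intros)
    ultimately have "(u has_real_derivative (- 2 * (real ?N * r ^ (?N - 1))) * \<beta> (r\<^sup>2) + (\<beta>' (r\<^sup>2) * (2 * r)) * (- 2 * r ^ ?N)) (at r)"
      unfolding u_def[abs_def] by (rule DERIV_mult[rotated, THEN DERIV_cong]) (simp add: algebra_simps)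
    moreover have "r ^ ?N = r * r ^ (?N - 1)" using DIM_positive[where 'a='a] by (cases ?N) auto
    ultimately show ?thesis by (elim DERIV_cong) (simp add: u'_def L_def power2_eq_square algebra_simps)
  qed
  have test: "test_function \<phi>" unfolding \<phi>_def by (rule test_function_radial[OF H(4,2)])
  define F where "F r = (if r \<in> {0<..} then w r * L r else 0)" for r
  have wc: "continuous_on {0<..} w" by (rule DERIV_continuous_on) (auto intro: w has_field_derivative_at_within)
  have Lc: "continuous_on S L" for S unfolding L_def
    by (intro continuous_intros continuous_on_compose2[OF \<beta>c] continuous_on_compose2[OF \<beta>'(2)]) auto
  have [measurable]: "F \<in> borel_measurable borel"
    unfolding F_def by (rule borel_measurable_continuous_on_if) (auto intro!: continuous_intros wc Lc)
  \<comment> \<open>The Laplacian of \<phi> vanishes at the origin, which removes the value of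
    \<open>Wa\<close> there.\<close>
  have WF: "Wa x * laplacian \<phi> x = F (norm x)" for x
    using rad[of x] \<beta>0[of 0] \<beta>'0[of 0] by (auto simp: lap F_def L_def)
  have FA: "\<sigma> * r ^ (?N - 1) * indicator {0<..} r * F r = \<sigma> * (indicator {A..B} r * (w r * u' r))" for r
  proof (cases "0 < r \<and> r \<notin> {A..B}")
    case True
    then show ?thesis using sq[of r] \<beta>0[of "r\<^sup>2"] \<beta>'0[of "r\<^sup>2"] by (auto simp: F_def L_def)
  qed (use AB in \<open>auto simp: F_def u'_def indicator_def\<close>)
  have "(LINT x|lebesgue. Wa x * laplacian \<phi> x) = (\<integral>x. F (norm (x::'a)) \<partial>lborel)"
    unfolding WF by (subst integral_completion) auto
  also have "\<dots> = \<sigma> * (\<integral>r. indicator {A..B} r * (w r * u' r) \<partial>lborel)"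
    unfolding integral_radial[OF \<open>F \<in> borel_measurable borel\<close>] \<sigma>_def[symmetric] FA by simp
  also have "(\<integral>r. indicator {A..B} r * (w r * u' r) \<partial>lborel) = - (\<integral>r. indicator {A..B} r * (w' r * u r) \<partial>lborel)"
  proof -
    have u'c: "continuous_on S u'" for S unfolding u'_def by (intro continuous_intros Lc)
    have uc: "continuous_on S u" for S using u DERIV_continuous_on has_field_derivative_at_within by blast
    have sub: "{A..B} \<subseteq> {0<..}" using AB by auto
    have c1: "continuous_on {A..B} (\<lambda>r. w r * u' r)" and c2: "continuous_on {A..B} (\<lambda>r. w' r * u r)"
      using continuous_on_subset[OF wc sub] continuous_on_subset[OF w(2) sub] by (auto intro!: continuous_intros u'c uc)
    have i: "integrable lborel (\<lambda>r. indicator {A..B} r * (w r * u' r))" "integrable lborel (\<lambda>r. indicator {A..B} r * (w' r * u r))"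
      using borel_integrable_atLeastAtMost'[OF c1] borel_integrable_atLeastAtMost'[OF c2] by (simp_all add: set_integrable_def)
    have "(\<integral>r. indicator {A..B} r *\<^sub>R (w r * u' r + w' r * u r) \<partial>lborel) = w B * u B - w A * u A"
    proof (rule integral_FTC_atLeastAtMost)
      show "((\<lambda>r. w r * u r) has_vector_derivative w r * u' r + w' r * u r) (at r within {A..B})" if "A \<le> r" "r \<le> B" for r
        unfolding has_real_derivative_iff_has_vector_derivative[symmetric]
        using DERIV_mult[OF w(1)[of r] u[of r]] that AB
        by (auto intro!: has_field_derivative_at_within elim!: DERIV_cong simp: algebra_simps)
    qed (use AB c1 c2 in \<open>auto intro: continuous_on_add\<close>)
    also have "\<dots> = 0" by (simp add: u_def \<beta>0)
    finally show ?thesis using i by (simp add: distrib_left)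
  qed
  also have "\<sigma> * - (\<integral>r. indicator {A..B} r * (w' r * u r) \<partial>lborel)
     = (\<integral>r. indicator {A..B} r * (2 * r * \<beta> (r\<^sup>2) * (\<sigma> * r ^ (?N - 1) * w' r)) \<partial>lborel)"
  proof -
    have "r ^ ?N = r * r ^ (?N - 1)" for r :: real using DIM_positive[where 'a='a] by (cases ?N) auto
    then have "indicator {A..B} r * (2 * r * \<beta> (r\<^sup>2) * (\<sigma> * r ^ (?N - 1) * w' r)) = (- \<sigma>) * (indicator {A..B} r * (w' r * u r))" for r
      by (simp add: u_def)
    then show ?thesis by (simp only: integral_mult_right_zero)
  qed
  finally have lhs: "(LINT x|lebesgue. Wa x * laplacian \<phi> x) = \<dots>" .
  \<comment> \<open>Layer-cake form: \<phi>(x) is the integral of \<open>k\<close> over the radii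
    exceeding |x|. Fubini then turns the pairing of \<phi> with \<open>g\<close> into a weighted
    integral of the masses of \<open>g\<close> in balls.\<close>
  define k where "k r = indicator {A..B} r * (2 * r * \<beta> (r\<^sup>2))" for r
  have kc: "continuous_on {A..B} (\<lambda>r. 2 * r * \<beta> (r\<^sup>2))"
    by (intro continuous_intros continuous_on_compose2[OF \<beta>c]) auto
  have ki: "integrable lborel k"
    using borel_integrable_atLeastAtMost'[OF kc] by (simp add: set_integrable_def k_def[abs_def])
  have \<phi>k: "\<phi> x = (\<integral>r. k r * indicator {x. norm x < r} x \<partial>lborel)" for x
  proof -
    have d: "((\<lambda>r. - H (r\<^sup>2)) has_vector_derivative 2 * r * \<beta> (r\<^sup>2)) (at r within S)" for r S
      unfolding has_real_derivative_iff_has_vector_derivative[symmetric]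
      by (rule has_field_derivative_at_within, rule DERIV_cong[OF DERIV_minus[OF DERIV_chain2[OF H(1)]]])
        (auto intro!: derivative_eq_intros)
    show ?thesis
    proof (cases "B \<le> norm x")
      case True
      then have "B\<^sup>2 \<le> x \<bullet> x" using AB by (simp add: power2_norm_eq_inner[symmetric] power_mono)
      moreover have "k r * indicator {x. norm x < r} x = 0" for r using True by (auto simp: k_def indicator_def)
      ultimately show ?thesis by (simp only: \<phi>_def H(2) Bochner_Integration.integral_zero)
    next
      case False
      let ?m = "max A (norm x)"
      have "AE r in lborel. r \<noteq> norm x" by (rule AE_lborel_singleton)
      then have "(\<integral>r. k r * indicator {x. norm x < r} x \<partial>lborel) = (\<integral>r. indicator {?m..B} r *\<^sub>R (2 * r * \<beta> (r\<^sup>2)) \<partial>lborel)"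
      proof (intro integral_cong_AE)
        have [measurable]: "\<beta> \<in> borel_measurable borel" using \<beta>c by (rule borel_measurable_continuous_onI)
        show "(\<lambda>r. indicator {?m..B} r *\<^sub>R (2 * r * \<beta> (r\<^sup>2))) \<in> borel_measurable lborel" by measurable
        have "(\<lambda>r. k r * indicator {norm x<..} r) \<in> borel_measurable lborel" using ki by measurable
        then show "(\<lambda>r. k r * indicator {x. norm x < r} x) \<in> borel_measurable lborel" by (simp add: indicator_def)
        show "AE r in lborel. k r * indicator {x. norm x < r} x = indicator {?m..B} r *\<^sub>R (2 * r * \<beta> (r\<^sup>2))"
          using \<open>AE r in lborel. r \<noteq> norm x\<close> by eventually_elim (auto simp: k_def indicator_def)
      qed
      also have "\<dots> = - H (B\<^sup>2) - - H (?m\<^sup>2)"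
        by (rule integral_FTC_atLeastAtMost[OF _ d])
          (use AB False in \<open>auto intro!: continuous_intros continuous_on_compose2[OF \<beta>c] simp: max_def\<close>)
      also have "\<dots> = H (?m\<^sup>2)" by (simp add: H(2))
      also have "\<dots> = \<phi> x"
      proof (cases "norm x \<le> A")
        case True
        then have "x \<bullet> x \<le> A\<^sup>2" by (simp add: power2_norm_eq_inner[symmetric] power_mono)
        then show ?thesis using True H(3)[of "x \<bullet> x"] by (simp add: \<phi>_def max_absorb1)
      qed (simp add: \<phi>_def power2_norm_eq_inner max_absorb2)
      finally show ?thesis by simp
    qed
  qed
  have Hc: "continuous_on UNIV H" by (rule DERIV_continuous_on) (rule H(1))
  have \<phi>c: "continuous_on UNIV \<phi>"
    unfolding \<phi>_def by (intro continuous_on_compose2[OF Hc] continuous_intros) auto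
  then have [measurable]: "\<phi> \<in> borel_measurable borel" by (rule borel_measurable_continuous_onI)
  have "(LINT x|lebesgue. g0 x * \<phi> x) = (LINT x|lebesgue. g x * \<phi> x)"
  proof (rule integral_cong_AE)
    show "AE x in lebesgue. g0 x * \<phi> x = g x * \<phi> x" using AE_completion[OF g0(1)] by eventually_elim simp
    have "\<phi> \<in> borel_measurable lebesgue" "g \<in> borel_measurable lebesgue" by (auto intro!: measurable_completion)
    then show "(\<lambda>x. g0 x * \<phi> x) \<in> borel_measurable lebesgue" "(\<lambda>x. g x * \<phi> x) \<in> borel_measurable lebesgue"
      using g0(2) by auto
  qed
  also have "\<dots> = (\<integral>x. g x * \<phi> x \<partial>lborel)" by (rule integral_completion) simp
  also have "\<dots> = (\<integral>x. (\<integral>r. k r * (indicator {x. norm x < r} x * g x) \<partial>lborel) \<partial>lborel)"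
    unfolding \<phi>k by (simp add: mult_ac flip: integral_mult_right_zero)
  also have "\<dots> = (\<integral>r. (\<integral>x. k r * (indicator {x. norm x < r} x * g x) \<partial>lborel) \<partial>lborel)"
  proof (rule lborel_pair.Fubini_integral)
    show "integrable (lborel \<Otimes>\<^sub>M lborel) (\<lambda>(r, x). k r * (indicator {x. norm x < r} x * g x))"
    proof (rule Bochner_Integration.integrable_bound[OF integrable_product_times[OF ki int[of B]]])
      have [measurable]: "k \<in> borel_measurable borel" using ki by simp
      have "(\<lambda>p. k (fst p) * (indicator {p. norm (snd p) < fst p} p * g (snd p))) \<in> borel_measurable (lborel \<Otimes>\<^sub>M lborel)"
        by measurable
      then show "(\<lambda>(r, x). k r * (indicator {x. norm x < r} x * g x)) \<in> borel_measurable (lborel \<Otimes>\<^sub>M lborel)"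
        by (simp add: case_prod_beta' indicator_def)
    qed (auto simp: k_def indicator_def)
  qed
  also have "\<dots> = (\<integral>r. indicator {A..B} r * (2 * r * \<beta> (r\<^sup>2) * (\<integral>x. indicator {x. norm x < r} x * g x \<partial>lborel)) \<partial>lborel)"
    by (simp add: k_def mult.assoc)
  finally have "(LINT x|lebesgue. g0 x * \<phi> x) = \<dots>" .
  moreover have "(LINT x|lebesgue. Wa x * laplacian \<phi> x) = (LINT x|lebesgue. g0 x * \<phi> x)"
    using wl test by (simp add: weak_laplacian_def)
  ultimately show ?thesis using lhs unfolding \<beta>_def \<sigma>_def by simp
qed

text \<open>Both sides are continuous in the radius. If they differed at \<open>r\<close>, their
  difference would keep its sign on an interval around \<open>r\<close>, and the tested identity
  with a bump positive inside that interval would fail.\<close>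

lemma radial_weak_laplacian:
  fixes Wa :: "'a::euclidean_space \<Rightarrow> real"
  assumes wl: "weak_laplacian Wa g0" and rad: "\<And>x. x \<noteq> 0 \<Longrightarrow> Wa x = w (norm x)"
    and w: "\<And>r. 0 < r \<Longrightarrow> (w has_real_derivative w' r) (at r)" "continuous_on {0<..} w'"
    and g[measurable]: "g \<in> borel_measurable borel" and g0: "AE x in lborel. g0 x = g x" "g0 \<in> borel_measurable lebesgue"
    and int: "\<And>r. integrable lborel (\<lambda>x. indicator (cball 0 r) x * g x)"
    and r0: "0 < r"
  shows "sphere_area TYPE('a) * r ^ (DIM('a) - 1) * w' r = (\<integral>x. indicator {x. norm x < r} x * g x \<partial>lborel)"
proof (rule ccontr)
  let ?N = "DIM('a)"
  define d where "d r = sphere_area TYPE('a) * r ^ (?N - 1) * w' r - (\<integral>x. indicator {x. norm x < r} x * g x \<partial>lborel)" for r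
  have cont: "continuous_on {0<..} d"
    unfolding d_def by (intro continuous_intros w continuous_at_imp_continuous_on ballI
        integral_truncated_ball_isCont g int)
  assume "\<not> ?thesis"
  then have dr: "d r \<noteq> 0" by (simp add: d_def)
  define s where "s = sgn (d r)"
  have s: "0 < s * d r" "s \<noteq> 0" using dr by (auto simp: s_def sgn_if)
  have "isCont (\<lambda>x. s * d x) r"
    using cont r0 by (intro continuous_intros) (simp add: continuous_on_eq_continuous_at)
  from order_tendstoD(1)[OF this[unfolded isCont_def] s(1)]
  obtain e where e: "0 < e" "\<And>x. x \<noteq> r \<Longrightarrow> dist x r < e \<Longrightarrow> 0 < s * d x"
    by (auto simp: eventually_at)
  define A where "A = r - min e r / 2"
  define B where "B = r + min e r / 2"
  have AB: "0 < A" "A < B" "A < r" "r < B" using e r0 by (auto simp: A_def B_def min_def field_simps)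
  have pos: "0 < s * d x" if "x \<in> {A..B}" for x
    using that e s r0 by (cases "x = r") (auto simp: A_def B_def dist_real_def min_def abs_if split: if_splits)
  define k where "k x = 2 * x * bump (A\<^sup>2) (B\<^sup>2) (x\<^sup>2)" for x
  have bc: "continuous_on UNIV (bump (A\<^sup>2) (B\<^sup>2))" using C_k_real_bump[of 0] by simp
  have kc: "continuous_on S k" for S unfolding k_def by (intro continuous_intros continuous_on_compose2[OF bc]) auto
  have sub: "{A..B} \<subseteq> {0<..}" using AB by auto
  have c1: "continuous_on {A..B} (\<lambda>r. k r * (sphere_area TYPE('a) * r ^ (?N - 1) * w' r))"
    by (intro continuous_intros kc continuous_on_subset[OF w(2) sub])
  have c2: "continuous_on {A..B} (\<lambda>r. k r * (\<integral>x. indicator {x. norm x < r} x * g x \<partial>lborel))"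
    by (intro continuous_intros kc continuous_at_imp_continuous_on ballI integral_truncated_ball_isCont g int)
  note i1 = borel_integrable_atLeastAtMost'[OF c1, unfolded set_integrable_def real_scaleR_def]
  note i2 = borel_integrable_atLeastAtMost'[OF c2, unfolded set_integrable_def real_scaleR_def]
  have eq: "indicator {A..B} x * (k x * (s * d x)) = s * (indicator {A..B} x * (k x * (sphere_area TYPE('a) * x ^ (?N - 1) * w' x))
         - indicator {A..B} x * (k x * (\<integral>y. indicator {y. norm y < x} y * g y \<partial>lborel)))" for x
    by (simp add: d_def algebra_simps)
  have "(\<integral>x. indicator {A..B} x * (k x * (s * d x)) \<partial>lborel) = 0"
    unfolding eq using i1 i2 radial_weak_laplacian_tested[OF wl rad w g g0 int AB(1,2), folded k_def] by simp
  moreover have "integrable lborel (\<lambda>x. indicator {A..B} x * (k x * (s * d x)))"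
    unfolding eq using i1 i2 by (intro integrable_mult_right Bochner_Integration.integrable_diff)
  moreover have "0 \<le> indicator {A..B} x * (k x * (s * d x))" for x
  proof (cases "x \<in> {A..B}")
    case True
    then have "0 \<le> k x" using AB bump_nonneg[of "A\<^sup>2" "B\<^sup>2" "x\<^sup>2"] by (simp add: k_def)
    then have "0 \<le> k x * (s * d x)" using pos[OF True] mult_nonneg_nonneg[of "k x" "s * d x"] by linarith
    then show ?thesis by simp
  qed simp
  ultimately have ae: "AE x in lborel. indicator {A..B} x * (k x * (s * d x)) = 0"
    by (subst (asm) integral_nonneg_eq_0_iff_AE) auto
  have "AE x in lborel. x \<notin> {A<..<B}"
    using ae
  proof eventually_elim
    case (elim x)
    show ?case
    proof
      assume x: "x \<in> {A<..<B}"
      then have "A\<^sup>2 < x\<^sup>2" "x\<^sup>2 < B\<^sup>2" using AB by (auto intro!: power_strict_mono)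
      then have "0 < k x" using x AB bump_pos[of "A\<^sup>2" "x\<^sup>2" "B\<^sup>2"] by (simp add: k_def)
      with pos[of x] x elim show False by auto
    qed
  qed
  then have "emeasure lborel {A<..<B} = 0"
    by (subst (asm) AE_iff_measurable[OF _ refl]) (auto simp: greaterThanLessThan_def greaterThan_def lessThan_def Int_def)
  then show False using AB by simp
qed

section \<open>The interaction kernel\<close>

context C1_compact_support
begin

text \<open>Writing out \<open>flux\<close> and exchanging the integrals turns the restriction |y| <
  |u| into the integral of \<open>h\<close> over the ball of radius |u|. For \<open>h = g\<close>
  that is the derivative of the attractive potential up to the area factor, so pairing the
  attraction with a gradient becomes pairing its Laplacian with spherical means.\<close>

lemma
  fixes h :: "'a \<Rightarrow> real"
  assumes [measurable]: "h \<in> borel_measurable borel"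
    and int: "\<And>R. integrable lborel (\<lambda>x. indicator (cball 0 R) x * h x)"
  shows integral_flux: "(\<integral>y. h y * flux (norm y) \<partial>lborel)
      = - (\<integral>u. (\<integral>y. indicator {y. norm y < norm u} y * h y \<partial>lborel) * ((u \<bullet> G u) / norm u ^ DIM('a)) \<partial>lborel)"
    and integrable_times_flux: "integrable lborel (\<lambda>y. h y * flux (norm y))"
proof -
  let ?q = "\<lambda>u. (u \<bullet> G u) / norm u ^ DIM('a)"
  obtain C where C: "0 < C"
    "\<And>u. \<bar>?q u\<bar> \<le> C * (indicator (cball 0 \<bar>r\<bar>) u * inverse (norm u ^ (DIM('a) - 1)))"
    by (rule radial_derivative_bound) blast
  let ?k = "\<lambda>u::'a. C * (indicator (cball 0 \<bar>r\<bar>) u * inverse (norm u ^ (DIM('a) - 1)))"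
  have ki: "integrable lborel ?k"
    by (intro integrable_mult_right integrable_inverse_norm_power) simp
  let ?f = "\<lambda>u y. indicator {y. norm y < norm u} y * h y * ?q u"
  have F: "integrable (lborel \<Otimes>\<^sub>M lborel) (\<lambda>(u, y). ?f u y)"
  proof (rule Bochner_Integration.integrable_bound[OF integrable_product_times[OF ki int[of "\<bar>r\<bar>"]]])
    have "(\<lambda>p. indicator {p. norm (snd p) < norm (fst p)} p * h (snd p) * ?q (fst p)) \<in> borel_measurable (lborel \<Otimes>\<^sub>M lborel)"
      by measurable
    then show "(\<lambda>(u, y). ?f u y) \<in> borel_measurable (lborel \<Otimes>\<^sub>M lborel)"
      by (simp add: case_prod_beta' indicator_def)
    have "norm (?f u y) \<le> norm (?k u * (indicator (cball 0 \<bar>r\<bar>) y * h y))" for u y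
    proof (cases "norm y < norm u \<and> norm u \<le> \<bar>r\<bar>")
      case True
      then have "norm (?f u y) = \<bar>h y\<bar> * \<bar>?q u\<bar>" by (simp add: abs_mult)
      also have "\<dots> \<le> \<bar>h y\<bar> * ?k u" by (intro mult_left_mono C) simp
      also have "\<dots> = norm (?k u * (indicator (cball 0 \<bar>r\<bar>) y * h y))"
        using True C(1) by (simp add: abs_mult indicator_def)
      finally show ?thesis .
    next
      case False
      then have "?f u y = 0"
      proof (cases "norm y < norm u")
        case True
        then have "u \<notin> cball 0 \<bar>r\<bar>" using False by auto
        then have "\<bar>?q u\<bar> \<le> 0" using C(2)[of u] by (metis indicator_simps(2) mult_zero_left mult_zero_right)
        then have "?q u = 0" by (rule abs_le_zero_iff[THEN iffD1])
        then show ?thesis by (metis mult_zero_right)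
      qed simp
      then have "norm (?f u y) = 0" by (simp only: norm_zero)
      then show ?thesis by (simp only: norm_ge_zero)
    qed
    then show "AE p in lborel \<Otimes>\<^sub>M lborel. norm (case p of (u, y) \<Rightarrow> ?f u y) \<le> norm (case p of (u, y) \<Rightarrow> ?k u * (indicator (cball 0 \<bar>r\<bar>) y * h y))"
      by (auto simp: split_beta)
  qed
  have fl: "h y * flux (norm y) = - (\<integral>u. ?f u y \<partial>lborel)" for y
  proof -
    have "(\<integral>u. ?f u y \<partial>lborel) = (\<integral>u. h y * (indicator {u. norm y < norm u} u * ?q u) \<partial>lborel)"
      by (intro Bochner_Integration.integral_cong) (auto simp: indicator_def)
    then show ?thesis unfolding flux_def by (simp only: integral_mult_right_zero mult_minus_right)
  qed
  show "integrable lborel (\<lambda>y. h y * flux (norm y))"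
    unfolding fl using lborel_pair.integrable_snd[OF F] by simp
  have "(\<integral>y. h y * flux (norm y) \<partial>lborel) = - (\<integral>y. (\<integral>u. ?f u y \<partial>lborel) \<partial>lborel)"
    unfolding fl by simp
  also have "(\<integral>y. (\<integral>u. ?f u y \<partial>lborel) \<partial>lborel) = (\<integral>u. (\<integral>y. ?f u y \<partial>lborel) \<partial>lborel)"
    by (rule lborel_pair.Fubini_integral[OF F])
  finally show "(\<integral>y. h y * flux (norm y) \<partial>lborel)
      = - (\<integral>u. (\<integral>y. indicator {y. norm y < norm u} y * h y \<partial>lborel) * ?q u \<partial>lborel)" by simp
qed

text \<open>Take \<open>h = 1\<close>: the ball volume cancels the power of the norm, and
  \<open>integral_inner_gradient\<close> remains.\<close>

lemma integral_flux_norm: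
  shows "(\<integral>y. flux (norm (y::'a)) \<partial>lborel) = sphere_area TYPE('a) * (\<integral>u. \<phi> u \<partial>lborel)"
    and "integrable lborel (\<lambda>y::'a. flux (norm y))"
proof -
  have i: "integrable lborel (\<lambda>x::'a. indicator (cball 0 R) x * (1::real))" for R
    using integrable_cball_indicator[of 1 R] by simp
  have v: "(\<integral>y. indicator {y. norm y < norm u} (y::'a) * 1 \<partial>lborel) = unit_ball_vol DIM('a) * norm u ^ DIM('a)" for u :: 'a
  proof -
    have e: "{y::'a. norm y < norm u} = ball 0 (norm u)" by auto
    show ?thesis using measure_shell[of 0 "norm u"] unfolding e by (simp add: zero_power)
  qed
  have z: "unit_ball_vol DIM('a) * norm u ^ DIM('a) * ((u \<bullet> G u) / norm u ^ DIM('a)) = unit_ball_vol DIM('a) * (u \<bullet> G u)" for u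
    by (cases "u = 0") auto
  show "(\<integral>y. flux (norm (y::'a)) \<partial>lborel) = sphere_area TYPE('a) * (\<integral>u. \<phi> u \<partial>lborel)"
    using integral_flux[OF _ i] unfolding v z by (simp add: integral_inner_gradient sphere_area_def)
  show "integrable lborel (\<lambda>y::'a. flux (norm y))"
    using integrable_times_flux[OF _ i] by simp
qed

end

text \<open>What remains of the potential: \<kappa> stands for w' and \<open>g\<close> for the
  Laplacian of the attractive part. \<open>\<kappa>_g\<close> is the divergence theorem on balls,
  and it takes the place of second derivatives of the potential.\<close>

locale confining_kernel =
  fixes \<kappa> :: "real \<Rightarrow> real" and g :: "'a::euclidean_space \<Rightarrow> real"
  assumes dim: "2 \<le> DIM('a)"
    and \<kappa>_cont: "continuous_on {0<..} \<kappa>" and \<kappa>_nonneg: "\<And>r. 0 < r \<Longrightarrow> 0 \<le> \<kappa> r"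
    and g_measurable[measurable]: "g \<in> borel_measurable borel"
    and g_int: "\<And>r. integrable lborel (\<lambda>x. indicator (cball 0 r) x * g x)"
    and \<kappa>_g: "\<And>r. 0 < r \<Longrightarrow> sphere_area TYPE('a) * r ^ (DIM('a) - 1) * \<kappa> r = (\<integral>x. indicator {x. norm x < r} x * g x \<partial>lborel)"
    and g_bound: "\<And>\<epsilon>. 0 < \<epsilon> \<Longrightarrow> \<exists>C. AE x in lborel. \<epsilon> \<le> norm x \<longrightarrow> \<bar>g x\<bar> \<le> C"
    and \<kappa>_grow: "filterlim (\<lambda>r. \<kappa> r * r powr (1 / real DIM('a))) at_top at_top"
begin

lemma sphere_area_kernel_pos: "0 < sphere_area TYPE('a)" by (rule sphere_area_pos)

text \<open>Away from the origin this is the gradient of the full potential. The value 0 at the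
  origin makes \<open>K\<close> odd without exception.\<close>

definition K :: "'a \<Rightarrow> 'a" where
  "K z = (if z = 0 then 0 else (\<kappa> (norm z) / norm z - 1 / (sphere_area TYPE('a) * norm z ^ DIM('a))) *\<^sub>R z)"

lemma K_minus: "K (- z) = - K z"
  by (simp add: K_def)

lemma K_measurable[measurable]: "K \<in> borel_measurable borel"
proof -
  have [measurable]: "(\<lambda>r. if r \<in> {0<..} then \<kappa> r else 0) \<in> borel_measurable borel"
    by (rule borel_measurable_continuous_on_if) (auto intro!: continuous_intros \<kappa>_cont)
  have "K = (\<lambda>z. ((if norm z \<in> {0<..} then \<kappa> (norm z) else 0) / norm z - 1 / (sphere_area TYPE('a) * norm z ^ DIM('a))) *\<^sub>R z)"
    by (auto simp: K_def fun_eq_iff)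
  also have "\<dots> \<in> borel_measurable borel" by measurable
  finally show ?thesis .
qed

text \<open>\<open>\<kappa>_g\<close> bounds \<kappa>(r) by the integral of |g| over the ball of
  radius \<open>R\<close> divided by \<sigma> r^(N-1), so the attraction is no more singular at the
  origin than the Newtonian repulsion.\<close>

lemma K_bound:
  obtains C where "0 < C" "\<And>z. norm z \<le> R \<Longrightarrow> norm (K z) \<le> C * inverse (norm z ^ (DIM('a) - 1))"
proof -
  define I where "I = (\<integral>x. \<bar>indicator (cball 0 R) x * g x\<bar> \<partial>lborel)"
  have I: "0 \<le> I" by (simp add: I_def)
  show thesis
  proof
    show "0 < (I + 1) / sphere_area TYPE('a)" using I sphere_area_kernel_pos by simp
    fix z :: 'a assume z: "norm z \<le> R"
    show "norm (K z) \<le> (I + 1) / sphere_area TYPE('a) * inverse (norm z ^ (DIM('a) - 1))"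
    proof (cases "z = 0")
      case True
      then show ?thesis using I sphere_area_kernel_pos by (simp add: K_def)
    next
      case False
      have "(\<integral>x. indicator {x. norm x < norm z} x * g x \<partial>lborel) \<le> I"
        unfolding I_def
      proof (rule integral_mono)
        show "integrable lborel (\<lambda>x. indicator {x. norm x < norm z} x * g x)"
          by (rule Bochner_Integration.integrable_bound[OF g_int[of R]]) (use z in \<open>auto simp: indicator_def\<close>)
        show "integrable lborel (\<lambda>x. \<bar>indicator (cball 0 R) x * g x\<bar>)" by (intro integrable_abs g_int)
      qed (use z in \<open>auto simp: indicator_def\<close>)
      then have "sphere_area TYPE('a) * norm z ^ (DIM('a) - 1) * \<kappa> (norm z) \<le> I" using \<kappa>_g[of "norm z"] False by simp
      then have k: "\<kappa> (norm z) \<le> I / sphere_area TYPE('a) * inverse (norm z ^ (DIM('a) - 1))"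
        using False sphere_area_kernel_pos by (simp add: field_simps)
      have "norm z ^ DIM('a) = norm z * norm z ^ (DIM('a) - 1)" using dim by (cases "DIM('a)") auto
      then have "norm (K z) = \<bar>\<kappa> (norm z) - inverse (norm z ^ (DIM('a) - 1)) / sphere_area TYPE('a)\<bar>"
        using False by (simp add: K_def field_simps abs_mult[symmetric])
      also have "\<dots> \<le> \<kappa> (norm z) + inverse (norm z ^ (DIM('a) - 1)) / sphere_area TYPE('a)"
        using \<kappa>_nonneg[of "norm z"] False sphere_area_kernel_pos by (simp add: abs_le_iff add_increasing)
      also have "\<dots> \<le> (I + 1) / sphere_area TYPE('a) * inverse (norm z ^ (DIM('a) - 1))"
      proof -
        have "(I + 1) / sphere_area TYPE('a) * inverse (norm z ^ (DIM('a) - 1))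
           = I / sphere_area TYPE('a) * inverse (norm z ^ (DIM('a) - 1)) + inverse (norm z ^ (DIM('a) - 1)) / sphere_area TYPE('a)"
          by (simp add: distrib_left distrib_right divide_inverse mult_ac)
        then show ?thesis using k by linarith
      qed
      finally show ?thesis .
    qed
  qed
qed

lemma K_locally_integrable: "integrable lborel (\<lambda>z. indicator (cball 0 R) z *\<^sub>R K z)"
proof -
  obtain C where C: "0 < C" "\<And>z. norm z \<le> R \<Longrightarrow> norm (K z) \<le> C * inverse (norm z ^ (DIM('a) - 1))"
    by (rule K_bound[of R]) blast
  show ?thesis
  proof (rule Bochner_Integration.integrable_bound)
    show "integrable lborel (\<lambda>z::'a. C * (indicator (cball 0 \<bar>R\<bar>) z * inverse (norm z ^ (DIM('a) - 1))))"
      by (intro integrable_mult_right integrable_inverse_norm_power) simp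
    show "AE z in lborel. norm (indicator (cball 0 R) z *\<^sub>R K z) \<le> norm (C * (indicator (cball 0 \<bar>R\<bar>) z * inverse (norm z ^ (DIM('a) - 1))))"
      using C by (auto simp: indicator_def)
  qed measurable
qed

definition K_mass :: "real \<Rightarrow> real" where
  "K_mass R = (\<integral>z. indicator (cball 0 R) z * norm (K z) \<partial>lborel)"

lemma K_norm_locally_integrable: "integrable lborel (\<lambda>z. indicator (cball 0 R) z * norm (K z))"
  using integrable_norm[OF K_locally_integrable[of R]] by simp

lemma K_mass_nonneg: "0 \<le> K_mass R"
  by (simp add: K_mass_def)

lemma K_times_bounded:
  fixes f :: "'a \<Rightarrow> real"
  assumes [measurable]: "f \<in> borel_measurable borel" and f: "\<And>z. \<bar>f z\<bar> \<le> B * indicator (cball 0 R) z"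
  shows "integrable lborel (\<lambda>z. f z *\<^sub>R K z)" and "norm (\<integral>z. f z *\<^sub>R K z \<partial>lborel) \<le> B * K_mass R"
proof -
  have b: "norm (f z *\<^sub>R K z) \<le> B * (indicator (cball 0 R) z * norm (K z))" for z
    using mult_right_mono[OF f[of z] norm_ge_zero[of "K z"]] by simp
  have i: "integrable lborel (\<lambda>z. B * (indicator (cball 0 R) z * norm (K z)))"
    by (intro integrable_mult_right K_norm_locally_integrable)
  show I: "integrable lborel (\<lambda>z. f z *\<^sub>R K z)"
  proof (rule Bochner_Integration.integrable_bound[OF i])
    show "AE z in lborel. norm (f z *\<^sub>R K z) \<le> norm (B * (indicator (cball 0 R) z * norm (K z)))"
      using b by (auto intro: order_trans[OF b abs_ge_self] simp del: norm_scaleR)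
  qed measurable
  have "norm (\<integral>z. f z *\<^sub>R K z \<partial>lborel) \<le> (\<integral>z. norm (f z *\<^sub>R K z) \<partial>lborel)" by (rule integral_norm_bound)
  also have "\<dots> \<le> (\<integral>z. B * (indicator (cball 0 R) z * norm (K z)) \<partial>lborel)"
    by (rule integral_mono[OF integrable_norm[OF I] i b])
  finally show "norm (\<integral>z. f z *\<^sub>R K z \<partial>lborel) \<le> B * K_mass R" by (simp add: K_mass_def)
qed

text \<open>Applied to \<phi>(z) = u(x - z), the left side is div V at x. Split K into repulsion and
  attraction: the first gives - \<phi>(0) through \<open>flux_0\<close>, the second is 1/\<sigma>
  times the integral of \<open>g\<close> against \<open>flux\<close>. Near the origin
  \<open>flux\<close> is at most \<sigma> S and |g| has small integral; further out |g| is bounded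
  and \<open>flux\<close> has integral \<sigma> times that of \<phi>. The constant depends on
  \<open>g\<close> alone.\<close>

lemma divergence_bound:
  obtains C0 where "0 \<le> C0"
    "\<And>\<phi> G r S. C1_compact_support \<phi> G r \<Longrightarrow> (\<And>x. 0 \<le> \<phi> x) \<Longrightarrow> (\<And>x. \<phi> x \<le> S) \<Longrightarrow>
      - (\<integral>z. K z \<bullet> G z \<partial>lborel) \<le> - \<phi> 0 + S / 2 + C0 * (\<integral>x. \<phi> x \<partial>lborel)"
proof -
  have ai: "integrable lborel (\<lambda>x. indicator (cball 0 r) x * \<bar>g x\<bar>)" for r
    using integrable_abs[OF g_int[of r]] by (simp add: abs_mult)
  have "isCont (\<lambda>r. \<integral>x. indicator {x. norm x < r} x * \<bar>g x\<bar> \<partial>lborel) 0"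
    by (rule integral_truncated_ball_isCont[OF _ ai]) simp
  moreover have "{x::'a. norm x < 0} = {}" by auto
  ultimately have "((\<lambda>r. \<integral>x. indicator {x. norm x < r} x * \<bar>g x\<bar> \<partial>lborel) \<longlongrightarrow> 0) (at 0)"
    by (simp add: isCont_def)
  \<comment> \<open>Near the origin |g| is given integral at most 1/2, which leaves half of the
    damping term - \<phi>(0) at a maximum.\<close>
  from order_tendstoD(2)[OF this, of "1/2"] obtain d where
    d: "0 < d" "\<And>r. r \<noteq> 0 \<Longrightarrow> dist r 0 < d \<Longrightarrow> (\<integral>x. indicator {x. norm x < r} x * \<bar>g x\<bar> \<partial>lborel) < 1/2"
    by (auto simp: eventually_at)
  define \<epsilon> where "\<epsilon> = d / 2"
  have \<epsilon>: "0 < \<epsilon>" "(\<integral>x. indicator {x. norm x < \<epsilon>} x * \<bar>g x\<bar> \<partial>lborel) \<le> 1/2"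
    using d(1) d(2)[of \<epsilon>] by (auto simp: \<epsilon>_def)
  obtain C1 where C1: "AE x in lborel. \<epsilon> \<le> norm x \<longrightarrow> \<bar>g x\<bar> \<le> C1" using g_bound[OF \<epsilon>(1)] by blast
  define C0 where "C0 = \<bar>C1\<bar>"
  show thesis
  proof
    show "0 \<le> C0" by (simp add: C0_def)
    fix \<phi> :: "'a \<Rightarrow> real" and G r S
    assume "C1_compact_support \<phi> G r" and pos: "\<And>x. 0 \<le> \<phi> x" and S: "\<And>x. \<phi> x \<le> S"
    then interpret C1_compact_support \<phi> G r by simp
    have S0: "0 \<le> S" using pos[of 0] S[of 0] by simp
    let ?q = "\<lambda>u. (u \<bullet> G u) / norm u ^ DIM('a)"
    let ?Q = "\<lambda>u. (\<integral>y. indicator {y. norm y < norm u} y * g y \<partial>lborel)"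
    have KG: "K z \<bullet> G z = (?Q z * ?q z) / sphere_area TYPE('a) - (indicator {z. 0 < norm z} z * ?q z) / sphere_area TYPE('a)" for z
    proof (cases "z = 0")
      case False
      have "norm z ^ DIM('a) = norm z * norm z ^ (DIM('a) - 1)" using dim by (cases "DIM('a)") auto
      moreover have "?Q z = sphere_area TYPE('a) * norm z ^ (DIM('a) - 1) * \<kappa> (norm z)" using \<kappa>_g[of "norm z"] False by simp
      ultimately have "(?Q z * ?q z) / sphere_area TYPE('a) = \<kappa> (norm z) / norm z * (z \<bullet> G z)"
        using False sphere_area_kernel_pos by simp
      then show ?thesis using False by (simp add: K_def left_diff_distrib)
    qed (simp add: K_def)
    have i2: "integrable lborel (\<lambda>z. indicator {z. 0 < norm z} z * ?q z)" by (rule integrable_flux)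
    obtain CG where CG: "0 < CG" "\<And>x. norm (G x) \<le> CG" using bounded_G by blast
    have iKG: "integrable lborel (\<lambda>z. K z \<bullet> G z)"
    proof (rule Bochner_Integration.integrable_bound)
      show "integrable lborel (\<lambda>z. CG * (indicator (cball 0 r) z * norm (K z)))"
        by (intro integrable_mult_right K_norm_locally_integrable)
      show "AE z in lborel. norm (K z \<bullet> G z) \<le> norm (CG * (indicator (cball 0 r) z * norm (K z)))"
      proof (rule AE_I2)
        show "norm (K z \<bullet> G z) \<le> norm (CG * (indicator (cball 0 r) z * norm (K z)))" for z
        proof (cases "norm z \<le> r")
          case True
          have "\<bar>K z \<bullet> G z\<bar> \<le> norm (K z) * CG"
            by (rule order_trans[OF Cauchy_Schwarz_ineq2]) (simp add: CG mult_left_mono)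
          then show ?thesis using True CG by (simp add: abs_mult mult.commute)
        qed (simp add: G_zero)
      qed
    qed measurable
    have "?Q z * ?q z = sphere_area TYPE('a) * (K z \<bullet> G z) + indicator {z. 0 < norm z} z * ?q z" for z
      using arg_cong[OF KG[of z], of "\<lambda>t. sphere_area TYPE('a) * t"] sphere_area_kernel_pos
      by (simp add: right_diff_distrib)
    then have i1: "integrable lborel (\<lambda>z. ?Q z * ?q z)"
      using iKG i2 by (simp add: integrable_mult_right)
    have "- (\<integral>z. K z \<bullet> G z \<partial>lborel) = - ((\<integral>z. ?Q z * ?q z \<partial>lborel) / sphere_area TYPE('a) - (\<integral>z. indicator {z. 0 < norm z} z * ?q z \<partial>lborel) / sphere_area TYPE('a))"
      using Bochner_Integration.integral_diff[OF integrable_divide[OF i1] integrable_divide[OF i2], of "sphere_area TYPE('a)" "sphere_area TYPE('a)"]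
        sphere_area_kernel_pos unfolding KG by (simp only: integral_divide_zero)
    also have "\<dots> = (\<integral>y. g y * flux (norm y) \<partial>lborel) / sphere_area TYPE('a) - flux 0 / sphere_area TYPE('a)"
    proof -
      have "(\<integral>z. indicator {z. 0 < norm z} z * ?q z \<partial>lborel) = - flux 0"
        unfolding flux_def by (simp only: minus_minus)
      moreover have "(\<integral>z. ?Q z * ?q z \<partial>lborel) = - (\<integral>y. g y * flux (norm y) \<partial>lborel)"
        using integral_flux[OF g_measurable g_int] by simp
      ultimately show ?thesis by (simp only:)
    qed
    also have "flux 0 / sphere_area TYPE('a) = \<phi> 0" using sphere_area_kernel_pos by (simp add: flux_0)
    finally have eq: "- (\<integral>z. K z \<bullet> G z \<partial>lborel) = - \<phi> 0 + (\<integral>y. g y * flux (norm y) \<partial>lborel) / sphere_area TYPE('a)" by simp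
    have "(\<integral>y. g y * flux (norm y) \<partial>lborel)
      \<le> (\<integral>y. (sphere_area TYPE('a) * S) * (indicator {y. norm y < \<epsilon>} y * \<bar>g y\<bar>) + C0 * flux (norm y) \<partial>lborel)"
    proof (rule integral_mono_AE)
      show "integrable lborel (\<lambda>y. g y * flux (norm y))" by (rule integrable_times_flux[OF g_measurable g_int])
      have "integrable lborel (\<lambda>y. indicator {y. norm y < \<epsilon>} y * \<bar>g y\<bar>)"
        by (rule Bochner_Integration.integrable_bound[OF ai[of \<epsilon>]]) (auto simp: indicator_def)
      then show "integrable lborel (\<lambda>y. (sphere_area TYPE('a) * S) * (indicator {y. norm y < \<epsilon>} y * \<bar>g y\<bar>) + C0 * flux (norm y))"
        using integral_flux_norm(2) by (intro Bochner_Integration.integrable_add integrable_mult_right)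
      show "AE y in lborel. g y * flux (norm y) \<le> (sphere_area TYPE('a) * S) * (indicator {y. norm y < \<epsilon>} y * \<bar>g y\<bar>) + C0 * flux (norm y)"
        using C1
      proof eventually_elim
        case (elim y)
        have f: "0 \<le> flux (norm y)" "flux (norm y) \<le> sphere_area TYPE('a) * S"
          by (rule flux_nonneg[OF norm_ge_zero pos S], rule flux_le[OF norm_ge_zero pos S])
        show ?case
        proof (cases "norm y < \<epsilon>")
          case True
          have "g y * flux (norm y) \<le> \<bar>g y\<bar> * (sphere_area TYPE('a) * S)" using f by (intro mult_mono) auto
          moreover have "0 \<le> C0 * flux (norm y)" using f by (simp add: C0_def)
          ultimately show ?thesis using True by (simp add: mult.commute)
        next
          case False
          then have "g y \<le> C0" using elim by (simp add: C0_def)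
          then show ?thesis using False f by (simp add: mult_right_mono)
        qed
      qed
    qed
    also have "\<dots> = (sphere_area TYPE('a) * S) * (\<integral>y. indicator {y. norm y < \<epsilon>} y * \<bar>g y\<bar> \<partial>lborel) + C0 * (sphere_area TYPE('a) * (\<integral>u. \<phi> u \<partial>lborel))"
    proof -
      have "integrable lborel (\<lambda>y. indicator {y. norm y < \<epsilon>} y * \<bar>g y\<bar>)"
        by (rule Bochner_Integration.integrable_bound[OF ai[of \<epsilon>]]) (auto simp: indicator_def)
      then show ?thesis using integral_flux_norm by simp
    qed
    also have "\<dots> \<le> (sphere_area TYPE('a) * S) * (1/2) + C0 * (sphere_area TYPE('a) * (\<integral>u. \<phi> u \<partial>lborel))"
      using \<epsilon>(2) S0 sphere_area_kernel_pos by (intro add_right_mono mult_left_mono) auto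
    finally have "(\<integral>y. g y * flux (norm y) \<partial>lborel) / sphere_area TYPE('a) \<le> ((sphere_area TYPE('a) * S) * (1/2) + C0 * (sphere_area TYPE('a) * (\<integral>u. \<phi> u \<partial>lborel))) / sphere_area TYPE('a)"
      using sphere_area_kernel_pos by (intro divide_right_mono) auto
    also have "\<dots> = S / 2 + C0 * (\<integral>u. \<phi> u \<partial>lborel)" using sphere_area_kernel_pos by (simp add: field_simps)
    finally show "- (\<integral>z. K z \<bullet> G z \<partial>lborel) \<le> - \<phi> 0 + S / 2 + C0 * (\<integral>x. \<phi> x \<partial>lborel)"
      using eq by simp
  qed
qed

end

section \<open>Virial and drift estimates\<close>

text \<open>The field |x|^2 x is a quarter of the gradient of |x|^4, so this expression appears when
  the derivative of the fourth moment is symmetrised in the two particles.\<close>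

lemma cubic_inner_identity:
  fixes x y :: "'a::real_inner"
  shows "((norm x)\<^sup>2 *\<^sub>R x - (norm y)\<^sup>2 *\<^sub>R y) \<bullet> (x - y)
     = ((norm x)\<^sup>2 + (norm y)\<^sup>2) * (norm (x - y))\<^sup>2 / 2 + ((norm x)\<^sup>2 - (norm y)\<^sup>2)\<^sup>2 / 2"
  unfolding power2_norm_eq_inner
  by (simp add: inner_diff_left inner_diff_right inner_commute[of y x] power2_eq_square field_simps)

text \<open>The lower bound serves the attraction, the upper one the repulsion. The factor 3/2 is
  1/2 from the first term of \<open>cubic_inner_identity\<close> plus 1 from the second, by the
  triangle inequality and (a + b)^2 <= 2 (a^2 + b^2).\<close>

lemma cubic_inner_bounds:
  fixes x y :: "'a::real_inner"
  shows "((norm x)\<^sup>2 + (norm y)\<^sup>2) * (norm (x - y))\<^sup>2 / 2 \<le> ((norm x)\<^sup>2 *\<^sub>R x - (norm y)\<^sup>2 *\<^sub>R y) \<bullet> (x - y)"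
    and "((norm x)\<^sup>2 *\<^sub>R x - (norm y)\<^sup>2 *\<^sub>R y) \<bullet> (x - y) \<le> 3 / 2 * (((norm x)\<^sup>2 + (norm y)\<^sup>2) * (norm (x - y))\<^sup>2)"
proof -
  have "((norm x)\<^sup>2 - (norm y)\<^sup>2)\<^sup>2 = (norm x - norm y)\<^sup>2 * (norm x + norm y)\<^sup>2"
    by (simp add: power2_eq_square algebra_simps)
  also have "\<dots> \<le> (norm (x - y))\<^sup>2 * (2 * ((norm x)\<^sup>2 + (norm y)\<^sup>2))"
  proof (intro mult_mono)
    show "(norm x - norm y)\<^sup>2 \<le> (norm (x - y))\<^sup>2"
      using norm_triangle_ineq3[of x y] by (simp add: abs_le_square_iff[symmetric])
    show "(norm x + norm y)\<^sup>2 \<le> 2 * ((norm x)\<^sup>2 + (norm y)\<^sup>2)"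
      using zero_le_power2[of "norm x - norm y"] by (simp add: power2_eq_square algebra_simps)
  qed auto
  finally show "((norm x)\<^sup>2 *\<^sub>R x - (norm y)\<^sup>2 *\<^sub>R y) \<bullet> (x - y) \<le> 3 / 2 * (((norm x)\<^sup>2 + (norm y)\<^sup>2) * (norm (x - y))\<^sup>2)"
    unfolding cubic_inner_identity by (simp only: mult.commute[of "(norm (x - y))\<^sup>2"] mult.assoc)
  show "((norm x)\<^sup>2 + (norm y)\<^sup>2) * (norm (x - y))\<^sup>2 / 2 \<le> ((norm x)\<^sup>2 *\<^sub>R x - (norm y)\<^sup>2 *\<^sub>R y) \<bullet> (x - y)"
    unfolding cubic_inner_identity by simp
qed

text \<open>For \<open>x\<close> and \<open>y\<close> in the ball of radius \<open>r\<close> the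
  difference stays in the ball of radius \<open>2 * r\<close>, so the inner integral is bounded
  uniformly in \<open>x\<close> by the mass of \<open>q\<close> there. This permits Fubini with the
  singular kernel.\<close>

lemma integrable_difference_kernel:
  fixes F :: "'a::euclidean_space \<Rightarrow> 'a \<Rightarrow> real"
  assumes F: "(\<lambda>(x, y). F x y) \<in> borel_measurable (borel \<Otimes>\<^sub>M borel)"
    and q: "q \<in> borel_measurable borel" "\<And>z. 0 \<le> q z" "\<And>R. integrable lborel (\<lambda>z. indicator (cball 0 R) z * q z)"
    and bd: "\<And>x y. \<bar>F x y\<bar> \<le> C * (indicator (cball 0 r) x * indicator (cball 0 r) y * q (x - y))"
  shows "integrable (lborel \<Otimes>\<^sub>M lborel) (\<lambda>(x, y). F x y)" and "\<And>x. integrable lborel (F x)"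
proof -
  note [measurable] = F q(1)
  have bd': "\<bar>F x y\<bar> \<le> indicator (cball 0 r) x * (\<bar>C\<bar> * (indicator (cball 0 (2 * r)) (x - y) * q (x - y)))" for x y
  proof (cases "x \<in> cball 0 r \<and> y \<in> cball 0 r")
    case True
    then have "norm (x - y) \<le> 2 * r" using norm_triangle_ineq4[of x y] by auto
    moreover have "C * q (x - y) \<le> \<bar>C\<bar> * q (x - y)" by (intro mult_right_mono q) simp
    ultimately show ?thesis using bd[of x y] True by simp
  next
    case False
    then have "F x y = 0" using bd[of x y] by auto
    then show ?thesis using q(2)[of "x - y"] by simp
  qed
  have i2: "integrable lborel (\<lambda>y. indicator (cball 0 (2 * r)) (x - y) * q (x - y))" for x
    using q(3)[of "2 * r"] by (subst integrable_reflect[where f="\<lambda>z. indicator (cball 0 (2 * r)) z * q z"]) auto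
  have Fx[measurable]: "F x \<in> borel_measurable borel" for x
    using measurable_compose[OF measurable_Pair1'[of x borel borel] F] by simp
  show I: "integrable lborel (F x)" for x
  proof (rule Bochner_Integration.integrable_bound[OF integrable_mult_right[OF integrable_mult_right[OF i2]]])
    show "AE y in lborel. norm (F x y) \<le> norm (indicator (cball 0 r) x * (\<bar>C\<bar> * (indicator (cball 0 (2 * r)) (x - y) * q (x - y))))"
      using bd' by (auto intro: order_trans[OF bd' abs_ge_self])
  qed measurable
  show "integrable (lborel \<Otimes>\<^sub>M lborel) (\<lambda>(x, y). F x y)"
  proof (rule lborel_pair.Fubini_integrable)
    show m: "(\<lambda>(x, y). F x y) \<in> borel_measurable (lborel \<Otimes>\<^sub>M lborel)" using F by simp
    show "AE x in lborel. integrable lborel (\<lambda>y. case (x, y) of (x, y) \<Rightarrow> F x y)" using I by simp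
    let ?c = "\<bar>C\<bar> * (\<integral>z. indicator (cball 0 (2 * r)) z * q z \<partial>lborel)"
    show "integrable lborel (\<lambda>x. \<integral>y. norm (case (x, y) of (x, y) \<Rightarrow> F x y) \<partial>lborel)"
    proof (rule Bochner_Integration.integrable_bound[OF integrable_cball_indicator[of ?c r]])
      show "(\<lambda>x. \<integral>y. norm (case (x, y) of (x, y) \<Rightarrow> F x y) \<partial>lborel) \<in> borel_measurable lborel"
        by (rule lborel.borel_measurable_lebesgue_integral) (use m in measurable)
      show "AE x in lborel. norm (\<integral>y. norm (case (x, y) of (x, y) \<Rightarrow> F x y) \<partial>lborel) \<le> norm (?c * indicator (cball 0 r) x)"
      proof (rule AE_I2)
        fix x :: 'a
        have "(\<integral>y. norm (F x y) \<partial>lborel) \<le> (\<integral>y. indicator (cball 0 r) x * (\<bar>C\<bar> * (indicator (cball 0 (2 * r)) (x - y) * q (x - y))) \<partial>lborel)"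
          using bd' by (intro integral_mono integrable_norm I integrable_mult_right i2) auto
        also have "\<dots> = ?c * indicator (cball 0 r) x"
          using integral_reflect[of "\<lambda>z. indicator (cball 0 (2 * r)) z * q z" x] by simp
        finally show "norm (\<integral>y. norm (case (x, y) of (x, y) \<Rightarrow> F x y) \<partial>lborel) \<le> norm (?c * indicator (cball 0 r) x)"
          by simp
      qed
    qed
  qed
qed

context confining_kernel
begin

text \<open>The particles move with minus this field, since \<rho>_t = div (\<rho> V): a positive
  \<open>x \<bullet> velocity u x\<close> means motion towards the origin. The translation sits on
  \<open>u\<close>, so that increments and derivatives fall on \<open>u\<close> and only local
  integrability of \<open>K\<close> is used.\<close>

definition velocity :: "('a \<Rightarrow> real) \<Rightarrow> 'a \<Rightarrow> 'a" where
  "velocity u x = (\<integral>z. u (x - z) *\<^sub>R K z \<partial>lborel)"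

lemma
  assumes u: "continuous_on UNIV u" "\<And>x. r \<le> norm x \<Longrightarrow> u x = 0" and x: "norm x \<le> R"
  shows velocity_integrable: "integrable lborel (\<lambda>z. u (x - z) *\<^sub>R K z)"
    and velocity_bound: "(\<And>x. \<bar>u x\<bar> \<le> B) \<Longrightarrow> norm (velocity u x) \<le> B * K_mass (R + r)"
proof -
  have [measurable]: "u \<in> borel_measurable borel" using u(1) by (rule borel_measurable_continuous_onI)
  have m: "(\<lambda>z. u (x - z)) \<in> borel_measurable borel" by measurable
  have bd: "\<bar>u (x - z)\<bar> \<le> B * indicator (cball 0 (R + r)) z" if "\<And>x. \<bar>u x\<bar> \<le> B" for B z
  proof (cases "r \<le> norm (x - z)")
    case True
    then show ?thesis using u(2) that[of 0] by (simp add: indicator_def)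
  next
    case False
    then have "norm z \<le> R + r" using x norm_triangle_sub[of z x] norm_minus_commute[of x z] by linarith
    then show ?thesis using that[of "x - z"] by simp
  qed
  have "compact (u ` cball 0 r)"
    by (intro compact_continuous_image continuous_on_subset[OF u(1)]) auto
  then obtain C where C: "0 < C" "\<And>y. y \<in> u ` cball 0 r \<Longrightarrow> norm y \<le> C"
    using compact_imp_bounded bounded_pos by metis
  have C': "\<bar>u x\<bar> \<le> C" for x
    using C u(2)[of x] by (cases "x \<in> cball 0 r") (auto simp: not_le)
  show "integrable lborel (\<lambda>z. u (x - z) *\<^sub>R K z)" by (rule K_times_bounded(1)[OF m bd[OF C']])
  show "norm (velocity u x) \<le> B * K_mass (R + r)" if "\<And>x. \<bar>u x\<bar> \<le> B"
    unfolding velocity_def by (rule K_times_bounded(2)[OF m bd[OF that]])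
qed

text \<open>One estimate serves twice: \<open>u = v\<close> gives the Lipschitz bound in space, and
  \<open>x = y\<close> compares the fields of two time slices.\<close>

lemma velocity_diff_bound:
  assumes u: "continuous_on UNIV u" "\<And>x. r \<le> norm x \<Longrightarrow> u x = 0" and x: "norm x \<le> R"
    and v: "continuous_on UNIV v" "\<And>x. r \<le> norm x \<Longrightarrow> v x = 0" and y: "norm y \<le> R"
    and d: "\<And>z. \<bar>u (x - z) - v (y - z)\<bar> \<le> d"
  shows "norm (velocity u x - velocity v y) \<le> d * K_mass (R + r)"
proof -
  have [measurable]: "u \<in> borel_measurable borel" using u(1) by (rule borel_measurable_continuous_onI)
  have [measurable]: "v \<in> borel_measurable borel" using v(1) by (rule borel_measurable_continuous_onI)
  have "velocity u x - velocity v y = (\<integral>z. (u (x - z) - v (y - z)) *\<^sub>R K z \<partial>lborel)"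
    unfolding velocity_def scaleR_left_diff_distrib
    by (rule Bochner_Integration.integral_diff[symmetric, OF velocity_integrable[OF u x] velocity_integrable[OF v y]])
  also have "norm \<dots> \<le> d * K_mass (R + r)"
  proof (rule K_times_bounded(2))
    show "\<bar>u (x - z) - v (y - z)\<bar> \<le> d * indicator (cball 0 (R + r)) z" for z
    proof (cases "z \<in> cball 0 (R + r)")
      case False
      then have "r \<le> norm (x - z)" "r \<le> norm (y - z)"
        using x y norm_triangle_sub[of z x] norm_triangle_sub[of z y] norm_minus_commute[of x z] norm_minus_commute[of y z] by auto
      then show ?thesis using False u v by simp
    qed (use d in simp)
  qed measurable
  finally show ?thesis .
qed

lemma velocity_eq:
  assumes "continuous_on UNIV u"
  shows "velocity u x = (\<integral>y. u y *\<^sub>R K (x - y) \<partial>lborel)"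
    and "integrable lborel (\<lambda>z. u (x - z) *\<^sub>R K z) \<Longrightarrow> integrable lborel (\<lambda>y. u y *\<^sub>R K (x - y))"
proof -
  have [measurable]: "u \<in> borel_measurable borel" using assms by (rule borel_measurable_continuous_onI)
  show "velocity u x = (\<integral>y. u y *\<^sub>R K (x - y) \<partial>lborel)"
    using integral_reflect[of "\<lambda>y. u y *\<^sub>R K (x - y)" x] by (simp add: velocity_def)
  show "integrable lborel (\<lambda>z. u (x - z) *\<^sub>R K z) \<Longrightarrow> integrable lborel (\<lambda>y. u y *\<^sub>R K (x - y))"
    using integrable_reflect[of "\<lambda>y. u y *\<^sub>R K (x - y)" x] by simp
qed

end

section \<open>Estimates for a single time slice\<close>

locale density = confining_kernel \<kappa> g for \<kappa> and g :: "'a::euclidean_space \<Rightarrow> real" +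
  fixes u :: "'a \<Rightarrow> real" and R M :: real
  assumes u_cont: "continuous_on UNIV u" and u_supp: "\<And>x. R \<le> norm x \<Longrightarrow> u x = 0"
    and u_nonneg: "\<And>x. 0 \<le> u x" and u_le: "\<And>x. u x \<le> M"
    and u_mass: "(\<integral>x. u x \<partial>lborel) = 1" and u_center: "(\<integral>x. u x *\<^sub>R x \<partial>lborel) = 0"
    and R_pos: "0 < R"
begin

lemma u_measurable[measurable]: "u \<in> borel_measurable borel"
  using u_cont by (rule borel_measurable_continuous_onI)

lemma M_nonneg: "0 \<le> M" using u_nonneg[of 0] u_le[of 0] by simp

lemma u_times_integrable:
  fixes f :: "'a \<Rightarrow> 'b::{banach, second_countable_topology}"
  shows "continuous_on UNIV f \<Longrightarrow> integrable lborel (\<lambda>x. u x *\<^sub>R f x)"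
  by (rule integrable_continuous_compact_support[of _ R]) (auto intro!: continuous_intros u_cont u_supp)

lemma u_times_integrable_real:
  fixes f :: "'a \<Rightarrow> real"
  shows "continuous_on UNIV f \<Longrightarrow> integrable lborel (\<lambda>x. u x * f x)"
  using u_times_integrable[of f] by simp

lemma u_integrable: "integrable lborel u"
  using u_times_integrable_real[of "\<lambda>_. 1"] by simp

lemma inverse_norm_power_locally_integrable:
  "integrable lborel (\<lambda>z::'a. indicator (cball 0 d) z * inverse (norm z ^ (DIM('a) - 1)))"
  using integrable_inverse_norm_power[of d, where 'a='a] by (cases "0 \<le> d") simp_all

lemma u_times_inverse_norm_power_integrable:
  "integrable lborel (\<lambda>y. u y * inverse (norm (x - y) ^ (DIM('a) - 1)))"
proof -
  let ?q = "\<lambda>z::'a. indicator (cball 0 (norm x + R)) z * inverse (norm z ^ (DIM('a) - 1))"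
  have i: "integrable lborel (\<lambda>y. M * ?q (x - y))"
    using inverse_norm_power_locally_integrable[of "norm x + R"] integrable_reflect[of ?q x] by simp
  show ?thesis
  proof (rule Bochner_Integration.integrable_bound[OF i])
    show "AE y in lborel. norm (u y * inverse (norm (x - y) ^ (DIM('a) - 1))) \<le> norm (M * ?q (x - y))"
    proof (rule AE_I2)
      fix y
      show "norm (u y * inverse (norm (x - y) ^ (DIM('a) - 1))) \<le> norm (M * ?q (x - y))"
      proof (cases "R \<le> norm y")
        case False
        then have "norm (x - y) \<le> norm x + R" using norm_triangle_ineq4[of x y] by linarith
        then show ?thesis using u_nonneg[of y] u_le[of y] M_nonneg by (simp add: mult_right_mono abs_mult)
      qed (simp add: u_supp)
    qed
  qed measurable
qed

lemma near_field_bound: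
  assumes "0 \<le> d"
  shows "(\<integral>y. u y * (indicator (cball 0 d) (x - y) * inverse (norm (x - y) ^ (DIM('a) - 1))) \<partial>lborel)
       \<le> M * (sphere_area TYPE('a) * d)"
    and "integrable lborel (\<lambda>y. u y * (indicator (cball 0 d) (x - y) * inverse (norm (x - y) ^ (DIM('a) - 1))))"
proof -
  let ?q = "\<lambda>z::'a. indicator (cball 0 d) z * inverse (norm z ^ (DIM('a) - 1))"
  have i: "integrable lborel (\<lambda>y. M * ?q (x - y))"
    using inverse_norm_power_locally_integrable[of d] integrable_reflect[of ?q x] by simp
  show i2: "integrable lborel (\<lambda>y. u y * ?q (x - y))"
    by (rule Bochner_Integration.integrable_bound[OF u_times_inverse_norm_power_integrable[of x]])
      (measurable, auto simp: indicator_def)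
  have "(\<integral>y. u y * ?q (x - y) \<partial>lborel) \<le> (\<integral>y. M * ?q (x - y) \<partial>lborel)"
    using u_le by (intro integral_mono i i2) (auto intro!: mult_right_mono)
  also have "\<dots> = M * (sphere_area TYPE('a) * d)"
    using integral_reflect[of ?q x] integral_inverse_norm_power[OF assms, where 'a='a] by simp
  finally show "(\<integral>y. u y * ?q (x - y) \<partial>lborel) \<le> M * (sphere_area TYPE('a) * d)" .
qed

text \<open>The kernel here is |x - y|^(2-N): at most |x - y|^(1-N) within distance 1, and at most 1
  beyond because N >= 2. The bound depends on neither \<open>x\<close> nor the support.\<close>

lemma repulsion_energy_bound:
  shows "(\<integral>y. u y * (norm (x - y) * inverse (norm (x - y) ^ (DIM('a) - 1))) \<partial>lborel)
     \<le> M * sphere_area TYPE('a) + 1"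
    and "integrable lborel (\<lambda>y. u y * (norm (x - y) * inverse (norm (x - y) ^ (DIM('a) - 1))))"
proof -
  let ?p = "\<lambda>y. indicator (cball 0 1) (x - y) * inverse (norm (x - y) ^ (DIM('a) - 1))"
  have iu: "integrable lborel u" using u_times_integrable[of "\<lambda>_. 1::real"] by simp
  have bd: "norm z * inverse (norm z ^ (DIM('a) - 1)) \<le> indicator (cball 0 1) z * inverse (norm z ^ (DIM('a) - 1)) + 1" for z :: 'a
  proof (cases "norm z \<le> 1")
    case True
    then have "norm z * inverse (norm z ^ (DIM('a) - 1)) \<le> 1 * inverse (norm z ^ (DIM('a) - 1))"
      by (intro mult_right_mono) auto
    then show ?thesis using True by simp
  next
    case False
    then have "norm z ^ 1 \<le> norm z ^ (DIM('a) - 1)" using dim by (intro power_increasing) auto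
    then have "norm z * inverse (norm z ^ (DIM('a) - 1)) \<le> 1" using False
      by (simp add: divide_inverse[symmetric])
    then show ?thesis using False by simp
  qed
  note n = near_field_bound[of 1 x]
  have i1: "integrable lborel (\<lambda>y. u y * ?p y + u y)" using n(2) iu by simp
  have le: "u y * (norm (x - y) * inverse (norm (x - y) ^ (DIM('a) - 1))) \<le> u y * ?p y + u y" for y
    using mult_left_mono[OF bd[of "x - y"] u_nonneg[of y]] by (simp add: distrib_left)
  show i2: "integrable lborel (\<lambda>y. u y * (norm (x - y) * inverse (norm (x - y) ^ (DIM('a) - 1))))"
  proof (rule Bochner_Integration.integrable_bound[OF i1])
    show "AE y in lborel. norm (u y * (norm (x - y) * inverse (norm (x - y) ^ (DIM('a) - 1)))) \<le> norm (u y * ?p y + u y)"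
      using le u_nonneg by (auto simp: abs_mult intro!: order_trans[OF le abs_ge_self])
  qed measurable
  have "(\<integral>y. u y * (norm (x - y) * inverse (norm (x - y) ^ (DIM('a) - 1))) \<partial>lborel) \<le> (\<integral>y. u y * ?p y + u y \<partial>lborel)"
    by (intro integral_mono i1 i2 le)
  also have "\<dots> = (\<integral>y. u y * ?p y \<partial>lborel) + 1" using n(2) iu u_mass by simp
  also have "\<dots> \<le> M * sphere_area TYPE('a) + 1" using n(1) by simp
  finally show "(\<integral>y. u y * (norm (x - y) * inverse (norm (x - y) ^ (DIM('a) - 1))) \<partial>lborel)
     \<le> M * sphere_area TYPE('a) + 1" .
qed

text \<open>Jensen's inequality: with unit mass centred at 0, the mean of x - y is x. It turns
  pairwise distances into the distance from the origin.\<close>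

lemma mean_distance_ge: "norm x \<le> (\<integral>y. u y * norm (x - y) \<partial>lborel)"
proof -
  have i: "integrable lborel (\<lambda>y. u y *\<^sub>R (x - y))" by (intro u_times_integrable continuous_intros)
  have "(\<integral>y. u y *\<^sub>R (x - y) \<partial>lborel) = (\<integral>y. u y *\<^sub>R x - u y *\<^sub>R y \<partial>lborel)"
    by (simp add: scaleR_right_diff_distrib)
  also have "\<dots> = (\<integral>y. u y *\<^sub>R x \<partial>lborel) - (\<integral>y. u y *\<^sub>R y \<partial>lborel)"
    by (intro Bochner_Integration.integral_diff u_times_integrable continuous_intros)
  also have "\<dots> = x"
    using u_mass u_center u_times_integrable[of "\<lambda>_. 1::real"] by simp
  finally have "norm x = norm (\<integral>y. u y *\<^sub>R (x - y) \<partial>lborel)" by simp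
  also have "\<dots> \<le> (\<integral>y. norm (u y *\<^sub>R (x - y)) \<partial>lborel)" by (rule integral_norm_bound)
  finally show ?thesis using u_nonneg by simp
qed

lemma inner_center: "(\<integral>y. u y * (x \<bullet> (x - y)) \<partial>lborel) = (norm x)\<^sup>2"
proof -
  have "(\<integral>y. u y * (x \<bullet> (x - y)) \<partial>lborel) = (\<integral>y. u y * (norm x)\<^sup>2 - x \<bullet> (u y *\<^sub>R y) \<partial>lborel)"
    by (simp add: inner_diff_right power2_norm_eq_inner algebra_simps)
  also have "\<dots> = (\<integral>y. u y * (norm x)\<^sup>2 \<partial>lborel) - (\<integral>y. x \<bullet> (u y *\<^sub>R y) \<partial>lborel)"
    using u_times_integrable[of "\<lambda>_. (norm x)\<^sup>2"] u_times_integrable[of "\<lambda>y. y"]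
    by (intro Bochner_Integration.integral_diff integrable_inner_right) auto
  also have "\<dots> = (norm x)\<^sup>2"
    using integral_inner_right[of x lborel "\<lambda>y. u y *\<^sub>R y"] u_times_integrable[of "\<lambda>y. y"] u_mass u_center
      u_times_integrable[of "\<lambda>_. 1::real"] by (simp del: inner_scaleR_right)
  finally show ?thesis .
qed

lemma u_K_integrable: "integrable lborel (\<lambda>y. u y *\<^sub>R K (x - y))"
  by (rule velocity_eq(2)[OF u_cont velocity_integrable[OF u_cont u_supp order_refl]])

lemma inner_velocity: "v \<bullet> velocity u x = (\<integral>y. u y * (v \<bullet> K (x - y)) \<partial>lborel)"
  using u_K_integrable[of x] by (simp add: velocity_eq(1)[OF u_cont] flip: integral_inner_right)

lemma inner_K:
  assumes "z \<noteq> 0"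
  shows "v \<bullet> K z = \<kappa> (norm z) * (v \<bullet> z) / norm z - (v \<bullet> z) / (sphere_area TYPE('a) * norm z ^ DIM('a))"
  using assms by (simp add: K_def left_diff_distrib)

text \<open>Here \<open>k\<close> bounds the attraction from below at distances in \<open>[r0, 2R]\<close>. Symmetrising in \<open>x\<close> and \<open>y\<close> gains
  a factor \<open>|x - y|\<^sup>2\<close>, which makes the repulsive part integrable uniformly in \<open>x\<close>.\<close>

lemma fourth_moment_virial:
  assumes k: "0 \<le> k" "0 \<le> r0" "\<And>r. r0 \<le> r \<Longrightarrow> 0 < r \<Longrightarrow> r \<le> 2 * R \<Longrightarrow> k \<le> \<kappa> r"
  defines "C1 \<equiv> 3 / 2 / sphere_area TYPE('a) * (M * sphere_area TYPE('a) + 1)"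
  shows "(\<integral>x. u x * ((norm x)\<^sup>2 * (x \<bullet> velocity u x)) \<partial>lborel) \<ge>
     k / 2 * (\<integral>x. u x * norm x ^ 3 \<partial>lborel) - (k * r0 / 2 + C1) * (\<integral>x. u x * (norm x)\<^sup>2 \<partial>lborel)"
proof -
  let ?s = "sphere_area TYPE('a)"
  have s: "0 < ?s" by (rule sphere_area_pos)
  \<comment> \<open>Lower bound for the symmetrised kernel per unit of |x|^2 + |y|^2. The attraction
    k |z| / 2 is lowered by k r0 / 2, which makes it nonpositive for |z| <= r0, where \<kappa> is
    only known to be nonnegative; the repulsion has order |z|^(2-N).\<close>
  define h where "h z = k / 2 * (norm z - r0) - 3 / 2 / ?s * (norm z * inverse (norm z ^ (DIM('a) - 1)))" for z :: 'a
  have [measurable]: "h \<in> borel_measurable borel" unfolding h_def by measurable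
  define \<Theta> where "\<Theta> x y = u x * u y * ((norm x)\<^sup>2 * (x \<bullet> K (x - y)))" for x y
  define \<Xi> where "\<Xi> x y = u x * u y * ((norm x)\<^sup>2 * h (x - y))" for x y
  have hR: "integrable lborel (\<lambda>z. indicator (cball 0 d) z * \<bar>h z\<bar>)" for d
  proof -
    let ?b = "\<lambda>z::'a. (k / 2 * (\<bar>d\<bar> + \<bar>r0\<bar>)) * indicator (cball 0 d) z + (3 / 2 / ?s * \<bar>d\<bar>) * (indicator (cball 0 d) z * inverse (norm z ^ (DIM('a) - 1)))"
    have "integrable lborel ?b"
      by (intro Bochner_Integration.integrable_add integrable_cball_indicator integrable_mult_right inverse_norm_power_locally_integrable)
    then show ?thesis
    proof (rule Bochner_Integration.integrable_bound)
      show "AE z in lborel. norm (indicator (cball 0 d) z * \<bar>h z\<bar>) \<le> norm (?b z)"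
      proof (rule AE_I2)
        fix z :: 'a
        show "norm (indicator (cball 0 d) z * \<bar>h z\<bar>) \<le> norm (?b z)"
        proof (cases "norm z \<le> d")
          case True
          have "\<bar>h z\<bar> \<le> \<bar>k / 2 * (norm z - r0)\<bar> + \<bar>3 / 2 / ?s * (norm z * inverse (norm z ^ (DIM('a) - 1)))\<bar>"
            unfolding h_def by (rule abs_triangle_ineq4)
          also have "\<bar>k / 2 * (norm z - r0)\<bar> \<le> k / 2 * (\<bar>d\<bar> + \<bar>r0\<bar>)"
            using True k(1) norm_ge_zero[of z] unfolding abs_mult by (intro mult_mono) (auto simp del: norm_ge_zero)
          also have "\<bar>3 / 2 / ?s * (norm z * inverse (norm z ^ (DIM('a) - 1)))\<bar> \<le> 3 / 2 / ?s * (\<bar>d\<bar> * inverse (norm z ^ (DIM('a) - 1)))"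
            using True s unfolding abs_mult by (intro mult_mono) auto
          finally show ?thesis using True by (simp add: mult.assoc)
        qed simp
      qed
    qed measurable
  qed
  have uM: "u x * u y \<le> M * M" for x y by (intro mult_mono u_le u_nonneg M_nonneg)
  have \<Theta>b: "\<bar>\<Theta> x y\<bar> \<le> (M * M * R ^ 3) * (indicator (cball 0 R) x * indicator (cball 0 R) y * norm (K (x - y)))" for x y
  proof (cases "norm x < R \<and> norm y < R")
    case True
    have "\<bar>x \<bullet> K (x - y)\<bar> \<le> R * norm (K (x - y))"
      using True by (intro order_trans[OF Cauchy_Schwarz_ineq2] mult_right_mono) auto
    moreover have "(norm x)\<^sup>2 \<le> R\<^sup>2" using True by (intro power_mono) auto
    ultimately have "(norm x)\<^sup>2 * \<bar>x \<bullet> K (x - y)\<bar> \<le> R\<^sup>2 * (R * norm (K (x - y)))" by (intro mult_mono) auto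
    then have "u x * u y * ((norm x)\<^sup>2 * \<bar>x \<bullet> K (x - y)\<bar>) \<le> (M * M) * (R\<^sup>2 * (R * norm (K (x - y))))"
      by (rule mult_mono[OF uM]) (auto simp: M_nonneg)
    then show ?thesis using True u_nonneg by (simp add: \<Theta>_def abs_mult power2_eq_square power3_eq_cube mult.assoc)
  next
    case False
    then have "\<Theta> x y = 0" using u_supp[of x] u_supp[of y] by (auto simp: \<Theta>_def not_less)
    then show ?thesis using M_nonneg R_pos by simp
  qed
  have \<Xi>b: "\<bar>\<Xi> x y\<bar> \<le> (M * M * R\<^sup>2) * (indicator (cball 0 R) x * indicator (cball 0 R) y * \<bar>h (x - y)\<bar>)" for x y
  proof (cases "norm x < R \<and> norm y < R")
    case True
    have "(norm x)\<^sup>2 \<le> R\<^sup>2" using True by (intro power_mono) auto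
    then have "(norm x)\<^sup>2 * \<bar>h (x - y)\<bar> \<le> R\<^sup>2 * \<bar>h (x - y)\<bar>" by (intro mult_mono) auto
    then have "u x * u y * ((norm x)\<^sup>2 * \<bar>h (x - y)\<bar>) \<le> (M * M) * (R\<^sup>2 * \<bar>h (x - y)\<bar>)"
      by (rule mult_mono[OF uM]) (auto simp: M_nonneg)
    then show ?thesis using True u_nonneg by (simp add: \<Xi>_def abs_mult mult.assoc)
  next
    case False
    then have "\<Xi> x y = 0" using u_supp[of x] u_supp[of y] by (auto simp: \<Xi>_def not_less)
    then show ?thesis using M_nonneg by simp
  qed
  note \<Theta>i = integrable_difference_kernel[of \<Theta> "\<lambda>z. norm (K z)", OF _ _ _ K_norm_locally_integrable \<Theta>b]
  note \<Xi>i = integrable_difference_kernel[of \<Xi> "\<lambda>z. \<bar>h z\<bar>", OF _ _ _ hR \<Xi>b]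
  have m1: "(\<lambda>(x, y). \<Theta> x y) \<in> borel_measurable (borel \<Otimes>\<^sub>M borel)" unfolding \<Theta>_def by measurable
  have m2: "(\<lambda>(x, y). \<Xi> x y) \<in> borel_measurable (borel \<Otimes>\<^sub>M borel)" unfolding \<Xi>_def by measurable
  have \<Theta>I: "integrable (lborel \<Otimes>\<^sub>M lborel) (\<lambda>(x, y). \<Theta> x y)" by (rule \<Theta>i(1)) (use m1 in auto)
  have \<Xi>I: "integrable (lborel \<Otimes>\<^sub>M lborel) (\<lambda>(x, y). \<Xi> x y)" by (rule \<Xi>i(1)) (use m2 in auto)
  have \<Theta>S: "integrable (lborel \<Otimes>\<^sub>M lborel) (\<lambda>(x, y). \<Theta> y x)"
    using lborel_pair.integrable_product_swap[OF \<Theta>I] by simp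
  have \<Xi>S: "integrable (lborel \<Otimes>\<^sub>M lborel) (\<lambda>(x, y). \<Xi> y x)"
    using lborel_pair.integrable_product_swap[OF \<Xi>I] by simp
  have swap: "(\<integral>p. (case p of (x, y) \<Rightarrow> F y x) \<partial>(lborel \<Otimes>\<^sub>M lborel)) = (\<integral>p. (case p of (x, y) \<Rightarrow> F x y) \<partial>(lborel \<Otimes>\<^sub>M lborel))"
    if "integrable (lborel \<Otimes>\<^sub>M lborel) (\<lambda>(x, y). F x y)" for F :: "'a \<Rightarrow> 'a \<Rightarrow> real"
    using lborel_pair.integral_product_swap[of "\<lambda>(x, y). F x y"] that by (simp add: split_beta')
  \<comment> \<open>The comparison is made for the sum over both orders of \<open>x\<close> and
    \<open>y\<close>; by \<open>swap\<close> each side then integrates to twice its unsymmetrised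
    integral.\<close>
  have pt: "\<Xi> x y + \<Xi> y x \<le> \<Theta> x y + \<Theta> y x" for x y
  proof (cases "norm x < R \<and> norm y < R")
    case False
    then show ?thesis using u_supp[of x] u_supp[of y] by (auto simp: \<Theta>_def \<Xi>_def not_less)
  next
    case True
    define z where "z = x - y"
    define P where "P = (norm x)\<^sup>2 + (norm y)\<^sup>2"
    define I where "I = ((norm x)\<^sup>2 *\<^sub>R x - (norm y)\<^sup>2 *\<^sub>R y) \<bullet> z"
    have P: "0 \<le> P" by (simp add: P_def)
    have Kyx: "K (y - x) = - K z" using K_minus[of z] by (simp add: z_def)
    have hyx: "h (y - x) = h z" by (simp add: h_def z_def norm_minus_commute)
    have e1: "\<Theta> x y + \<Theta> y x = u x * u y * (((norm x)\<^sup>2 *\<^sub>R x - (norm y)\<^sup>2 *\<^sub>R y) \<bullet> K z)"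
      unfolding \<Theta>_def Kyx by (simp add: z_def inner_diff_left algebra_simps)
    have e2: "\<Xi> x y + \<Xi> y x = u x * u y * (P * h z)"
      unfolding \<Xi>_def hyx by (simp add: z_def P_def algebra_simps)
    have "P * h z \<le> ((norm x)\<^sup>2 *\<^sub>R x - (norm y)\<^sup>2 *\<^sub>R y) \<bullet> K z"
    proof (cases "z = 0")
      case True
      then have "h z \<le> 0" using k dim by (simp add: h_def)
      then show ?thesis using True P by (simp add: K_def mult_nonneg_nonpos)
    next
      case False
      define r where "r = norm z"
      have r: "0 < r" "r \<le> 2 * R" using False True norm_triangle_ineq4[of x y] by (auto simp: r_def z_def)
      have I: "P * r\<^sup>2 / 2 \<le> I" "I \<le> 3 / 2 * (P * r\<^sup>2)"
        unfolding I_def P_def r_def z_def by (rule cubic_inner_bounds)+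
      have I0: "0 \<le> I" using I(1) P by (smt (verit) divide_nonneg_nonneg mult_nonneg_nonneg zero_le_power2)
      have rN: "r ^ DIM('a) = r * r ^ (DIM('a) - 1)" using dim by (cases "DIM('a)") auto
      have a: "P * (k / 2 * (r - r0)) \<le> \<kappa> r * I / r"
      proof (cases "r0 \<le> r")
        case True
        then have kr: "k \<le> \<kappa> r" using k(3) r by auto
        have "P * (k / 2 * (r - r0)) \<le> P * (k / 2 * r)" using P k by (intro mult_left_mono) auto
        also have "\<dots> = k * (P * r\<^sup>2 / 2) / r" using r by (simp add: power2_eq_square)
        also have "\<dots> \<le> \<kappa> r * I / r" using kr I(1) k(1) I0 P r by (intro divide_right_mono mult_mono) auto
        finally show ?thesis .
      next
        case False
        then have "P * (k / 2 * (r - r0)) \<le> 0" using P k by (intro mult_nonneg_nonpos) auto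
        also have "0 \<le> \<kappa> r * I / r" using \<kappa>_nonneg[of r] I0 r by auto
        finally show ?thesis .
      qed
      have "I / (?s * r ^ DIM('a)) \<le> 3 / 2 * (P * r\<^sup>2) / (?s * r ^ DIM('a))"
        using I(2) s r by (intro divide_right_mono) auto
      also have "\<dots> = P * (3 / 2 / ?s * (r * inverse (r ^ (DIM('a) - 1))))"
        using r s by (simp add: rN power2_eq_square field_simps)
      finally show ?thesis using a unfolding inner_K[OF False] h_def r_def[symmetric] I_def[symmetric]
        by (simp add: right_diff_distrib)
    qed
    then show ?thesis unfolding e1 e2 by (intro mult_left_mono mult_nonneg_nonneg u_nonneg)
  qed
  have "(\<integral>p. (case p of (x, y) \<Rightarrow> \<Xi> x y) + (case p of (x, y) \<Rightarrow> \<Xi> y x) \<partial>(lborel \<Otimes>\<^sub>M lborel))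
     \<le> (\<integral>p. (case p of (x, y) \<Rightarrow> \<Theta> x y) + (case p of (x, y) \<Rightarrow> \<Theta> y x) \<partial>(lborel \<Otimes>\<^sub>M lborel))"
    using pt by (intro integral_mono Bochner_Integration.integrable_add \<Theta>I \<Theta>S \<Xi>I \<Xi>S) auto
  then have dbl: "(\<integral>p. (case p of (x, y) \<Rightarrow> \<Xi> x y) \<partial>(lborel \<Otimes>\<^sub>M lborel)) \<le> (\<integral>p. (case p of (x, y) \<Rightarrow> \<Theta> x y) \<partial>(lborel \<Otimes>\<^sub>M lborel))"
    using \<Theta>I \<Theta>S \<Xi>I \<Xi>S swap[OF \<Theta>I] swap[OF \<Xi>I] by simp
  have "(\<integral>x. (\<integral>y. \<Xi> x y \<partial>lborel) \<partial>lborel) \<le> (\<integral>x. (\<integral>y. \<Theta> x y \<partial>lborel) \<partial>lborel)"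
    using dbl lborel_pair.integral_fst[of \<Theta>] lborel_pair.integral_fst[of \<Xi>] \<Theta>I \<Xi>I by simp
  moreover have "(\<integral>y. \<Theta> x y \<partial>lborel) = u x * ((norm x)\<^sup>2 * (x \<bullet> velocity u x))" for x
    unfolding inner_velocity by (simp add: \<Theta>_def mult_ac flip: integral_mult_right_zero)
  ultimately have 1: "(\<integral>x. (\<integral>y. \<Xi> x y \<partial>lborel) \<partial>lborel) \<le> (\<integral>x. u x * ((norm x)\<^sup>2 * (x \<bullet> velocity u x)) \<partial>lborel)" by simp
  \<comment> \<open>\<open>mean_distance_ge\<close> bounds the mean of |x - y| below by |x|, and
    \<open>repulsion_energy_bound\<close> supplies \<open>C1\<close>.\<close>
  have inner: "u x * ((norm x)\<^sup>2 * (k / 2 * (norm x - r0) - C1)) \<le> (\<integral>y. \<Xi> x y \<partial>lborel)" for x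
  proof -
    have i1: "integrable lborel (\<lambda>y. u y * norm (x - y))" "integrable lborel u"
      by (intro u_times_integrable_real continuous_intros) (rule u_integrable)
    note i2 = repulsion_energy_bound[of x]
    have e: "u y * h (x - y) = k / 2 * (u y * norm (x - y)) - k / 2 * r0 * u y - 3 / 2 / ?s * (u y * (norm (x - y) * inverse (norm (x - y) ^ (DIM('a) - 1))))" for y
      unfolding h_def right_diff_distrib by (simp only: mult_ac)
    have "(\<integral>y. u y * h (x - y) \<partial>lborel) = k / 2 * (\<integral>y. u y * norm (x - y) \<partial>lborel) - k / 2 * r0
       - 3 / 2 / ?s * (\<integral>y. u y * (norm (x - y) * inverse (norm (x - y) ^ (DIM('a) - 1))) \<partial>lborel)"
      unfolding e using i1 i2(2) u_mass
      by (simp only: Bochner_Integration.integral_diff Bochner_Integration.integrable_diff integrable_mult_right integral_mult_right_zero mult_1_right)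
    also have "\<dots> \<ge> k / 2 * norm x - k / 2 * r0 - C1"
      unfolding C1_def using s k(1) by (intro diff_mono order_refl mult_left_mono i2(1) mean_distance_ge) auto
    finally have "(k / 2 * (norm x - r0) - C1) \<le> (\<integral>y. u y * h (x - y) \<partial>lborel)" by (simp add: right_diff_distrib)
    then have "u x * ((norm x)\<^sup>2 * (k / 2 * (norm x - r0) - C1)) \<le> u x * ((norm x)\<^sup>2 * (\<integral>y. u y * h (x - y) \<partial>lborel))"
      by (intro mult_left_mono u_nonneg) auto
    also have "\<dots> = (\<integral>y. \<Xi> x y \<partial>lborel)"
      by (simp add: \<Xi>_def mult_ac flip: integral_mult_right_zero)
    finally show ?thesis .
  qed
  have m3: "integrable lborel (\<lambda>x. u x * norm x ^ 3)" "integrable lborel (\<lambda>x. u x * (norm x)\<^sup>2)"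
    by (intro u_times_integrable_real continuous_intros)+
  have e3: "u x * ((norm x)\<^sup>2 * (k / 2 * (norm x - r0) - C1)) = k / 2 * (u x * norm x ^ 3) - (k * r0 / 2 + C1) * (u x * (norm x)\<^sup>2)" for x
    by (simp add: power2_eq_square power3_eq_cube field_simps)
  have "k / 2 * (\<integral>x. u x * norm x ^ 3 \<partial>lborel) - (k * r0 / 2 + C1) * (\<integral>x. u x * (norm x)\<^sup>2 \<partial>lborel)
     = (\<integral>x. u x * ((norm x)\<^sup>2 * (k / 2 * (norm x - r0) - C1)) \<partial>lborel)"
    unfolding e3 using m3 by simp
  also have "\<dots> \<le> (\<integral>x. (\<integral>y. \<Xi> x y \<partial>lborel) \<partial>lborel)"
  proof (rule integral_mono)
    show "integrable lborel (\<lambda>x. u x * ((norm x)\<^sup>2 * (k / 2 * (norm x - r0) - C1)))" unfolding e3 using m3 by simp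
    show "integrable lborel (\<lambda>x. \<integral>y. \<Xi> x y \<partial>lborel)" using lborel_pair.integrable_fst[OF \<Xi>I] by simp
  qed (rule inner)
  finally show ?thesis using 1 by linarith
qed

text \<open>Mass at distance less than \<open>|x| / 2\<close> from \<open>x\<close> lies outside the ball of radius \<open>|x| / 2\<close>, so it is
  controlled by the fourth moment.\<close>

lemma inward_velocity:
  assumes x: "R \<le> norm x" and k: "0 \<le> k" "0 \<le> r0" "\<And>r. r0 \<le> r \<Longrightarrow> 0 < r \<Longrightarrow> r \<le> 2 * norm x \<Longrightarrow> k \<le> \<kappa> r"
    and d: "0 < d"
  shows "x \<bullet> velocity u x \<ge> k * (norm x - r0) / 2 - norm x / sphere_area TYPE('a) *
     (M * (sphere_area TYPE('a) * d) + inverse (d ^ (DIM('a) - 1)) * (16 / norm x ^ 4 * (\<integral>y. u y * norm y ^ 4 \<partial>lborel))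
        + inverse ((norm x / 2) ^ (DIM('a) - 1)))"
proof -
  let ?s = "sphere_area TYPE('a)" and ?X = "norm x" and ?n = "DIM('a) - 1"
  have s: "0 < ?s" by (rule sphere_area_pos)
  have X: "0 < ?X" using x R_pos by linarith
  \<comment> \<open>Since |x - y| <= 2 |x|, this makes \<open>a * (x \<bullet> z)\<close> a lower
    bound for the attraction beyond \<open>r0\<close> that is affine in \<open>y\<close>, so that
    \<open>inner_center\<close> evaluates its integral exactly.\<close>
  define a where "a = k / (2 * ?X)"
  have a: "0 \<le> a" using k X by (simp add: a_def)
  define b where "b = inverse (d ^ ?n)"
  define c where "c = inverse ((?X / 2) ^ ?n)"
  have bc: "0 \<le> b" "0 \<le> c" using d by (auto simp: b_def c_def)
  \<comment> \<open>Majorant of |x - y|^(1-N) in three ranges. Up to \<open>d\<close> the kernel is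
    kept. Between \<open>d\<close> and |x|/2 it is at most \<open>b\<close>, and |y| >= |x|/2 there,
    so the weight (2 |y| / |x|)^4, whence the 16, is at least 1. Beyond |x|/2 it is at most
    \<open>c\<close>.\<close>
  define P where "P y = indicator (cball 0 d) (x - y) * inverse (norm (x - y) ^ ?n) + b * (16 / ?X ^ 4 * norm y ^ 4) + c" for y
  note i1 = u_integrable
  have i2: "integrable lborel (\<lambda>y. u y * (x \<bullet> (x - y)))"
    by (intro u_times_integrable_real continuous_intros)
  have i3: "integrable lborel (\<lambda>y. u y * norm y ^ 4)"
    by (intro u_times_integrable_real continuous_intros)
  note n = near_field_bound[OF less_imp_le[OF d], of x]
  have inv: "inverse (norm (x - y) ^ ?n) \<le> P y" for y
  proof -
    have nn: "0 \<le> b * (16 / ?X ^ 4 * norm y ^ 4)" using bc by simp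
    consider "norm (x - y) \<le> d" | "d < norm (x - y)" "norm (x - y) < ?X / 2" | "?X / 2 \<le> norm (x - y)" "d < norm (x - y)" by linarith
    then show ?thesis
    proof cases
      case 1
      then show ?thesis using nn bc by (simp add: P_def)
    next
      case 2
      then have "?X / 2 \<le> norm y" using norm_triangle_sub[of x y] by linarith
      then have "(?X / 2) ^ 4 \<le> norm y ^ 4" using X by (intro power_mono) auto
      then have "1 \<le> 16 / ?X ^ 4 * norm y ^ 4" using X by (simp add: power_divide field_simps)
      then have "b * 1 \<le> b * (16 / ?X ^ 4 * norm y ^ 4)" using bc by (intro mult_left_mono)
      moreover have "inverse (norm (x - y) ^ ?n) \<le> b"
        unfolding b_def using 2 d by (intro le_imp_inverse_le power_mono) auto
      ultimately show ?thesis using 2 bc by (simp add: P_def)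
    next
      case 3
      then have "inverse (norm (x - y) ^ ?n) \<le> c"
        unfolding c_def using X by (intro le_imp_inverse_le power_mono) auto
      then show ?thesis using 3 nn by (simp add: P_def)
    qed
  qed
  have pt: "u y * (a * (x \<bullet> (x - y)) - a * (r0 * ?X) - ?X / ?s * P y) \<le> u y * (x \<bullet> K (x - y))" for y
  proof (cases "R \<le> norm y")
    case False
    define z where "z = x - y"
    have z: "z \<noteq> 0" using False x by (auto simp: z_def)
    define r where "r = norm z"
    have r: "0 < r" "r \<le> 2 * ?X" using z False x norm_triangle_ineq4[of x y] by (auto simp: r_def z_def)
    have xz_le: "x \<bullet> z \<le> ?X * r" unfolding r_def by (rule norm_cauchy_schwarz)
    \<comment> \<open>As |y| < R <= |x|, every portion of the mass attracts \<open>x\<close>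
      inwards, so \<kappa> may be replaced by smaller values.\<close>
    have "x \<bullet> y \<le> ?X * norm y" by (rule norm_cauchy_schwarz)
    also have "\<dots> \<le> ?X * ?X" using False x by (intro mult_left_mono) auto
    finally have xz: "0 \<le> x \<bullet> z" by (simp add: z_def inner_diff_right power2_norm_eq_inner[symmetric] power2_eq_square)
    have rN: "r ^ DIM('a) = r * r ^ ?n" using dim by (cases "DIM('a)") auto
    have attr: "a * (x \<bullet> z) - a * (r0 * ?X) \<le> \<kappa> r * (x \<bullet> z) / r"
    proof (cases "r0 \<le> r")
      case True
      then have kr: "k \<le> \<kappa> r" using k(3) r by auto
      have "a * (x \<bullet> z) = k * (x \<bullet> z) / (2 * ?X)" by (simp add: a_def)
      also have "\<dots> \<le> k * (x \<bullet> z) / r" using r xz k X by (intro divide_left_mono) auto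
      also have "\<dots> \<le> \<kappa> r * (x \<bullet> z) / r" using kr xz r by (intro divide_right_mono mult_right_mono) auto
      finally have "a * (x \<bullet> z) \<le> \<kappa> r * (x \<bullet> z) / r" .
      moreover have "0 \<le> a * (r0 * ?X)" using a k by simp
      ultimately show ?thesis by linarith
    next
      case False
      have "r * ?X \<le> r0 * ?X" using False by (intro mult_right_mono) auto
      then have "x \<bullet> z \<le> r0 * ?X" using xz_le unfolding mult.commute[of ?X] by linarith
      then have "a * (x \<bullet> z) \<le> a * (r0 * ?X)" using a by (rule mult_left_mono)
      moreover have "0 \<le> \<kappa> r * (x \<bullet> z) / r" using \<kappa>_nonneg[of r] xz r by auto
      ultimately show ?thesis by linarith
    qed
    have "(x \<bullet> z) / (?s * r ^ DIM('a)) \<le> (?X * r) / (?s * r ^ DIM('a))"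
      using xz_le s r by (intro divide_right_mono) auto
    also have "\<dots> = ?X / ?s * inverse (r ^ ?n)" using r by (simp add: rN field_simps)
    also have "\<dots> \<le> ?X / ?s * P y" using inv[of y] s X by (intro mult_left_mono) (auto simp: r_def z_def)
    finally have "a * (x \<bullet> z) - a * (r0 * ?X) - ?X / ?s * P y \<le> x \<bullet> K z"
      using attr unfolding inner_K[OF z] r_def[symmetric] by linarith
    then show ?thesis unfolding z_def by (intro mult_left_mono u_nonneg)
  qed (simp add: u_supp)
  have e: "u y * (a * (x \<bullet> (x - y)) - a * (r0 * ?X) - ?X / ?s * P y)
     = a * (u y * (x \<bullet> (x - y))) - a * (r0 * ?X) * u y
       - ?X / ?s * (u y * (indicator (cball 0 d) (x - y) * inverse (norm (x - y) ^ ?n)) + b * (16 / ?X ^ 4) * (u y * norm y ^ 4) + c * u y)" for y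
    unfolding P_def by (simp add: algebra_simps)
  have iL: "integrable lborel (\<lambda>y. u y * (a * (x \<bullet> (x - y)) - a * (r0 * ?X) - ?X / ?s * P y))"
    unfolding e by (intro Bochner_Integration.integrable_diff Bochner_Integration.integrable_add integrable_mult_right i1 i2 i3 n(2))
  have "integrable lborel (\<lambda>y. u y * (x \<bullet> K (x - y)))"
    using integrable_inner_right[of x lborel "\<lambda>y. u y *\<^sub>R K (x - y)"] u_K_integrable[of x] by simp
  with iL pt have "(\<integral>y. u y * (a * (x \<bullet> (x - y)) - a * (r0 * ?X) - ?X / ?s * P y) \<partial>lborel) \<le> x \<bullet> velocity u x"
    unfolding inner_velocity by (intro integral_mono)
  also have "(\<integral>y. u y * (a * (x \<bullet> (x - y)) - a * (r0 * ?X) - ?X / ?s * P y) \<partial>lborel)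
     = a * ?X\<^sup>2 - a * (r0 * ?X) - ?X / ?s * ((\<integral>y. u y * (indicator (cball 0 d) (x - y) * inverse (norm (x - y) ^ ?n)) \<partial>lborel)
        + b * (16 / ?X ^ 4) * (\<integral>y. u y * norm y ^ 4 \<partial>lborel) + c)"
    unfolding e using i1 i2 i3 n(2) inner_center[of x] u_mass
    by (simp only: Bochner_Integration.integral_diff Bochner_Integration.integral_add Bochner_Integration.integrable_diff
        Bochner_Integration.integrable_add integrable_mult_right integral_mult_right_zero mult_1_right)
  also have "a * ?X\<^sup>2 - a * (r0 * ?X) = k * (?X - r0) / 2"
    using X by (simp add: a_def power2_eq_square field_simps)
  finally have "k * (?X - r0) / 2 - ?X / ?s * ((\<integral>y. u y * (indicator (cball 0 d) (x - y) * inverse (norm (x - y) ^ ?n)) \<partial>lborel)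
        + b * (16 / ?X ^ 4) * (\<integral>y. u y * norm y ^ 4 \<partial>lborel) + c) \<le> x \<bullet> velocity u x" .
  moreover have "?X / ?s * ((\<integral>y. u y * (indicator (cball 0 d) (x - y) * inverse (norm (x - y) ^ ?n)) \<partial>lborel)
        + b * (16 / ?X ^ 4) * (\<integral>y. u y * norm y ^ 4 \<partial>lborel) + c)
      \<le> ?X / ?s * (M * (?s * d) + b * (16 / ?X ^ 4 * (\<integral>y. u y * norm y ^ 4 \<partial>lborel)) + c)"
    using n(1) s X by (intro mult_left_mono) auto
  ultimately show ?thesis unfolding b_def c_def by linarith
qed

end

section \<open>The divergence of the flux\<close>

text \<open>\<open>g\<close> is controlled on the ball only, as the velocity is only locally
  Lipschitz. When one point lies outside, \<open>f\<close> vanishes there, and the increment of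
  \<open>f\<close> alone bounds the product at the other point.\<close>

lemma lipschitz_mult_supported:
  fixes f g :: "'a::real_normed_vector \<Rightarrow> real"
  assumes f: "\<And>x y. \<bar>f x - f y\<bar> \<le> A * norm (x - y)" "\<And>x. \<bar>f x\<bar> \<le> a" "\<And>x. r \<le> norm x \<Longrightarrow> f x = 0"
    and g: "\<And>x y. norm x \<le> r \<Longrightarrow> norm y \<le> r \<Longrightarrow> \<bar>g x - g y\<bar> \<le> B * norm (x - y)" "\<And>x. norm x \<le> r \<Longrightarrow> \<bar>g x\<bar> \<le> b"
    and pos: "0 \<le> B" "0 \<le> b" "0 \<le> A"
  shows "\<bar>f x * g x - f y * g y\<bar> \<le> (A * b + a * B) * norm (x - y)"
proof -
  have a: "0 \<le> a" using f(2)[of x] by simp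
  have aB: "0 \<le> a * B * norm (x - y)" using a pos by simp
  have one: "\<bar>f x * g x\<bar> \<le> A * norm (x - y) * b" if "norm x \<le> r" "r \<le> norm y" for x y
    using f(1)[of x y] f(3)[OF that(2)] g(2)[OF that(1)] unfolding abs_mult by (intro mult_mono) (auto simp: pos)
  consider "norm x \<le> r" "norm y \<le> r" | "norm x \<le> r" "r \<le> norm y" | "r \<le> norm x" "norm y \<le> r" | "r \<le> norm x" "r \<le> norm y"
    by linarith
  then show ?thesis
  proof cases
    case 1
    have "f x * g x - f y * g y = (f x - f y) * g x + f y * (g x - g y)" by (simp add: algebra_simps)
    also have "\<bar>\<dots>\<bar> \<le> \<bar>f x - f y\<bar> * \<bar>g x\<bar> + \<bar>f y\<bar> * \<bar>g x - g y\<bar>"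
      by (metis abs_mult abs_triangle_ineq)
    also have "\<dots> \<le> (A * norm (x - y)) * b + a * (B * norm (x - y))"
      by (intro add_mono mult_mono f g 1) (auto simp: pos a)
    finally show ?thesis by (simp add: algebra_simps)
  next
    case 2
    then show ?thesis using one[of x y] aB f(3)[of y] by (simp add: algebra_simps)
  next
    case 3
    then show ?thesis using one[of y x] aB f(3)[of x] by (simp add: algebra_simps norm_minus_commute)
  next
    case 4
    then show ?thesis using f(3)[of x] f(3)[of y] aB a pos by simp
  qed
qed

text \<open>The derivative is a pointwise limit of difference quotients of a continuous function;
  continuity of \<open>F'\<close> is not assumed.\<close>

lemma borel_measurable_directional_derivative:
  fixes F :: "'a::euclidean_space \<Rightarrow> real"
  assumes "continuous_on UNIV F" and "\<And>x. ((\<lambda>s. F (x + s *\<^sub>R e)) has_real_derivative F' x) (at 0)"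
  shows "F' \<in> borel_measurable borel"
proof (rule borel_measurable_LIMSEQ_real)
  have [measurable]: "F \<in> borel_measurable borel" using assms(1) by (rule borel_measurable_continuous_onI)
  let ?h = "\<lambda>n. inverse (real (Suc n))"
  show "(\<lambda>n. (F (x + ?h n *\<^sub>R e) - F x) / ?h n) \<longlonglongrightarrow> F' x" for x
  proof -
    have "((\<lambda>h. (F (x + h *\<^sub>R e) - F x) / h) \<longlongrightarrow> F' x) (at 0)"
      using assms(2)[of x] by (simp add: DERIV_def)
    then show ?thesis
      by (rule filterlim_compose) (auto simp: filterlim_at LIMSEQ_inverse_real_of_nat simp del: of_nat_Suc)
  qed
  show "(\<lambda>x. (F (x + ?h n *\<^sub>R e) - F x) / ?h n) \<in> borel_measurable borel" for n by measurable
qed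

lemma has_divergence_directional:
  fixes F :: "'a::euclidean_space \<Rightarrow> 'a"
  assumes "has_divergence F d x"
  obtains c where "d = (\<Sum>b\<in>Basis. c b)" "\<And>b. b \<in> Basis \<Longrightarrow> ((\<lambda>s. F (x + s *\<^sub>R b) \<bullet> b) has_real_derivative c b) (at 0)"
proof -
  obtain F' where F': "(F has_derivative F') (at x)" "d = (\<Sum>b\<in>Basis. F' b \<bullet> b)"
    using assms by (auto simp: has_divergence_def)
  have "((\<lambda>s. F (x + s *\<^sub>R b) \<bullet> b) has_real_derivative F' b \<bullet> b) (at 0)" for b
  proof -
    have 1: "((\<lambda>s. x + s *\<^sub>R b) has_derivative (\<lambda>h. h *\<^sub>R b)) (at 0)" by (auto intro!: derivative_eq_intros)
    have "(F has_derivative F') (at (x + 0 *\<^sub>R b))" using F'(1) by simp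
    from has_derivative_compose[OF 1 this]
    have "((\<lambda>s. F (x + s *\<^sub>R b) \<bullet> b) has_derivative (\<lambda>h. F' (h *\<^sub>R b) \<bullet> b)) (at 0)"
      by (rule has_derivative_inner_left)
    moreover have "F' (h *\<^sub>R b) = h *\<^sub>R F' b" for h
      using F'(1) by (simp add: has_derivative_bounded_linear bounded_linear.linear linear_scale)
    ultimately show ?thesis unfolding has_field_derivative_def by (elim has_derivative_eq_rhs) auto
  qed
  then show thesis using that F'(2) by blast
qed

context confining_kernel
begin

context
  fixes u :: "'a \<Rightarrow> real" and Du r
  assumes u_C1: "C1_compact_support u Du r"
begin

interpretation C1_compact_support u Du r by (rule u_C1)

lemma velocity_lipschitz:
  obtains C where "0 < C" "\<And>x y R. norm x \<le> R \<Longrightarrow> norm y \<le> R \<Longrightarrow> norm (velocity u x - velocity u y) \<le> C * K_mass (R + r) * norm (x - y)"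
proof -
  obtain C where C: "0 < C" "\<And>x y. \<bar>u x - u y\<bar> \<le> C * norm (x - y)" using lipschitz by blast
  show thesis
  proof
    show "norm (velocity u x - velocity u y) \<le> C * K_mass (R + r) * norm (x - y)" if "norm x \<le> R" "norm y \<le> R" for x y R
    proof -
      have "norm (velocity u x - velocity u y) \<le> (C * norm (x - y)) * K_mass (R + r)"
      proof (rule velocity_diff_bound[OF cont zero that(1) cont zero that(2)])
        show "\<bar>u (x - z) - u (y - z)\<bar> \<le> C * norm (x - y)" for z using C(2)[of "x - z" "y - z"] by simp
      qed
      then show ?thesis by (simp add: mult_ac)
    qed
  qed (fact C(1))
qed

lemma velocity_continuous: "continuous_on UNIV (velocity u)"
proof -
  obtain C where C: "0 < C" "\<And>x y R. norm x \<le> R \<Longrightarrow> norm y \<le> R \<Longrightarrow> norm (velocity u x - velocity u y) \<le> C * K_mass (R + r) * norm (x - y)"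
    by (rule velocity_lipschitz) blast
  have "continuous_on (ball 0 R) (velocity u)" for R
  proof -
    have "(C * K_mass (R + r))-lipschitz_on (ball 0 R) (velocity u)"
      using C(1) K_mass_nonneg[of "R + r"] C(2)[of _ R] by (auto simp: lipschitz_on_def dist_norm intro!: less_imp_le)
    then show ?thesis by (rule lipschitz_on_continuous_on)
  qed
  then have "continuous_on (\<Union>n::nat. ball 0 (real n)) (velocity u)"
    by (intro continuous_on_open_UN) auto
  moreover have "(\<Union>n::nat. ball (0::'a) (real n)) = UNIV"
    using reals_Archimedean2 by (auto simp: set_eq_iff)
  ultimately show ?thesis by simp
qed

lemma velocity_directional_derivative:
  "((\<lambda>s. velocity u (x + s *\<^sub>R e) \<bullet> v) has_real_derivative (\<integral>z. (Du (x - z) \<bullet> e) * (K z \<bullet> v) \<partial>lborel)) (at 0)"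
  and velocity_derivative_integrable: "integrable lborel (\<lambda>z. (Du (x - z) \<bullet> e) * (K z \<bullet> v))"
proof -
  obtain C where C: "0 < C" "\<And>x y. \<bar>u x - u y\<bar> \<le> C * norm (x - y)" using lipschitz by blast
  let ?f = "\<lambda>s z. u (x + s *\<^sub>R e - z) * (K z \<bullet> v)"
  let ?R = "norm x + norm e + r"
  let ?B = "\<lambda>z. (C * norm e * norm v) * (indicator (cball 0 ?R) z * norm (K z))"
  have int: "integrable lborel (?f s)" for s
    using integrable_inner_left[of v lborel "\<lambda>z. u (x + s *\<^sub>R e - z) *\<^sub>R K z"] velocity_integrable[OF cont zero order_refl, where x="x + s *\<^sub>R e"]
    by simp
  have B: "integrable lborel ?B" by (intro integrable_mult_right K_norm_locally_integrable)
  have m: "(\<lambda>z. (Du (x - z) \<bullet> e) * (K z \<bullet> v)) \<in> borel_measurable lborel" by measurable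
  have der: "AE z in lborel. ((\<lambda>s. ?f s z) has_real_derivative (Du (x - z) \<bullet> e) * (K z \<bullet> v)) (at 0)"
  proof (rule AE_I2)
    fix z
    have "((\<lambda>s. u ((x - z) + s *\<^sub>R e)) has_real_derivative (Du (x - z + 0 *\<^sub>R e) \<bullet> e)) (at 0)" by (rule DERIV_line)
    then have "((\<lambda>s. u (x + s *\<^sub>R e - z)) has_real_derivative (Du (x - z) \<bullet> e)) (at 0)" by (simp add: algebra_simps)
    from DERIV_cmult_right[OF this, of "K z \<bullet> v"] show "((\<lambda>s. ?f s z) has_real_derivative (Du (x - z) \<bullet> e) * (K z \<bullet> v)) (at 0)" .
  qed
  have bd: "\<bar>?f s z - ?f 0 z\<bar> \<le> ?B z * \<bar>s - 0\<bar>" if s: "\<bar>s - 0\<bar> < 1" for s z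
  proof (cases "norm z \<le> ?R")
    case True
    have "\<bar>?f s z - ?f 0 z\<bar> = \<bar>u (x + s *\<^sub>R e - z) - u (x - z)\<bar> * \<bar>K z \<bullet> v\<bar>"
      by (simp add: left_diff_distrib[symmetric] abs_mult)
    also have "\<dots> \<le> (C * (\<bar>s\<bar> * norm e)) * (norm (K z) * norm v)"
      using C(2)[of "x + s *\<^sub>R e - z" "x - z"] C(1) Cauchy_Schwarz_ineq2 by (intro mult_mono) auto
    finally show ?thesis using True by (simp add: mult_ac)
  next
    case False
    have "\<bar>s\<bar> * norm e \<le> norm e" using s by (simp add: mult_left_le_one_le)
    then have "norm (x + s *\<^sub>R e) \<le> norm x + norm e" using norm_triangle_ineq[of x "s *\<^sub>R e"] by simp
    then have "r \<le> norm (x + s *\<^sub>R e - z)" "r \<le> norm (x - z)"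
      using False norm_triangle_sub[of z "x + s *\<^sub>R e"] norm_triangle_sub[of z x] norm_ge_zero[of e]
        norm_minus_commute[of z "x + s *\<^sub>R e"] norm_minus_commute[of z x] by linarith+
    then show ?thesis using C(1) by (simp add: zero)
  qed
  note D = has_real_derivative_integral[OF zero_less_one int der B m bd]
  show "integrable lborel (\<lambda>z. (Du (x - z) \<bullet> e) * (K z \<bullet> v))" by (rule D(2))
  have "velocity u (x + s *\<^sub>R e) \<bullet> v = (\<integral>z. ?f s z \<partial>lborel)" for s
    using integral_inner_left[of v lborel "\<lambda>z. u (x + s *\<^sub>R e - z) *\<^sub>R K z"] velocity_integrable[OF cont zero order_refl, where x="x + s *\<^sub>R e"]
    by (simp add: velocity_def)
  then show "((\<lambda>s. velocity u (x + s *\<^sub>R e) \<bullet> v) has_real_derivative (\<integral>z. (Du (x - z) \<bullet> e) * (K z \<bullet> v) \<partial>lborel)) (at 0)"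
    using D(1) by simp
qed

text \<open>\<open>has_divergence\<close> provides differentiability of the product u V only.
  Comparing coordinatewise with the product rule, where V is differentiated through \<open>u\<close>
  under the integral, identifies the value.\<close>

lemma divergence_flux_eq:
  assumes "has_divergence (\<lambda>y. u y *\<^sub>R velocity u y) d x"
  shows "d = Du x \<bullet> velocity u x + u x * (\<integral>z. K z \<bullet> Du (x - z) \<partial>lborel)"
proof -
  obtain c where c: "d = (\<Sum>b\<in>Basis. c b)"
    "\<And>b. b \<in> Basis \<Longrightarrow> ((\<lambda>s. (u (x + s *\<^sub>R b) *\<^sub>R velocity u (x + s *\<^sub>R b)) \<bullet> b) has_real_derivative c b) (at 0)"
    using has_divergence_directional[OF assms] by blast
  have cb: "c b = (Du x \<bullet> b) * (velocity u x \<bullet> b) + u x * (\<integral>z. (Du (x - z) \<bullet> b) * (K z \<bullet> b) \<partial>lborel)" if b: "b \<in> Basis" for b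
  proof -
    have "((\<lambda>s. u (x + s *\<^sub>R b) * (velocity u (x + s *\<^sub>R b) \<bullet> b)) has_real_derivative
       (Du x \<bullet> b) * (velocity u x \<bullet> b) + (\<integral>z. (Du (x - z) \<bullet> b) * (K z \<bullet> b) \<partial>lborel) * u x) (at 0)"
      using DERIV_mult[OF DERIV_line[of x b 0] velocity_directional_derivative[of x b b]] by simp
    moreover have "((\<lambda>s. u (x + s *\<^sub>R b) * (velocity u (x + s *\<^sub>R b) \<bullet> b)) has_real_derivative c b) (at 0)"
      using c(2)[OF b] by simp
    ultimately show ?thesis using DERIV_unique by (fastforce simp: mult.commute)
  qed
  have "d = (\<Sum>b\<in>Basis. (Du x \<bullet> b) * (velocity u x \<bullet> b)) + u x * (\<Sum>b\<in>Basis. \<integral>z. (Du (x - z) \<bullet> b) * (K z \<bullet> b) \<partial>lborel)"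
    unfolding c(1) by (simp add: cb sum.distrib sum_distrib_left)
  also have "(\<Sum>b\<in>Basis. (Du x \<bullet> b) * (velocity u x \<bullet> b)) = Du x \<bullet> velocity u x" by (rule euclidean_inner[symmetric])
  also have "(\<Sum>b\<in>Basis. \<integral>z. (Du (x - z) \<bullet> b) * (K z \<bullet> b) \<partial>lborel) = (\<integral>z. (\<Sum>b\<in>Basis. (Du (x - z) \<bullet> b) * (K z \<bullet> b)) \<partial>lborel)"
    by (rule Bochner_Integration.integral_sum[symmetric]) (rule velocity_derivative_integrable)
  also have "\<dots> = (\<integral>z. K z \<bullet> Du (x - z) \<partial>lborel)"
    by (rule arg_cong[where f="integral\<^sup>L lborel"], rule ext) (metis euclidean_inner inner_commute)
  finally show ?thesis .
qed

text \<open>Lipschitz continuity of \<open>u V\<close> suffices here: no continuity of its derivatives is used.\<close>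

lemma divergence_pairing:
  fixes \<zeta> :: "'a \<Rightarrow> real"
  assumes div: "\<And>x. has_divergence (\<lambda>y. u y *\<^sub>R velocity u y) (d x) x"
    and \<zeta>: "\<And>x. (\<zeta> has_derivative (\<lambda>h. Z x \<bullet> h)) (at x)" "continuous_on UNIV Z"
  shows "(\<integral>x. \<zeta> x * d x \<partial>lborel) = - (\<integral>x. u x * (Z x \<bullet> velocity u x) \<partial>lborel)"
    and "integrable lborel (\<lambda>x. \<zeta> x * d x)"
proof -
  have "\<exists>c. d x = (\<Sum>b\<in>Basis. c b) \<and> (\<forall>b\<in>Basis. ((\<lambda>s. (u (x + s *\<^sub>R b) *\<^sub>R velocity u (x + s *\<^sub>R b)) \<bullet> b) has_real_derivative c b) (at 0))" for x
    using has_divergence_directional[OF div[of x]] by metis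
  then obtain c where c: "\<And>x. d x = (\<Sum>b\<in>Basis. c x b)"
    "\<And>x b. b \<in> Basis \<Longrightarrow> ((\<lambda>s. (u (x + s *\<^sub>R b) *\<^sub>R velocity u (x + s *\<^sub>R b)) \<bullet> b) has_real_derivative c x b) (at 0)"
    by metis
  have \<zeta>c: "continuous_on UNIV \<zeta>"
    by (rule has_derivative_continuous_on[OF has_derivative_at_withinI[OF \<zeta>(1)]])
  interpret P: C1_compact_support "\<lambda>x. \<zeta> x * u x" "\<lambda>x. \<zeta> x *\<^sub>R Du x + u x *\<^sub>R Z x" r
  proof
    show "((\<lambda>x. \<zeta> x * u x) has_derivative (\<lambda>h. (\<zeta> x *\<^sub>R Du x + u x *\<^sub>R Z x) \<bullet> h)) (at x)" for x
      using has_derivative_mult[OF \<zeta>(1) der, of x] by (simp add: inner_add_left algebra_simps)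
    show "continuous_on UNIV (\<lambda>x. \<zeta> x *\<^sub>R Du x + u x *\<^sub>R Z x)" by (intro continuous_intros \<zeta>c \<zeta>(2) cont cont_G)
  qed (simp add: zero)
  obtain A where A: "0 < A" "\<And>x y. \<bar>\<zeta> x * u x - \<zeta> y * u y\<bar> \<le> A * norm (x - y)" using P.lipschitz by blast
  obtain a where a: "0 < a" "\<And>x. \<bar>\<zeta> x * u x\<bar> \<le> a" using P.bounded_\<phi> by blast
  obtain S where S: "0 < S" "\<And>x. \<bar>u x\<bar> \<le> S" using bounded_\<phi> by blast
  obtain C where C: "0 < C" "\<And>x y R. norm x \<le> R \<Longrightarrow> norm y \<le> R \<Longrightarrow> norm (velocity u x - velocity u y) \<le> C * K_mass (R + r) * norm (x - y)"
    by (rule velocity_lipschitz) blast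
  \<comment> \<open>Derivative along \<open>b\<close> of the \<open>b\<close>-component of \<zeta> u
    V. Each one integrates to zero, and their sum contains \<zeta> times the divergence
    \<open>d\<close>.\<close>
  define E where "E b x = (Z x \<bullet> b) * (u x * (velocity u x \<bullet> b)) + \<zeta> x * c x b" for b x
  have main: "(\<integral>x. E b x \<partial>lborel) = 0 \<and> integrable lborel (E b)" if b: "b \<in> Basis" for b
  proof -
    let ?F = "\<lambda>x. (\<zeta> x * u x) * (velocity u x \<bullet> b)"
    have inb: "\<bar>v \<bullet> b\<bar> \<le> norm v" for v using Basis_le_norm[OF b, of v] .
    have lip: "\<bar>?F x - ?F y\<bar> \<le> (A * (S * K_mass (r + r)) + a * (C * K_mass (r + r))) * norm (x - y)" for x y
    proof (rule lipschitz_mult_supported[of "\<lambda>x. \<zeta> x * u x" A a r, OF A(2) a(2)])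
      show "\<bar>velocity u x \<bullet> b - velocity u y \<bullet> b\<bar> \<le> C * K_mass (r + r) * norm (x - y)" if "norm x \<le> r" "norm y \<le> r" for x y
        using inb[of "velocity u x - velocity u y"] C(2)[OF that] by (simp add: inner_diff_left)
      show "\<bar>velocity u x \<bullet> b\<bar> \<le> S * K_mass (r + r)" if "norm x \<le> r" for x
        by (rule order_trans[OF inb velocity_bound[OF cont zero that S(2)]])
    qed (use C S A K_mass_nonneg zero in auto)
    have z: "r \<le> norm x \<Longrightarrow> ?F x = 0" for x by (simp add: zero)
    have d: "((\<lambda>s. ?F (x + s *\<^sub>R b)) has_real_derivative E b x) (at 0)" for x
    proof -
      have "((\<lambda>s. \<zeta> (x + s *\<^sub>R b)) has_derivative (\<lambda>h. Z x \<bullet> (h *\<^sub>R b))) (at 0)"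
        by (rule has_derivative_compose[of "\<lambda>s. x + s *\<^sub>R b" "\<lambda>h. h *\<^sub>R b" 0 UNIV \<zeta> "\<lambda>h. Z x \<bullet> h"])
          (use \<zeta>(1)[of x] in \<open>auto intro!: derivative_eq_intros\<close>)
      then have "((\<lambda>s. \<zeta> (x + s *\<^sub>R b)) has_real_derivative Z x \<bullet> b) (at 0)"
        by (simp add: has_field_derivative_def mult.commute[of _ "Z x \<bullet> b"])
      from DERIV_mult[OF this c(2)[OF b, of x]] show ?thesis
        by (simp add: E_def mult_ac)
    qed
    have Fc: "continuous_on UNIV ?F" by (intro continuous_intros \<zeta>c cont velocity_continuous)
    have "E b \<in> borel_measurable borel" by (rule borel_measurable_directional_derivative[OF Fc d])
    from integral_directional_derivative_eq_0[where F="?F" and e=b and F'="E b", OF lip z AE_I2[OF d] this]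
    show ?thesis by blast
  qed
  have sum: "(\<Sum>b\<in>Basis. E b x) = u x * (Z x \<bullet> velocity u x) + \<zeta> x * d x" for x
  proof -
    have "(\<Sum>b\<in>Basis. E b x) = u x * (\<Sum>b\<in>Basis. (Z x \<bullet> b) * (velocity u x \<bullet> b)) + \<zeta> x * (\<Sum>b\<in>Basis. c x b)"
      by (simp add: E_def sum.distrib sum_distrib_left mult_ac)
    then show ?thesis by (simp add: c(1) euclidean_inner[symmetric])
  qed
  have i1: "integrable lborel (\<lambda>x. u x * (Z x \<bullet> velocity u x))"
    by (rule integrable_continuous_compact_support[of _ r])
      (auto intro!: continuous_intros cont velocity_continuous \<zeta>(2) simp: zero)
  have i2: "integrable lborel (\<lambda>x. u x * (Z x \<bullet> velocity u x) + \<zeta> x * d x)"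
    unfolding sum[symmetric] using main by (intro Bochner_Integration.integrable_sum) auto
  have "integrable lborel (\<lambda>x. (u x * (Z x \<bullet> velocity u x) + \<zeta> x * d x) - u x * (Z x \<bullet> velocity u x))"
    by (rule Bochner_Integration.integrable_diff[OF i2 i1])
  then show i3: "integrable lborel (\<lambda>x. \<zeta> x * d x)" by simp
  have "(\<integral>x. u x * (Z x \<bullet> velocity u x) + \<zeta> x * d x \<partial>lborel) = (\<Sum>b\<in>Basis. \<integral>x. E b x \<partial>lborel)"
    unfolding sum[symmetric] using main by (intro Bochner_Integration.integral_sum) auto
  then show "(\<integral>x. \<zeta> x * d x \<partial>lborel) = - (\<integral>x. u x * (Z x \<bullet> velocity u x) \<partial>lborel)"
    using i1 i3 main by simp
qed

text \<open>The pointwise value of \<open>div V\<close> is \<open>- u\<close> plus a contribution of \<open>\<Delta>W\<^sub>a\<close> absorbed by half the maximum.\<close>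

lemma divergence_velocity_upper_bound:
  assumes C0: "\<And>\<phi> G r S. C1_compact_support \<phi> G r \<Longrightarrow> (\<And>x. 0 \<le> \<phi> x) \<Longrightarrow> (\<And>x. \<phi> x \<le> S) \<Longrightarrow>
      - (\<integral>z. K z \<bullet> G z \<partial>lborel) \<le> - \<phi> 0 + S / 2 + C0 * (\<integral>x. \<phi> x \<partial>lborel)"
    and pos: "\<And>x. 0 \<le> u x" and S: "\<And>x. u x \<le> S"
  shows "(\<integral>z. K z \<bullet> Du (x - z) \<partial>lborel) \<le> - u x + S / 2 + C0 * (\<integral>x. u x \<partial>lborel)"
proof -
  have "C1_compact_support (\<lambda>z. u (x - z)) (\<lambda>z. - Du (x - z)) (norm x + r)"
  proof
    show "((\<lambda>z. u (x - z)) has_derivative (\<lambda>h. - Du (x - z) \<bullet> h)) (at z)" for z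
      using has_derivative_compose[OF has_derivative_diff[OF has_derivative_const has_derivative_ident] der, of x z UNIV] by simp
    show "continuous_on UNIV (\<lambda>z. - Du (x - z))" by (intro continuous_intros continuous_on_compose2[OF cont_G]) auto
    show "u (x - z) = 0" if "norm x + r \<le> norm z" for z
      using that norm_triangle_sub[of z x] norm_minus_commute[of z x] by (intro zero) linarith
  qed
  from C0[OF this, of S] pos S
  show ?thesis using integral_reflect[of u x] by simp
qed

text \<open>A crude two-sided bound that grows with the gradient of the density. It is used on a
  fixed time interval, where any finite bound preserves the sign.\<close>

lemma divergence_velocity_bound:
  assumes B: "\<And>x. norm (Du x) \<le> B" and x: "norm x \<le> R" and r: "\<And>x. r \<le> norm x \<Longrightarrow> Du x = 0"
  shows "\<bar>\<integral>z. K z \<bullet> Du (x - z) \<partial>lborel\<bar> \<le> B * K_mass (R + r)"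
proof -
  have B0: "0 \<le> B" using B[of 0] norm_ge_zero order_trans by blast
  have i: "integrable lborel (\<lambda>z. B * (indicator (cball 0 (R + r)) z * norm (K z)))"
    by (intro integrable_mult_right K_norm_locally_integrable)
  have le: "norm (K z \<bullet> Du (x - z)) \<le> B * (indicator (cball 0 (R + r)) z * norm (K z))" for z
  proof (cases "norm z \<le> R + r")
    case True
    have "norm (K z \<bullet> Du (x - z)) \<le> norm (K z) * B"
      unfolding real_norm_def by (intro order_trans[OF Cauchy_Schwarz_ineq2] mult_left_mono B) auto
    then show ?thesis using True by (simp add: mult.commute)
  next
    case False
    then have "r \<le> norm (x - z)" using x norm_triangle_sub[of z x] norm_minus_commute[of z x] by linarith
    then show ?thesis using r B0 by simp
  qed
  have I: "integrable lborel (\<lambda>z. K z \<bullet> Du (x - z))"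
    by (rule Bochner_Integration.integrable_bound[OF i]) (measurable, use le B0 in \<open>auto simp: abs_mult\<close>)
  have "norm (\<integral>z. K z \<bullet> Du (x - z) \<partial>lborel) \<le> (\<integral>z. norm (K z \<bullet> Du (x - z)) \<partial>lborel)" by (rule integral_norm_bound)
  also have "\<dots> \<le> (\<integral>z. B * (indicator (cball 0 (R + r)) z * norm (K z)) \<partial>lborel)"
    by (rule integral_mono[OF integrable_norm[OF I] i le])
  finally show ?thesis by (simp add: K_mass_def)
qed

end

end

section \<open>Evolution: conservation laws and maximum principles\<close>

text \<open>Look at a maximum point of \<open>f\<close> on the interval: if the value there exceeded
  \<open>m\<close>, the negative derivative would produce a larger value just before.\<close>

lemma le_barrier:
  fixes f :: "real \<Rightarrow> real"
  assumes cont: "continuous_on {0..T} f" and init: "f 0 \<le> m"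
    and dec: "\<And>t. 0 < t \<Longrightarrow> t \<le> T \<Longrightarrow> m < f t \<Longrightarrow> \<exists>d<0. (f has_real_derivative d) (at t)"
    and t: "t \<in> {0..T}"
  shows "f t \<le> m"
proof (rule ccontr)
  assume "\<not> f t \<le> m"
  obtain s where s: "s \<in> {0..T}" "\<And>r. r \<in> {0..T} \<Longrightarrow> f r \<le> f s"
    using continuous_attains_sup[OF compact_Icc _ cont] t by auto
  have fs: "m < f s" using s(2)[OF t] \<open>\<not> f t \<le> m\<close> by simp
  then have s0: "0 < s" using init s(1) by (cases "s = 0") auto
  then obtain d where "d < 0" "(f has_real_derivative d) (at s)" using dec fs s(1) by auto
  then obtain e where e: "0 < e" "\<And>h. 0 < h \<Longrightarrow> h < e \<Longrightarrow> f s < f (s - h)"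
    using DERIV_neg_dec_left by blast
  let ?h = "min e s / 2"
  have "f s < f (s - ?h)" using e(2)[of ?h] e(1) s0 by auto
  moreover have "s - ?h \<in> {0..T}" using s0 s(1) e(1) by (auto simp: min_def field_simps)
  ultimately show False using s(2)[of "s - ?h"] by simp
qed

lemma continuous_nonneg_integral_zero:
  fixes f :: "'a::euclidean_space \<Rightarrow> real"
  assumes f: "continuous_on UNIV f" "\<And>x. 0 \<le> f x" "integrable lborel f" and "(\<integral>x. f x \<partial>lborel) \<le> 0"
  shows "f x = 0"
proof (rule ccontr)
  assume x: "f x \<noteq> 0"
  have "0 \<le> (\<integral>x. f x \<partial>lborel)" by (rule Bochner_Integration.integral_nonneg) (use f in auto)
  then have "(\<integral>x. f x \<partial>lborel) = 0" using assms(4) by simp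
  then have "AE x in lborel. f x = 0" using integral_nonneg_eq_0_iff_AE[OF f(3)] f(2) by simp
  then have "AE x in lborel. x \<notin> {x. f x \<noteq> 0}" by simp
  moreover have "open {x. f x \<noteq> 0}"
    using open_Collect_neq[OF f(1) continuous_on_const[of UNIV 0]] by simp
  ultimately have "{x. f x \<noteq> 0} = {}" by (rule open_AE_empty[rotated])
  then show False using x by blast
qed

context confining_kernel
begin

text \<open>Chosen once for the kernel, so that all later constants are terms in the kernel,
  \<open>R0\<close> and \<open>L\<close>, and cannot depend on the solution.\<close>

definition div_const :: real where
  "div_const = (SOME C0. 0 \<le> C0 \<and> (\<forall>\<phi> G r S. C1_compact_support \<phi> G r \<longrightarrow> (\<forall>x. 0 \<le> \<phi> x) \<longrightarrow> (\<forall>x. \<phi> x \<le> S) \<longrightarrow>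
      - (\<integral>z. K z \<bullet> G z \<partial>lborel) \<le> - \<phi> 0 + S / 2 + C0 * (\<integral>x. \<phi> x \<partial>lborel)))"

lemma div_const:
  shows "0 \<le> div_const"
    "C1_compact_support \<phi> G r \<Longrightarrow> (\<And>x. 0 \<le> \<phi> x) \<Longrightarrow> (\<And>x. \<phi> x \<le> S) \<Longrightarrow>
      - (\<integral>z. K z \<bullet> G z \<partial>lborel) \<le> - \<phi> 0 + S / 2 + div_const * (\<integral>x. \<phi> x \<partial>lborel)"
proof -
  obtain C0 where "0 \<le> C0" "\<And>\<phi> G r S. C1_compact_support \<phi> G r \<Longrightarrow> (\<And>x. 0 \<le> \<phi> x) \<Longrightarrow> (\<And>x. \<phi> x \<le> S) \<Longrightarrow>
      - (\<integral>z. K z \<bullet> G z \<partial>lborel) \<le> - \<phi> 0 + S / 2 + C0 * (\<integral>x. \<phi> x \<partial>lborel)"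
    by (rule divergence_bound) blast
  then have "\<exists>C0. 0 \<le> C0 \<and> (\<forall>\<phi> G r S. C1_compact_support \<phi> G r \<longrightarrow> (\<forall>x. 0 \<le> \<phi> x) \<longrightarrow> (\<forall>x. \<phi> x \<le> S) \<longrightarrow>
      - (\<integral>z. K z \<bullet> G z \<partial>lborel) \<le> - \<phi> 0 + S / 2 + C0 * (\<integral>x. \<phi> x \<partial>lborel))" by blast
  from someI_ex[OF this, folded div_const_def]
  show "0 \<le> div_const"
    "C1_compact_support \<phi> G r \<Longrightarrow> (\<And>x. 0 \<le> \<phi> x) \<Longrightarrow> (\<And>x. \<phi> x \<le> S) \<Longrightarrow>
      - (\<integral>z. K z \<bullet> G z \<partial>lborel) \<le> - \<phi> 0 + S / 2 + div_const * (\<integral>x. \<phi> x \<partial>lborel)" by blast+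
qed

text \<open>At a maximum m of a density of mass 1, div V is at most - m/2 +
  \<open>div_const\<close>, which is negative once m exceeds \<open>2 * div_const\<close>.\<close>

definition sup_bound :: "real \<Rightarrow> real" where
  "sup_bound L = max L (2 * div_const)"

text \<open>The kernel is odd, so the double integrand is antisymmetric in the two particles and
  Fubini makes its integral its own negative. This conserves the centre of mass.\<close>

lemma momentum_zero:
  assumes u: "C1_compact_support u Du r"
  shows "(\<integral>x. u x * (v \<bullet> velocity u x) \<partial>lborel) = 0"
proof -
  interpret C1_compact_support u Du r by (rule u)
  obtain S where S: "0 < S" "\<And>x. \<bar>u x\<bar> \<le> S" using bounded_\<phi> by blast
  define F where "F x y = u x * u y * (v \<bullet> K (x - y))" for x y
  have m: "(\<lambda>(x, y). F x y) \<in> borel_measurable (borel \<Otimes>\<^sub>M borel)" unfolding F_def by measurable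
  have b: "\<bar>F x y\<bar> \<le> (S * S * norm v) * (indicator (cball 0 r) x * indicator (cball 0 r) y * norm (K (x - y)))" for x y
  proof (cases "norm x \<le> r \<and> norm y \<le> r")
    case True
    have "\<bar>F x y\<bar> \<le> (S * S) * (norm v * norm (K (x - y)))"
      unfolding F_def abs_mult by (intro mult_mono S Cauchy_Schwarz_ineq2) (use S in auto)
    then show ?thesis using True by (simp add: mult.assoc)
  next
    case False
    then have "F x y = 0" using zero[of x] zero[of y] by (auto simp: F_def)
    then show ?thesis using S by simp
  qed
  have I: "integrable (lborel \<Otimes>\<^sub>M lborel) (\<lambda>(x, y). F x y)"
    by (rule integrable_difference_kernel(1)[OF m _ _ K_norm_locally_integrable b]) auto
  have "(\<integral>x. (\<integral>y. F x y \<partial>lborel) \<partial>lborel) = (\<integral>y. (\<integral>x. F x y \<partial>lborel) \<partial>lborel)"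
    using lborel_pair.Fubini_integral[OF I] by simp
  also have "\<dots> = - (\<integral>x. (\<integral>y. F x y \<partial>lborel) \<partial>lborel)"
  proof -
    have s: "F x y = - F y x" for x y
      using K_minus[of "x - y"] by (simp add: F_def)
    have "(\<integral>y. (\<integral>x. F x y \<partial>lborel) \<partial>lborel) = (\<integral>y. (\<integral>x. - F y x \<partial>lborel) \<partial>lborel)"
      by (intro Bochner_Integration.integral_cong refl s)
    then show ?thesis by simp
  qed
  finally have "(\<integral>x. (\<integral>y. F x y \<partial>lborel) \<partial>lborel) = 0" by simp
  moreover have "(\<integral>y. F x y \<partial>lborel) = u x * (v \<bullet> velocity u x)" for x
  proof -
    have "integrable lborel (\<lambda>y. u y *\<^sub>R K (x - y))"
      by (rule velocity_eq(2)[OF cont velocity_integrable[OF cont zero order_refl]])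
    then have "v \<bullet> velocity u x = (\<integral>y. u y * (v \<bullet> K (x - y)) \<partial>lborel)"
      by (simp add: velocity_eq(1)[OF cont] flip: integral_inner_right)
    then show ?thesis by (simp add: F_def mult.assoc)
  qed
  ultimately show ?thesis by simp
qed

end

text \<open>The facts about a solution on which the estimates rest, with one gradient
  \<open>D\<rho>\<close> for all times and with the convolution written as
  \<open>velocity\<close>.\<close>

locale transport = confining_kernel \<kappa> g for \<kappa> and g :: "'a::euclidean_space \<Rightarrow> real" +
  fixes \<rho> :: "real \<Rightarrow> 'a \<Rightarrow> real" and D\<rho> :: "real \<Rightarrow> 'a \<Rightarrow> 'a" and R0 L :: real
  assumes compact_supp: "\<And>T. 0 < T \<Longrightarrow> \<exists>r>0. \<forall>t\<in>{0..T}. \<forall>x. r \<le> norm x \<longrightarrow> \<rho> t x = 0"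
    and space_deriv: "\<And>t x. 0 \<le> t \<Longrightarrow> (\<rho> t has_derivative (\<lambda>h. D\<rho> t x \<bullet> h)) (at x)"
    and joint_cont: "\<And>T. 0 < T \<Longrightarrow> continuous_on ({0..T} \<times> UNIV) (\<lambda>(t, x). \<rho> t x)"
    and joint_cont_D: "\<And>T. 0 < T \<Longrightarrow> continuous_on ({0..T} \<times> UNIV) (\<lambda>(t, x). D\<rho> t x)"
    and time_lipschitz: "\<And>T. 0 < T \<Longrightarrow> \<exists>\<Lambda>>0. \<forall>s\<in>{0..T}. \<forall>t\<in>{0..T}. \<forall>x. \<bar>\<rho> s x - \<rho> t x\<bar> \<le> \<Lambda> * \<bar>s - t\<bar>"
    and pde: "\<And>t x. 0 < t \<Longrightarrow> \<exists>d. ((\<lambda>s. \<rho> s x) has_real_derivative d) (at t) \<and>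
        has_divergence (\<lambda>y. \<rho> t y *\<^sub>R velocity (\<rho> t) y) d x"
    and init_nonneg: "\<And>x. 0 \<le> \<rho> 0 x" and init_le: "\<And>x. \<rho> 0 x \<le> L"
    and init_mass: "(\<integral>x. \<rho> 0 x \<partial>lborel) = 1" and init_center: "(\<integral>x. \<rho> 0 x *\<^sub>R x \<partial>lborel) = 0"
    and init_supp: "\<And>x. R0 \<le> norm x \<Longrightarrow> \<rho> 0 x = 0"
begin

lemma C1_slice:
  assumes "0 < T" "\<And>t x. t \<in> {0..T} \<Longrightarrow> r \<le> norm x \<Longrightarrow> \<rho> t x = 0" "t \<in> {0..T}"
  shows "C1_compact_support (\<rho> t) (D\<rho> t) r"
proof
  show "(\<rho> t has_derivative (\<lambda>h. D\<rho> t x \<bullet> h)) (at x)" for x using assms space_deriv by simp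
  have "continuous_on UNIV (\<lambda>x. (\<lambda>(t, x). D\<rho> t x) (t, x))"
    by (rule continuous_on_compose2[OF joint_cont_D[OF assms(1)]]) (use assms(3) in \<open>auto intro!: continuous_intros\<close>)
  then show "continuous_on UNIV (D\<rho> t)" by simp
qed (use assms in auto)

lemma support_radius:
  assumes "0 < T"
  obtains r where "0 < r" "\<And>t x. t \<in> {0..T} \<Longrightarrow> r \<le> norm x \<Longrightarrow> \<rho> t x = 0"
    "\<And>t. t \<in> {0..T} \<Longrightarrow> C1_compact_support (\<rho> t) (D\<rho> t) r"
proof -
  obtain r where r: "0 < r" "\<And>t x. t \<in> {0..T} \<Longrightarrow> r \<le> norm x \<Longrightarrow> \<rho> t x = 0" using compact_supp[OF assms] by blast
  show thesis by (rule that[OF r C1_slice[OF assms r(2)]])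
qed

definition \<rho>t :: "real \<Rightarrow> 'a \<Rightarrow> real" where "\<rho>t t x = deriv (\<lambda>s. \<rho> s x) t"

lemma
  assumes "0 < t"
  shows \<rho>t_deriv: "((\<lambda>s. \<rho> s x) has_real_derivative \<rho>t t x) (at t)"
    and \<rho>t_div: "has_divergence (\<lambda>y. \<rho> t y *\<^sub>R velocity (\<rho> t) y) (\<rho>t t x) x"
proof -
  obtain d where d: "((\<lambda>s. \<rho> s x) has_real_derivative d) (at t)"
      "has_divergence (\<lambda>y. \<rho> t y *\<^sub>R velocity (\<rho> t) y) d x"
    using pde[OF assms, of x] by (elim exE conjE)
  have "\<rho>t t x = d" unfolding \<rho>t_def by (rule DERIV_imp_deriv[OF d(1)])
  then show "((\<lambda>s. \<rho> s x) has_real_derivative \<rho>t t x) (at t)"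
    "has_divergence (\<lambda>y. \<rho> t y *\<^sub>R velocity (\<rho> t) y) (\<rho>t t x) x" using d by (simp_all only:)
qed

lemma \<rho>t_eq:
  assumes "0 < t"
  shows "\<rho>t t x = D\<rho> t x \<bullet> velocity (\<rho> t) x + \<rho> t x * (\<integral>z. K z \<bullet> D\<rho> t (x - z) \<partial>lborel)"
proof -
  obtain r where "\<And>s. s \<in> {0..t} \<Longrightarrow> C1_compact_support (\<rho> s) (D\<rho> s) r" by (rule support_radius[OF assms]) blast
  then have "C1_compact_support (\<rho> t) (D\<rho> t) r" using assms by simp
  from divergence_flux_eq[OF this \<rho>t_div[OF assms]] show ?thesis .
qed

lemma weight_integrable:
  fixes \<zeta> :: "'a \<Rightarrow> real"
  assumes "continuous_on UNIV \<zeta>"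
  shows "integrable lborel (\<lambda>x. \<bar>\<zeta> x\<bar> * indicator (cball 0 r) x)"
  using borel_integrable_compact[of "cball 0 r" "\<lambda>x. \<bar>\<zeta> x\<bar>"] continuous_on_subset[OF assms, of "cball 0 r"]
  by (auto intro!: continuous_intros simp: mult.commute)

lemma moment_integrable:
  assumes "0 \<le> t" "continuous_on UNIV \<zeta>"
  shows "integrable lborel (\<lambda>x. \<zeta> x * \<rho> t x :: real)"
proof -
  obtain r where r: "0 < r" "\<And>s x. s \<in> {0..t+1} \<Longrightarrow> r \<le> norm x \<Longrightarrow> \<rho> s x = 0"
    "\<And>s. s \<in> {0..t+1} \<Longrightarrow> C1_compact_support (\<rho> s) (D\<rho> s) r" by (rule support_radius[of "t + 1"]) (use assms in \<open>auto\<close>)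
  interpret C1_compact_support "\<rho> t" "D\<rho> t" r using r(3) assms by simp
  show ?thesis
    by (rule integrable_continuous_compact_support[of _ r]) (auto intro!: continuous_intros assms cont simp: zero)
qed

lemma moment_continuous:
  assumes T: "0 < T" and \<zeta>: "continuous_on UNIV \<zeta>"
  shows "continuous_on {0..T} (\<lambda>t. \<integral>x. \<zeta> x * \<rho> t x \<partial>lborel)"
proof -
  obtain r where r: "0 < r" "\<And>s x. s \<in> {0..T} \<Longrightarrow> r \<le> norm x \<Longrightarrow> \<rho> s x = 0"
    by (rule support_radius[OF T]) blast
  obtain \<Lambda> where \<Lambda>: "0 < \<Lambda>" "\<And>s t x. s \<in> {0..T} \<Longrightarrow> t \<in> {0..T} \<Longrightarrow> \<bar>\<rho> s x - \<rho> t x\<bar> \<le> \<Lambda> * \<bar>s - t\<bar>"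
    using time_lipschitz[OF T] by blast
  let ?I = "\<integral>x. \<bar>\<zeta> x\<bar> * indicator (cball 0 r) x \<partial>lborel"
  have "\<bar>(\<integral>x. \<zeta> x * \<rho> s x \<partial>lborel) - (\<integral>x. \<zeta> x * \<rho> t x \<partial>lborel)\<bar> \<le> (\<Lambda> * ?I) * \<bar>s - t\<bar>"
    if st: "s \<in> {0..T}" "t \<in> {0..T}" for s t
  proof -
    have i: "integrable lborel (\<lambda>x. \<zeta> x * \<rho> s x)" "integrable lborel (\<lambda>x. \<zeta> x * \<rho> t x)"
      using st \<zeta> by (auto intro!: moment_integrable)
    have "\<bar>(\<integral>x. \<zeta> x * \<rho> s x \<partial>lborel) - (\<integral>x. \<zeta> x * \<rho> t x \<partial>lborel)\<bar> = \<bar>\<integral>x. \<zeta> x * \<rho> s x - \<zeta> x * \<rho> t x \<partial>lborel\<bar>"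
      using i by simp
    also have "\<dots> \<le> (\<integral>x. \<bar>\<zeta> x * \<rho> s x - \<zeta> x * \<rho> t x\<bar> \<partial>lborel)" by (rule integral_abs_bound)
    also have "\<dots> \<le> (\<integral>x. (\<Lambda> * \<bar>s - t\<bar>) * (\<bar>\<zeta> x\<bar> * indicator (cball 0 r) x) \<partial>lborel)"
    proof (rule integral_mono)
      show "integrable lborel (\<lambda>x. \<bar>\<zeta> x * \<rho> s x - \<zeta> x * \<rho> t x\<bar>)" using i by (intro integrable_abs Bochner_Integration.integrable_diff)
      show "integrable lborel (\<lambda>x. (\<Lambda> * \<bar>s - t\<bar>) * (\<bar>\<zeta> x\<bar> * indicator (cball 0 r) x))"
        by (intro integrable_mult_right weight_integrable \<zeta>)
      show "\<bar>\<zeta> x * \<rho> s x - \<zeta> x * \<rho> t x\<bar> \<le> (\<Lambda> * \<bar>s - t\<bar>) * (\<bar>\<zeta> x\<bar> * indicator (cball 0 r) x)" for x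
      proof (cases "norm x \<le> r")
        case True
        then show ?thesis using mult_left_mono[OF \<Lambda>(2)[OF st, of x], of "\<bar>\<zeta> x\<bar>"]
          by (simp add: abs_mult[symmetric] right_diff_distrib mult_ac)
      qed (use r(2) st in auto)
    qed
    also have "\<dots> = (\<Lambda> * \<bar>s - t\<bar>) * ?I" by (rule integral_mult_right_zero)
    finally show ?thesis by (simp only: mult_ac)
  qed
  moreover have "0 \<le> \<Lambda> * ?I" using \<Lambda>(1) by simp
  ultimately have "(\<Lambda> * ?I)-lipschitz_on {0..T} (\<lambda>t. \<integral>x. \<zeta> x * \<rho> t x \<partial>lborel)"
    by (auto simp: lipschitz_on_def dist_real_def)
  then show ?thesis by (rule lipschitz_on_continuous_on)
qed

text \<open>The Lipschitz bound in time dominates the difference quotients;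
  \<open>divergence_pairing\<close> then moves the derivative onto the weight.\<close>

lemma moment_derivative:
  assumes t: "0 < t" and \<zeta>: "\<And>x. (\<zeta> has_derivative (\<lambda>h. Z x \<bullet> h)) (at x)" "continuous_on UNIV Z"
  shows "((\<lambda>s. \<integral>x. \<zeta> x * \<rho> s x \<partial>lborel) has_real_derivative - (\<integral>x. \<rho> t x * (Z x \<bullet> velocity (\<rho> t) x) \<partial>lborel)) (at t)"
proof -
  have \<zeta>c: "continuous_on UNIV \<zeta>"
    by (rule has_derivative_continuous_on[OF has_derivative_at_withinI[OF \<zeta>(1)]])
  have T: "0 < t + 1" using t by simp
  obtain r where r: "0 < r" "\<And>s x. s \<in> {0..t+1} \<Longrightarrow> r \<le> norm x \<Longrightarrow> \<rho> s x = 0"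
    "\<And>s. s \<in> {0..t+1} \<Longrightarrow> C1_compact_support (\<rho> s) (D\<rho> s) r" by (rule support_radius[OF T]) blast
  obtain \<Lambda> where \<Lambda>: "0 < \<Lambda>" "\<And>s t' x. s \<in> {0..t+1} \<Longrightarrow> t' \<in> {0..t+1} \<Longrightarrow> \<bar>\<rho> s x - \<rho> t' x\<bar> \<le> \<Lambda> * \<bar>s - t'\<bar>"
    using time_lipschitz[OF T] by blast
  have C1: "C1_compact_support (\<rho> t) (D\<rho> t) r" using r(3) t by simp
  note P = divergence_pairing[OF C1 \<rho>t_div[OF t] \<zeta>]
  have "((\<lambda>s. \<integral>x. \<zeta> x * \<rho> s x \<partial>lborel) has_real_derivative (\<integral>x. \<zeta> x * \<rho>t t x \<partial>lborel)) (at t)"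
  proof (rule has_real_derivative_integral(1)[where d="min t 1" and B="\<lambda>x. \<Lambda> * (\<bar>\<zeta> x\<bar> * indicator (cball 0 r) x)"])
    show "0 < min t 1" using t by simp
    show "integrable lborel (\<lambda>x. \<zeta> x * \<rho> s x)" if "\<bar>s - t\<bar> < min t 1" for s
      using that \<zeta>c by (intro moment_integrable) auto
    show "AE x in lborel. ((\<lambda>s. \<zeta> x * \<rho> s x) has_real_derivative \<zeta> x * \<rho>t t x) (at t)"
      using \<rho>t_deriv[OF t] by (auto intro!: DERIV_cmult)
    show "integrable lborel (\<lambda>x. \<Lambda> * (\<bar>\<zeta> x\<bar> * indicator (cball 0 r) x))" by (intro integrable_mult_right weight_integrable \<zeta>c)
    show "(\<lambda>x. \<zeta> x * \<rho>t t x) \<in> borel_measurable lborel" using P(2) by simp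
    show "\<bar>\<zeta> x * \<rho> s x - \<zeta> x * \<rho> t x\<bar> \<le> \<Lambda> * (\<bar>\<zeta> x\<bar> * indicator (cball 0 r) x) * \<bar>s - t\<bar>" if s: "\<bar>s - t\<bar> < min t 1" for s x
    proof (cases "norm x \<le> r")
      case True
      have "\<bar>\<rho> s x - \<rho> t x\<bar> \<le> \<Lambda> * \<bar>s - t\<bar>" using s t by (intro \<Lambda>(2)) auto
      from mult_left_mono[OF this, of "\<bar>\<zeta> x\<bar>"] show ?thesis using True
        by (simp add: abs_mult[symmetric] right_diff_distrib mult_ac)
    next
      case False
      moreover have "s \<in> {0..t+1}" "t \<in> {0..t+1}" using s t by (auto simp: abs_less_iff)
      ultimately have "\<rho> s x = 0" "\<rho> t x = 0" using r(2)[of s x] r(2)[of t x] by auto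
      then show ?thesis using False by simp
    qed
  qed
  then show ?thesis using P(1) by simp
qed

lemma moment_constant:
  assumes t: "0 \<le> t" and \<zeta>: "\<And>x. (\<zeta> has_derivative (\<lambda>h. Z x \<bullet> h)) (at x)" "continuous_on UNIV Z"
    and 0: "\<And>s. 0 < s \<Longrightarrow> (\<integral>x. \<rho> s x * (Z x \<bullet> velocity (\<rho> s) x) \<partial>lborel) = 0"
  shows "(\<integral>x. \<zeta> x * \<rho> t x \<partial>lborel) = (\<integral>x. \<zeta> x * \<rho> 0 x \<partial>lborel)"
proof (cases "t = 0")
  case False
  then have t: "0 < t" using t by simp
  have \<zeta>c: "continuous_on UNIV \<zeta>"
    by (rule has_derivative_continuous_on[OF has_derivative_at_withinI[OF \<zeta>(1)]])
  show ?thesis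
  proof (rule DERIV_isconst2[OF t moment_continuous[OF t \<zeta>c]])
    show "((\<lambda>s. \<integral>x. \<zeta> x * \<rho> s x \<partial>lborel) has_real_derivative 0) (at s)" if "0 < s" "s < t" for s
      using moment_derivative[OF that(1) \<zeta>] 0[OF that(1)] by simp
  qed (use t in auto)
qed simp

lemma mass_conserved: "0 \<le> t \<Longrightarrow> (\<integral>x. \<rho> t x \<partial>lborel) = 1"
  using moment_constant[of t "\<lambda>_. 1" "\<lambda>_. 0"] init_mass by simp

lemma center_conserved:
  assumes t: "0 \<le> t"
  shows "(\<integral>x. \<rho> t x *\<^sub>R x \<partial>lborel) = 0"
proof -
  have i: "integrable lborel (\<lambda>x. \<rho> s x *\<^sub>R x)" if "0 \<le> s" for s
  proof -
    obtain r where r: "0 < r" "\<And>s' x. s' \<in> {0..s+1} \<Longrightarrow> r \<le> norm x \<Longrightarrow> \<rho> s' x = 0"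
      "\<And>s'. s' \<in> {0..s+1} \<Longrightarrow> C1_compact_support (\<rho> s') (D\<rho> s') r" by (rule support_radius[of "s + 1"]) (use \<open>0 \<le> s\<close> in \<open>auto\<close>)
    interpret C1_compact_support "\<rho> s" "D\<rho> s" r using r(3) that by simp
    show ?thesis
      by (rule integrable_continuous_compact_support[of _ r]) (auto intro!: continuous_intros cont simp: zero)
  qed
  have e: "(\<integral>x. \<rho> s x *\<^sub>R x \<partial>lborel) \<bullet> v = (\<integral>x. (x \<bullet> v) * \<rho> s x \<partial>lborel)" if "0 \<le> s" for s v
    using integral_inner_left[of v lborel "\<lambda>x. \<rho> s x *\<^sub>R x"] i[OF that] by (simp add: mult.commute)
  have "(\<integral>x. \<rho> t x *\<^sub>R x \<partial>lborel) \<bullet> v = 0" for v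
  proof -
    have "(\<integral>x. (x \<bullet> v) * \<rho> t x \<partial>lborel) = (\<integral>x. (x \<bullet> v) * \<rho> 0 x \<partial>lborel)"
    proof (rule moment_constant[OF t, where Z="\<lambda>_. v"])
      show "((\<lambda>x. x \<bullet> v) has_derivative (\<bullet>) v) (at x)" for x
        by (auto intro!: derivative_eq_intros simp: inner_commute)
      show "(\<integral>x. \<rho> s x * (v \<bullet> velocity (\<rho> s) x) \<partial>lborel) = 0" if s: "0 < s" for s
      proof -
        obtain r where "\<And>s'. s' \<in> {0..s} \<Longrightarrow> C1_compact_support (\<rho> s') (D\<rho> s') r" by (rule support_radius[OF s]) blast
        then show ?thesis using momentum_zero s by (metis atLeastAtMost_iff less_eq_real_def order_refl)
      qed
    qed auto
    then show ?thesis using e[OF t] e[of 0] init_center by simp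
  qed
  then show ?thesis by (metis inner_eq_zero_iff)
qed

lemma gradient_bound:
  assumes T: "0 < T" and r: "\<And>t. t \<in> {0..T} \<Longrightarrow> C1_compact_support (\<rho> t) (D\<rho> t) r"
  obtains B where "0 < B" "\<And>t x. t \<in> {0..T} \<Longrightarrow> norm (D\<rho> t x) \<le> B"
proof -
  have "compact ((\<lambda>(t, x). D\<rho> t x) ` ({0..T} \<times> cball 0 r))"
    by (intro compact_continuous_image continuous_on_subset[OF joint_cont_D[OF T]] compact_Times) auto
  then obtain B where B: "0 < B" "\<And>y. y \<in> (\<lambda>(t, x). D\<rho> t x) ` ({0..T} \<times> cball 0 r) \<Longrightarrow> norm y \<le> B"
    using compact_imp_bounded bounded_pos by metis
  show thesis
  proof
    show "norm (D\<rho> t x) \<le> B" if t: "t \<in> {0..T}" for t x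
    proof (cases "x \<in> cball 0 r")
      case True
      then show ?thesis using B(2)[of "D\<rho> t x"] t by force
    next
      case False
      interpret C1_compact_support "\<rho> t" "D\<rho> t" r using r t by simp
      show ?thesis using G_zero[of x] False B(1) by simp
    qed
  qed (fact B(1))
qed

lemma gradient_zero_at_extremum:
  assumes "0 \<le> t" "(\<forall>y. \<rho> t y \<le> \<rho> t x) \<or> (\<forall>y. \<rho> t x \<le> \<rho> t y)"
  shows "D\<rho> t x = 0"
proof -
  have "(\<lambda>h. D\<rho> t x \<bullet> h) = (\<lambda>h. 0)"
    using differential_zero_maxmin[of x UNIV "\<rho> t", OF _ _ space_deriv[OF assms(1)]] assms(2) by simp
  then show ?thesis by (metis inner_eq_zero_iff)
qed

text \<open>At a negative minimum of exp(- \<mu> t) \<rho> over time and space the gradient vanishes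
  and \<rho>_t = \<rho> Q with Q < \<mu>. The time derivative of the weighted density is then
  positive, so it was smaller just before.\<close>

lemma nonneg:
  assumes t1: "0 \<le> t1"
  shows "0 \<le> \<rho> t1 x1"
proof (rule ccontr)
  assume neg: "\<not> 0 \<le> \<rho> t1 x1"
  \<comment> \<open>One extra unit keeps the horizon positive when \<open>t1 = 0\<close>.\<close>
  define T where "T = t1 + 1"
  have T: "0 < T" "t1 \<in> {0..T}" using t1 by (auto simp: T_def)
  obtain r where r: "0 < r" "\<And>s x. s \<in> {0..T} \<Longrightarrow> r \<le> norm x \<Longrightarrow> \<rho> s x = 0"
    "\<And>s. s \<in> {0..T} \<Longrightarrow> C1_compact_support (\<rho> s) (D\<rho> s) r" by (rule support_radius[OF T(1)]) blast
  obtain B where B: "0 < B" "\<And>t x. t \<in> {0..T} \<Longrightarrow> norm (D\<rho> t x) \<le> B"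
  proof (rule gradient_bound[OF T(1) r(3)])
    fix B assume "0 < B" "\<And>t x. t \<in> {0..T} \<Longrightarrow> norm (D\<rho> t x) \<le> B"
    then show thesis by (rule that)
  qed
  \<comment> \<open>The radius \<open>r + 1\<close> appears because \<open>G_zero\<close> makes the
    gradient vanish strictly outside \<open>r\<close>, whereas the bound on \<open>Q\<close> wants
    it zero from its radius on. The final 1 makes \<open>Q - \<mu>\<close> negative.\<close>
  define \<mu> where "\<mu> = B * K_mass (r + (r + 1)) + 1"
  define q where "q = (\<lambda>(t, x). exp (- \<mu> * t) * \<rho> t x)"
  have "continuous_on ({0..T} \<times> cball 0 r) q"
  proof -
    have "continuous_on ({0..T} \<times> cball 0 r) (\<lambda>p. exp (- \<mu> * fst p) * (\<lambda>(t, x). \<rho> t x) p)"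
      by (intro continuous_intros continuous_on_subset[OF joint_cont[OF T(1)]]) auto
    then show ?thesis by (simp add: q_def split_beta)
  qed
  moreover have x1: "x1 \<in> cball 0 r" using r(2)[OF T(2), of x1] neg by force
  ultimately obtain p where p: "p \<in> {0..T} \<times> cball 0 r" "\<And>p'. p' \<in> {0..T} \<times> cball 0 r \<Longrightarrow> q p \<le> q p'"
    using continuous_attains_inf[of "{0..T} \<times> cball 0 r" q] T(2) compact_Times[OF compact_Icc compact_cball, of 0 T 0 r] by blast
  obtain t0 x0 where tx: "p = (t0, x0)" by force
  have t0: "t0 \<in> {0..T}" and x0: "norm x0 \<le> r" using p(1) tx by auto
  have "q (t0, x0) \<le> q (t1, x1)" using p(2)[of "(t1, x1)"] T(2) x1 tx by simp
  also have "\<dots> < 0" using neg by (simp add: q_def mult_pos_neg)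
  finally have q0: "q (t0, x0) < 0" .
  then have \<rho>0: "\<rho> t0 x0 < 0" by (simp add: q_def mult_less_0_iff)
  have t0p: "0 < t0" using t0 init_nonneg[of x0] \<rho>0 by (cases "t0 = 0") auto
  have min: "\<rho> t0 x0 \<le> \<rho> t0 y" for y
  proof (cases "y \<in> cball 0 r")
    case True
    then have "q (t0, x0) \<le> q (t0, y)" using p(2)[of "(t0, y)"] t0 tx by simp
    then show ?thesis by (simp add: q_def)
  next
    case False
    then show ?thesis using r(2)[OF t0, of y] \<rho>0 by simp
  qed
  have D0: "D\<rho> t0 x0 = 0" using gradient_zero_at_extremum t0 min by auto
  define Q where "Q = (\<integral>z. K z \<bullet> D\<rho> t0 (x0 - z) \<partial>lborel)"
  interpret S: C1_compact_support "\<rho> t0" "D\<rho> t0" r using r(3) t0 by simp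
  have "\<bar>Q\<bar> \<le> B * K_mass (r + (r + 1))" unfolding Q_def
    by (rule divergence_velocity_bound[OF C1_slice[OF T(1) _ t0] B(2)[OF t0] x0]) (use S.G_zero r(2) in auto)
  then have Q: "Q - \<mu> < 0" by (simp add: \<mu>_def)
  have e: "\<rho>t t0 x0 = \<rho> t0 x0 * Q" using \<rho>t_eq[OF t0p] D0 by (simp add: Q_def)
  have "((\<lambda>s. exp (- \<mu> * s) * \<rho> s x0) has_real_derivative (exp (- \<mu> * t0) * - \<mu>) * \<rho> t0 x0 + \<rho>t t0 x0 * exp (- \<mu> * t0)) (at t0)"
    by (rule DERIV_mult[OF _ \<rho>t_deriv[OF t0p]]) (auto intro!: derivative_eq_intros)
  moreover have "(exp (- \<mu> * t0) * - \<mu>) * \<rho> t0 x0 + \<rho>t t0 x0 * exp (- \<mu> * t0) = exp (- \<mu> * t0) * (\<rho> t0 x0 * (Q - \<mu>))"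
    by (simp add: e algebra_simps)
  moreover have "0 < exp (- \<mu> * t0) * (\<rho> t0 x0 * (Q - \<mu>))" using \<rho>0 Q by (simp add: mult_neg_neg)
  ultimately have "\<exists>d>0. \<forall>h>0. h < d \<longrightarrow> exp (- \<mu> * (t0 - h)) * \<rho> (t0 - h) x0 < exp (- \<mu> * t0) * \<rho> t0 x0"
    by (intro DERIV_pos_inc_left[where f="\<lambda>s. exp (- \<mu> * s) * \<rho> s x0"]) (simp_all only:)
  then obtain d where d: "0 < d" "\<And>h. 0 < h \<Longrightarrow> h < d \<Longrightarrow> q (t0 - h, x0) < q (t0, x0)"
    by (auto simp: q_def)
  let ?h = "min d t0 / 2"
  have "q (t0 - ?h, x0) < q (t0, x0)" using d(2)[of ?h] d(1) t0p by auto
  moreover have "(t0 - ?h, x0) \<in> {0..T} \<times> cball 0 r" using t0p t0 x0 d(1) by (auto simp: min_def field_simps)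
  ultimately show False using p(2)[of "(t0 - ?h, x0)"] tx by simp
qed

text \<open>At a space-time maximum m above the bound the gradient vanishes, so \<rho>_t = m Q with
  Q <= - m/2 + \<open>div_const\<close> < 0, and the density was larger just before. Nonnegativity
  and unit mass enter through \<open>div_const\<close>.\<close>

lemma sup_le:
  assumes t1: "0 \<le> t1"
  shows "\<rho> t1 x1 \<le> sup_bound L"
proof (rule ccontr)
  assume big: "\<not> \<rho> t1 x1 \<le> sup_bound L"
  have M0: "0 \<le> sup_bound L" using div_const(1) by (simp add: sup_bound_def)
  define T where "T = t1 + 1"
  have T: "0 < T" "t1 \<in> {0..T}" using t1 by (auto simp: T_def)
  obtain r where r: "0 < r" "\<And>s x. s \<in> {0..T} \<Longrightarrow> r \<le> norm x \<Longrightarrow> \<rho> s x = 0"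
    "\<And>s. s \<in> {0..T} \<Longrightarrow> C1_compact_support (\<rho> s) (D\<rho> s) r" by (rule support_radius[OF T(1)]) blast
  define q where "q = (\<lambda>(t, x). \<rho> t x)"
  have "continuous_on ({0..T} \<times> cball 0 r) q"
    unfolding q_def by (rule continuous_on_subset[OF joint_cont[OF T(1)]]) auto
  moreover have x1: "x1 \<in> cball 0 r" using r(2)[OF T(2), of x1] big M0 by force
  ultimately obtain p where p: "p \<in> {0..T} \<times> cball 0 r" "\<And>p'. p' \<in> {0..T} \<times> cball 0 r \<Longrightarrow> q p' \<le> q p"
    using continuous_attains_sup[of "{0..T} \<times> cball 0 r" q] T(2) compact_Times[OF compact_Icc compact_cball, of 0 T 0 r] by blast
  obtain t0 x0 where tx: "p = (t0, x0)" by force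
  have t0: "t0 \<in> {0..T}" and x0: "norm x0 \<le> r" using p(1) tx by auto
  define m where "m = \<rho> t0 x0"
  have m: "sup_bound L < m"
    using p(2)[of "(t1, x1)"] T(2) x1 tx big by (simp add: q_def m_def)
  then have t0p: "0 < t0" using t0 init_le[of x0] by (cases "t0 = 0") (auto simp: m_def sup_bound_def)
  have max: "\<rho> t0 y \<le> m" for y
  proof (cases "y \<in> cball 0 r")
    case True
    then show ?thesis using p(2)[of "(t0, y)"] t0 tx by (simp add: q_def m_def)
  next
    case False
    then show ?thesis using r(2)[OF t0, of y] m M0 by simp
  qed
  have D0: "D\<rho> t0 x0 = 0" using gradient_zero_at_extremum t0 max by (auto simp: m_def)
  define Q where "Q = (\<integral>z. K z \<bullet> D\<rho> t0 (x0 - z) \<partial>lborel)"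
  have "Q \<le> - \<rho> t0 x0 + m / 2 + div_const * (\<integral>x. \<rho> t0 x \<partial>lborel)"
    unfolding Q_def by (rule divergence_velocity_upper_bound[OF r(3)[OF t0] div_const(2) nonneg max]) (use t0p in auto)
  also have "(\<integral>x. \<rho> t0 x \<partial>lborel) = 1" using mass_conserved t0p by simp
  finally have "Q < 0" using m by (simp add: m_def sup_bound_def)
  moreover have "\<rho>t t0 x0 = m * Q" using \<rho>t_eq[OF t0p] D0 by (simp add: Q_def m_def)
  ultimately have "\<rho>t t0 x0 < 0" using m M0 by (simp add: mult_pos_neg)
  then obtain d where d: "0 < d" "\<And>h. 0 < h \<Longrightarrow> h < d \<Longrightarrow> \<rho> t0 x0 < \<rho> (t0 - h) x0"
    using DERIV_neg_dec_left[OF \<rho>t_deriv[OF t0p]] by blast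
  let ?h = "min d t0 / 2"
  have "\<rho> t0 x0 < \<rho> (t0 - ?h) x0" using d(2)[of ?h] d(1) t0p by auto
  moreover have "(t0 - ?h, x0) \<in> {0..T} \<times> cball 0 r" using t0p t0 x0 d(1) by (auto simp: min_def field_simps)
  ultimately show False using p(2)[of "(t0 - ?h, x0)"] tx by (simp add: q_def)
qed

lemma slice_density:
  assumes t: "0 \<le> t" and R: "0 < R" "\<And>x. R \<le> norm x \<Longrightarrow> \<rho> t x = 0"
  shows "density \<kappa> g (\<rho> t) R (sup_bound L)"
proof
  show "continuous_on UNIV (\<rho> t)"
    by (rule has_derivative_continuous_on[OF has_derivative_at_withinI[OF space_deriv[OF t]]])
qed (use assms nonneg sup_le mass_conserved center_conserved in auto)

end

section \<open>Confinement of the support\<close>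

text \<open>\<open>e\<close> is the distance at which the repulsion is split when |x| = X: with
  nearby mass O(1/X), the near part of order \<open>e\<close> and the intermediate part of order
  e^(1-n) / X agree, by the last identity.\<close>

lemma powr_minus_inverse:
  assumes "1 \<le> X" "0 < (n::nat)"
  defines "e \<equiv> X powr (- 1 / real n)"
  shows "0 < e" "e \<le> 1" "e ^ n = 1 / X" "e / 2 \<le> (2 * X) powr (- 1 / real n)" "inverse (e ^ (n - 1)) = X * e"
proof -
  show e0: "0 < e" using assms by simp
  have "X powr (- 1 / real n) \<le> X powr 0" using assms by (intro powr_mono) auto
  then show e1: "e \<le> 1" using assms by simp
  have "e ^ n = X powr (- 1 / real n * real n)" unfolding e_def using assms by (subst powr_powr[symmetric]) (simp add: powr_realpow)
  also have "\<dots> = 1 / X" using assms by (simp add: powr_minus_divide)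
  finally show en: "e ^ n = 1 / X" .
  have "(2::real) powr (- 1) \<le> 2 powr (- 1 / real n)" using assms by (intro powr_mono) (auto simp: field_simps)
  then have "1 / 2 \<le> (2::real) powr (- 1 / real n)" by (simp add: powr_minus_divide)
  then have "1 / 2 * e \<le> 2 powr (- 1 / real n) * e" using e0 by (intro mult_right_mono) auto
  then show "e / 2 \<le> (2 * X) powr (- 1 / real n)" using assms by (simp add: powr_mult)
  have "e * e ^ (n - 1) = 1 / X" using en assms(2) by (cases n) auto
  then have "e ^ (n - 1) = inverse (X * e)" using e0 assms(1) by (simp add: field_simps)
  then show "inverse (e ^ (n - 1)) = X * e" by simp
qed

context confining_kernel
begin

text \<open>The constant \<open>C1\<close> of \<open>fourth_moment_virial\<close> with the uniform
  density bound in place of \<open>M\<close>.\<close>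

definition virial_const :: "real \<Rightarrow> real" where
  "virial_const L = 3 / 2 / sphere_area TYPE('a) * (sup_bound L * sphere_area TYPE('a) + 1)"

text \<open>By the virial estimate the fourth moment decreases once it exceeds \<open>216 C\<^sup>3 R / k\<^sup>3\<close> with \<open>C = virial_const L\<close>,
  and \<open>1 / k\<^sup>3 \<le> 4 R\<^sup>2\<close>; hence the factor \<open>864\<close>.\<close>

definition moment_const :: "real \<Rightarrow> real \<Rightarrow> real" where
  "moment_const R0 L = 864 * virial_const L ^ 3 + R0 ^ 4"

text \<open>Three repulsive contributions in units of \<delta> = |x|^(-1/N): mass within \<delta>,
  mass between \<delta> and |x|/2 (through the fourth moment), and mass beyond |x|/2.\<close>

definition drift_const :: "real \<Rightarrow> real \<Rightarrow> real" where
  "drift_const R0 L = sup_bound L + 16 * moment_const R0 L / sphere_area TYPE('a) + 2 / sphere_area TYPE('a)"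

text \<open>Passing from |x| to 2 |x| in the power costs at most a factor 2, and (|x| - r0) / 2 >=
  |x| / 4 a factor 4, hence the 8; the second 8 leaves a surplus of |x|^(1 - 1/N) over the
  repulsion.\<close>

definition attraction :: "real \<Rightarrow> real \<Rightarrow> real" where
  "attraction R0 L = 8 * drift_const R0 L + 8"

lemma sup_bound_nonneg: "0 \<le> sup_bound L"
  using div_const(1) by (simp add: sup_bound_def)

lemma virial_const_pos: "0 < virial_const L"
  unfolding virial_const_def using sphere_area_kernel_pos sup_bound_nonneg[of L]
  by (intro mult_pos_pos divide_pos_pos add_nonneg_pos mult_nonneg_nonneg) auto

lemma moment_const_nonneg: "0 \<le> moment_const R0 L"
  unfolding moment_const_def using virial_const_pos[of L] by simp

lemma drift_const_nonneg: "0 \<le> drift_const R0 L"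
  unfolding drift_const_def using sphere_area_kernel_pos sup_bound_nonneg[of L] moment_const_nonneg[of R0 L] by simp

lemma attraction_ge_1: "1 \<le> attraction R0 L"
  unfolding attraction_def using drift_const_nonneg[of R0 L] by simp

end

text \<open>\<open>strong\<close> is the growth condition beyond \<open>r0\<close>.
  \<open>R_ge\<close> gives |x| - r0 >= |x| / 2 for |x| >= R, and \<open>small\<close> lets
  \<open>virial_const\<close> absorb the term k r0 of the virial estimate.\<close>

locale confined_transport = transport \<kappa> g \<rho> D\<rho> R0 L for \<kappa> and g :: "'a::euclidean_space \<Rightarrow> real" and \<rho> D\<rho> R0 L +
  fixes r0 R :: real
  assumes r0: "0 \<le> r0"
    and strong: "\<And>r. r0 \<le> r \<Longrightarrow> 0 < r \<Longrightarrow> attraction R0 L * r powr (- 1 / real DIM('a)) \<le> \<kappa> r"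
    and R_ge: "2 \<le> R" "R0 \<le> R" "2 * r0 \<le> R"
    and small: "attraction R0 L * (2 * R) powr (- 1 / real DIM('a)) * r0 \<le> virial_const L"
begin

lemma attraction_lower_bound:
  assumes "r0 \<le> r" "0 < r" "r \<le> X"
  shows "attraction R0 L * X powr (- 1 / real DIM('a)) \<le> \<kappa> r"
proof -
  have "X powr (- 1 / real DIM('a)) \<le> r powr (- 1 / real DIM('a))"
    using assms by (intro powr_mono2') auto
  then have "attraction R0 L * X powr (- 1 / real DIM('a)) \<le> attraction R0 L * r powr (- 1 / real DIM('a))"
    using attraction_ge_1[of R0 L] by (intro mult_left_mono) auto
  also have "\<dots> \<le> \<kappa> r" by (rule strong[OF assms(1,2)])
  finally show ?thesis .
qed

lemma virial_positive:
  assumes t: "0 \<le> t" and supp: "\<And>x. R \<le> norm x \<Longrightarrow> \<rho> t x = 0"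
    and large: "moment_const R0 L * R ^ 3 < (\<integral>x. \<rho> t x * norm x ^ 4 \<partial>lborel)"
  shows "0 < (\<integral>x. \<rho> t x * ((norm x)\<^sup>2 * (x \<bullet> velocity (\<rho> t) x)) \<partial>lborel)"
proof -
  have Rp: "0 < R" using R_ge by simp
  interpret density \<kappa> g "\<rho> t" R "sup_bound L" by (rule slice_density[OF t Rp supp])
  define C1 where "C1 = virial_const L"
  have C1: "0 < C1" unfolding C1_def by (rule virial_const_pos)
  define e where "e = (2 * R) powr (- 1 / real DIM('a))"
  have e: "0 < e" "e \<le> 1" "e ^ DIM('a) = 1 / (2 * R)"
    unfolding e_def using powr_minus_inverse[of "2 * R" "DIM('a)"] R_ge by auto
  define k where "k = attraction R0 L * e"
  have ke: "e \<le> k" unfolding k_def using e attraction_ge_1[of R0 L] by simp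
  then have k: "0 < k" using e by simp
  define M2 where "M2 = (\<integral>x. \<rho> t x * (norm x)\<^sup>2 \<partial>lborel)"
  define M3 where "M3 = (\<integral>x. \<rho> t x * norm x ^ 3 \<partial>lborel)"
  define M4 where "M4 = (\<integral>x. \<rho> t x * norm x ^ 4 \<partial>lborel)"
  have i: "integrable lborel (\<lambda>x. \<rho> t x * (norm x)\<^sup>2)" "integrable lborel (\<lambda>x. \<rho> t x * norm x ^ 3)" "integrable lborel (\<lambda>x. \<rho> t x * norm x ^ 4)"
    by (intro u_times_integrable_real continuous_intros)+
  have V: "k / 2 * M3 - (k * r0 / 2 + C1) * M2 \<le> (\<integral>x. \<rho> t x * ((norm x)\<^sup>2 * (x \<bullet> velocity (\<rho> t) x)) \<partial>lborel)"
    unfolding M2_def M3_def C1_def virial_const_def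
  proof (rule fourth_moment_virial)
    show "0 \<le> k" "0 \<le> r0" using k r0 by auto
    show "k \<le> \<kappa> r" if "r0 \<le> r" "0 < r" "r \<le> 2 * R" for r
      using attraction_lower_bound[OF that] by (simp add: k_def e_def)
  qed
  have M2_nonneg: "0 \<le> M2" unfolding M2_def by (rule Bochner_Integration.integral_nonneg) (simp add: u_nonneg)
  have kr0: "k * r0 \<le> C1" using small by (simp add: k_def e_def C1_def)
  \<comment> \<open>With |x|^2 <= |x|^3 / s + s^2, this choice makes 3/2 C1 M3 / s equal to k/4 M3,
    half of the attractive term; the remainder 3/2 C1 s^2 is the 54 C1^3 / k^2 below.\<close>
  define s where "s = 6 * C1 / k"
  have s: "0 < s" unfolding s_def using C1 k by simp
  have "M2 \<le> (\<integral>x. \<rho> t x * norm x ^ 3 / s + s\<^sup>2 * \<rho> t x \<partial>lborel)"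
    unfolding M2_def
  proof (rule integral_mono)
    show "\<rho> t x * (norm x)\<^sup>2 \<le> \<rho> t x * norm x ^ 3 / s + s\<^sup>2 * \<rho> t x" for x
    proof -
      have "(norm x)\<^sup>2 \<le> norm x ^ 3 / s + s\<^sup>2"
      proof (cases "norm x \<le> s")
        case True
        then have "(norm x)\<^sup>2 \<le> s\<^sup>2" by (intro power_mono) auto
        moreover have "0 \<le> norm x ^ 3 / s" using s by simp
        ultimately show ?thesis by linarith
      next
        case False
        then have "(norm x)\<^sup>2 * s \<le> (norm x)\<^sup>2 * norm x" by (intro mult_left_mono) auto
        then have "(norm x)\<^sup>2 \<le> norm x ^ 3 / s" using s by (simp add: le_divide_eq power3_eq_cube power2_eq_square)
        then show ?thesis by (simp add: add_increasing2)
      qed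
      from mult_left_mono[OF this u_nonneg[of x]] show ?thesis by (simp add: distrib_left mult.commute)
    qed
  qed (use i u_integrable in auto)
  also have "\<dots> = M3 / s + s\<^sup>2" using i u_integrable u_mass by (simp add: M3_def)
  finally have M2: "M2 \<le> M3 / s + s\<^sup>2" .
  have "M4 \<le> (\<integral>x. R * (\<rho> t x * norm x ^ 3) \<partial>lborel)"
    unfolding M4_def
  proof (rule integral_mono)
    show "\<rho> t x * norm x ^ 4 \<le> R * (\<rho> t x * norm x ^ 3)" for x
    proof (cases "R \<le> norm x")
      case False
      then have "norm x * (\<rho> t x * norm x ^ 3) \<le> R * (\<rho> t x * norm x ^ 3)" using u_nonneg by (intro mult_right_mono) auto
      moreover have "norm x ^ 4 = norm x * norm x ^ 3" by (simp add: power4_eq_xxxx power3_eq_cube)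
      ultimately show ?thesis by (simp add: mult_ac)
    qed (simp add: u_supp)
  qed (use i in auto)
  then have M4: "M4 \<le> R * M3" by (simp add: M3_def)
  have "(k * r0 / 2 + C1) * M2 \<le> (3 / 2 * C1) * M2" using kr0 M2_nonneg by (intro mult_right_mono) auto
  also have "\<dots> \<le> (3 / 2 * C1) * (M3 / s + s\<^sup>2)" using M2 C1 by (intro mult_left_mono) auto
  also have "\<dots> = k / 4 * M3 + 54 * C1 ^ 3 / k\<^sup>2"
    using C1 k by (simp add: s_def field_simps power2_eq_square power3_eq_cube)
  finally have V2: "k / 4 * M3 - 54 * C1 ^ 3 / k\<^sup>2 \<le> (\<integral>x. \<rho> t x * ((norm x)\<^sup>2 * (x \<bullet> velocity (\<rho> t) x)) \<partial>lborel)"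
    using V by linarith
  have "864 * C1 ^ 3 * R ^ 3 \<le> moment_const R0 L * R ^ 3"
    unfolding moment_const_def C1_def[symmetric] using Rp by (intro mult_right_mono) auto
  then have big: "864 * C1 ^ 3 * R ^ 3 < R * M3" using large M4 by (simp add: M4_def)
  \<comment> \<open>Here N >= 2 enters: since e <= 1, e^2 >= e^N = 1 / (2R). With e <= k this yields
    k^3 >= 1 / (4 R^2), however large \<open>attraction R0 L\<close> is.\<close>
  have "1 / (2 * R) \<le> e\<^sup>2" using e power_decreasing[OF dim, of e] by simp
  also have "e\<^sup>2 \<le> k\<^sup>2" using ke e by (intro power_mono) auto
  finally have k2: "1 / (2 * R) \<le> k\<^sup>2" .
  have "1 / (2 * R) * (1 / (2 * R)) \<le> k\<^sup>2 * e\<^sup>2" using k2 \<open>1 / (2 * R) \<le> e\<^sup>2\<close> Rp by (intro mult_mono) auto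
  also have "\<dots> \<le> k\<^sup>2 * e" using e k by (intro mult_left_mono) (auto simp: power2_eq_square mult_left_le)
  also have "\<dots> \<le> k\<^sup>2 * k" using ke k by (intro mult_left_mono) auto
  finally have k3: "1 \<le> 4 * R\<^sup>2 * k ^ 3" using Rp by (simp add: field_simps power2_eq_square power3_eq_cube)
  have "216 * C1 ^ 3 \<le> 216 * C1 ^ 3 * (4 * R\<^sup>2 * k ^ 3)" using k3 C1 mult_left_mono[OF k3, of "216 * C1 ^ 3"] by simp
  also have "\<dots> = (864 * C1 ^ 3 * R ^ 3) * (k ^ 3 / R)" using Rp by (simp add: power2_eq_square power3_eq_cube)
  also have "\<dots> < (R * M3) * (k ^ 3 / R)" using big k Rp by (intro mult_strict_right_mono) auto
  also have "\<dots> = k ^ 3 * M3" using Rp by simp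
  finally have "0 < k / 4 * M3 - 54 * C1 ^ 3 / k\<^sup>2"
    using k by (simp add: field_simps power2_eq_square power3_eq_cube)
  then show ?thesis using V2 by linarith
qed

text \<open>A barrier argument: above this level \<open>virial_positive\<close> makes the moment
  decrease. The summand R0^4 of \<open>moment_const\<close> covers the initial value.\<close>

lemma fourth_moment_bound:
  assumes T: "0 \<le> T" and supp: "\<And>t x. t \<in> {0..T} \<Longrightarrow> R \<le> norm x \<Longrightarrow> \<rho> t x = 0"
  shows "(\<integral>x. \<rho> T x * norm x ^ 4 \<partial>lborel) \<le> moment_const R0 L * R ^ 3"
proof -
  define \<zeta> where "\<zeta> x = (x \<bullet> x)\<^sup>2" for x :: 'a
  define Z where "Z x = (4 * (x \<bullet> x)) *\<^sub>R x" for x :: 'a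
  have \<zeta>n: "\<zeta> x * \<rho> t x = \<rho> t x * norm x ^ 4" for x t
    by (simp add: \<zeta>_def power2_norm_eq_inner[symmetric] power2_eq_square power4_eq_xxxx)
  have d\<zeta>: "(\<zeta> has_derivative (\<lambda>h. Z x \<bullet> h)) (at x)" for x
  proof -
    have "((\<lambda>s. s\<^sup>2) has_real_derivative 2 * (x \<bullet> x)) (at (x \<bullet> x))" by (auto intro!: derivative_eq_intros)
    from has_derivative_radial[OF this] show ?thesis unfolding \<zeta>_def[abs_def] Z_def
      by (rule has_derivative_eq_rhs) (simp add: fun_eq_iff)
  qed
  have Zc: "continuous_on UNIV Z" unfolding Z_def by (intro continuous_intros)
  have \<zeta>c: "continuous_on UNIV \<zeta>" unfolding \<zeta>_def by (intro continuous_intros)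
  let ?f = "\<lambda>t. \<integral>x. \<zeta> x * \<rho> t x \<partial>lborel"
  have Rp: "0 < R" using R_ge by simp
  have init: "?f 0 \<le> moment_const R0 L * R ^ 3"
  proof -
    have "?f 0 \<le> (\<integral>x. R0 ^ 4 * \<rho> 0 x \<partial>lborel)"
    proof (rule integral_mono)
      show "integrable lborel (\<lambda>x. \<zeta> x * \<rho> 0 x)" "integrable lborel (\<lambda>x. R0 ^ 4 * \<rho> 0 x)"
        by (rule moment_integrable[OF order_refl]; intro \<zeta>c continuous_intros)+
      show "\<zeta> x * \<rho> 0 x \<le> R0 ^ 4 * \<rho> 0 x" for x
      proof (cases "R0 \<le> norm x")
        case False
        then have "norm x ^ 4 \<le> R0 ^ 4" by (intro power_mono) auto
        then show ?thesis using init_nonneg[of x] unfolding \<zeta>n by (simp add: mult.commute mult_left_mono)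
      qed (simp add: init_supp)
    qed
    also have "\<dots> = R0 ^ 4 * 1" using init_mass by simp
    also have "\<dots> \<le> moment_const R0 L * 1" unfolding moment_const_def using virial_const_pos[of L] by simp
    also have "\<dots> \<le> moment_const R0 L * R ^ 3"
      using R_ge by (intro mult_left_mono moment_const_nonneg one_le_power) auto
    finally show ?thesis .
  qed
  show ?thesis
  proof (cases "T = 0")
    case True
    then show ?thesis using init by (simp add: \<zeta>n)
  next
    case False
    then have T0: "0 < T" using T by simp
    have "?f T \<le> moment_const R0 L * R ^ 3"
    proof (rule le_barrier[OF moment_continuous[OF T0 \<zeta>c] init])
      fix t assume t: "0 < t" "t \<le> T" and big: "moment_const R0 L * R ^ 3 < ?f t"
      have I: "0 < (\<integral>x. \<rho> t x * ((norm x)\<^sup>2 * (x \<bullet> velocity (\<rho> t) x)) \<partial>lborel)"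
        by (rule virial_positive) (use t supp big in \<open>auto simp: \<zeta>n\<close>)
      have e: "\<rho> t x * (Z x \<bullet> velocity (\<rho> t) x) = 4 * (\<rho> t x * ((norm x)\<^sup>2 * (x \<bullet> velocity (\<rho> t) x)))" for x
        by (simp add: Z_def power2_norm_eq_inner)
      have "(?f has_real_derivative - (4 * (\<integral>x. \<rho> t x * ((norm x)\<^sup>2 * (x \<bullet> velocity (\<rho> t) x)) \<partial>lborel))) (at t)"
        using moment_derivative[OF t(1) d\<zeta> Zc] unfolding e by simp
      moreover have "- (4 * (\<integral>x. \<rho> t x * ((norm x)\<^sup>2 * (x \<bullet> velocity (\<rho> t) x)) \<partial>lborel)) < 0" using I by linarith
      ultimately show "\<exists>d<0. (?f has_real_derivative d) (at t)" by blast
    qed (use T in auto)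
    then show ?thesis by (simp add: \<zeta>n)
  qed
qed

text \<open>The margin |x|^(1 - 1/N) lets the inward drift survive for a short time after
  \<open>T\<close>. It is proved for every |x| >= R because the support may then, a priori, extend
  beyond \<open>R\<close>.\<close>

lemma drift_inward:
  assumes T: "0 \<le> T" and supp: "\<And>t x. t \<in> {0..T} \<Longrightarrow> R \<le> norm x \<Longrightarrow> \<rho> t x = 0" and x: "R \<le> norm x"
  shows "norm x * norm x powr (- 1 / real DIM('a)) \<le> x \<bullet> velocity (\<rho> T) x"
proof -
  have Rp: "0 < R" using R_ge by simp
  interpret density \<kappa> g "\<rho> T" R "sup_bound L" by (rule slice_density) (use T supp Rp in auto)
  let ?X = "norm x" and ?s = "sphere_area TYPE('a)"
  have s: "0 < ?s" by (rule sphere_area_pos)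
  have X: "2 \<le> ?X" "2 * r0 \<le> ?X" "R0 \<le> ?X" using x R_ge by linarith+
  have x0: "x \<noteq> 0" using X(1) by auto
  define \<delta> where "\<delta> = ?X powr (- 1 / real DIM('a))"
  have \<delta>: "0 < \<delta>" "\<delta> \<le> 1" "\<delta> ^ DIM('a) = 1 / ?X" "\<delta> / 2 \<le> (2 * ?X) powr (- 1 / real DIM('a))" "inverse (\<delta> ^ (DIM('a) - 1)) = ?X * \<delta>"
    unfolding \<delta>_def using powr_minus_inverse[of ?X "DIM('a)"] X(1) by auto
  define k where "k = attraction R0 L * (2 * ?X) powr (- 1 / real DIM('a))"
  have k: "attraction R0 L * (\<delta> / 2) \<le> k"
    unfolding k_def using attraction_ge_1[of R0 L] by (intro mult_left_mono \<delta>(4)) auto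
  have k0: "0 \<le> k" unfolding k_def using attraction_ge_1[of R0 L] by (intro mult_nonneg_nonneg) auto
  define M4 where "M4 = (\<integral>y. \<rho> T y * norm y ^ 4 \<partial>lborel)"
  have "M4 \<le> moment_const R0 L * R ^ 3" unfolding M4_def by (rule fourth_moment_bound[OF T supp])
  also have "\<dots> \<le> moment_const R0 L * ?X ^ 3"
    using x Rp by (intro mult_left_mono power_mono moment_const_nonneg) auto
  finally have M4: "M4 \<le> moment_const R0 L * ?X ^ 3" .
  have far: "16 / ?X ^ 4 * M4 \<le> 16 * moment_const R0 L / ?X"
  proof -
    have "16 / ?X ^ 4 * M4 \<le> 16 / ?X ^ 4 * (moment_const R0 L * ?X ^ 3)" using M4 by (intro mult_left_mono) auto
    also have "\<dots> = 16 * moment_const R0 L / ?X" using x0 by (simp add: field_simps power4_eq_xxxx power3_eq_cube)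
    finally show ?thesis .
  qed
  have "\<delta> ^ DIM('a) \<le> \<delta> ^ 1" using \<delta> dim by (intro power_decreasing) auto
  then have invX: "1 / ?X \<le> \<delta>" using \<delta>(3) by simp
  have "inverse ((?X / 2) ^ (DIM('a) - 1)) \<le> inverse ((?X / 2) ^ 1)"
    using X dim by (intro le_imp_inverse_le power_increasing) auto
  also have "\<dots> \<le> 2 * \<delta>" using invX by (simp add: field_simps)
  finally have far2: "inverse ((?X / 2) ^ (DIM('a) - 1)) \<le> 2 * \<delta>" .
  have "inverse (\<delta> ^ (DIM('a) - 1)) * (16 / ?X ^ 4 * M4) \<le> (?X * \<delta>) * (16 * moment_const R0 L / ?X)"
    unfolding \<delta>(5) using far \<delta>(1) by (intro mult_left_mono) auto
  also have "\<dots> = 16 * moment_const R0 L * \<delta>" using x0 by simp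
  finally have mid: "inverse (\<delta> ^ (DIM('a) - 1)) * (16 / ?X ^ 4 * M4) \<le> 16 * moment_const R0 L * \<delta>" .
  have drift: "?s * drift_const R0 L * \<delta> = sup_bound L * (?s * \<delta>) + 16 * moment_const R0 L * \<delta> + 2 * \<delta>"
    using s by (simp add: drift_const_def field_simps)
  have rep: "sup_bound L * (?s * \<delta>) + inverse (\<delta> ^ (DIM('a) - 1)) * (16 / ?X ^ 4 * M4) + inverse ((?X / 2) ^ (DIM('a) - 1))
      \<le> ?s * drift_const R0 L * \<delta>"
    unfolding drift using mid far2 by linarith
  have V: "k * (?X - r0) / 2 - ?X / ?s * (sup_bound L * (?s * \<delta>) + inverse (\<delta> ^ (DIM('a) - 1)) * (16 / ?X ^ 4 * M4)
        + inverse ((?X / 2) ^ (DIM('a) - 1))) \<le> x \<bullet> velocity (\<rho> T) x"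
    unfolding M4_def
  proof (rule inward_velocity[OF x k0 r0 _ \<delta>(1)])
    show "k \<le> \<kappa> r" if "r0 \<le> r" "0 < r" "r \<le> 2 * norm x" for r
      unfolding k_def by (rule attraction_lower_bound[OF that])
  qed
  have "?X / ?s * (sup_bound L * (?s * \<delta>) + inverse (\<delta> ^ (DIM('a) - 1)) * (16 / ?X ^ 4 * M4) + inverse ((?X / 2) ^ (DIM('a) - 1)))
     \<le> ?X / ?s * (?s * drift_const R0 L * \<delta>)"
    using s by (intro mult_left_mono rep) auto
  also have "\<dots> = ?X * \<delta> * drift_const R0 L" using s by simp
  finally have rep': "?X / ?s * (sup_bound L * (?s * \<delta>) + inverse (\<delta> ^ (DIM('a) - 1)) * (16 / ?X ^ 4 * M4) + inverse ((?X / 2) ^ (DIM('a) - 1)))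
     \<le> ?X * \<delta> * drift_const R0 L" .
  have "?X * \<delta> * (drift_const R0 L + 1) = (attraction R0 L * (\<delta> / 2)) * (?X / 4)"
    by (simp add: attraction_def field_simps)
  also have "\<dots> \<le> k * (?X / 4)" using k by (intro mult_right_mono) auto
  also have "\<dots> \<le> k * ((?X - r0) / 2)" using X k0 by (intro mult_left_mono) auto
  finally have "?X * \<delta> * (drift_const R0 L + 1) \<le> k * (?X - r0) / 2" by simp
  then show ?thesis using V rep' unfolding \<delta>_def[symmetric] by (simp add: distrib_left)
qed

text \<open>The drift is Lipschitz in time, so on the annulus from \<open>R\<close> to the a priori
  radius \<open>r\<close> it still points inwards during [T, T + d]. The integral of the density
  against a weight vanishing inside \<open>R\<close> then cannot increase from its value 0 at
  \<open>T\<close>; as its integrand is nonnegative, the density vanishes outside.\<close>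

lemma support_persists:
  assumes T: "0 \<le> T" and supp: "\<And>t x. t \<in> {0..T} \<Longrightarrow> R \<le> norm x \<Longrightarrow> \<rho> t x = 0"
  obtains d where "0 < d" "\<And>t x. t \<in> {0..T + d} \<Longrightarrow> R \<le> norm x \<Longrightarrow> \<rho> t x = 0"
proof -
  have Rp: "0 < R" using R_ge by simp
  have T1: "0 < T + 1" using T by simp
  obtain r' where r': "0 < r'" "\<And>s x. s \<in> {0..T + 1} \<Longrightarrow> r' \<le> norm x \<Longrightarrow> \<rho> s x = 0"
    by (rule support_radius[OF T1]) blast
  define r where "r = max r' R"
  have r: "0 < r" "R \<le> r" "\<And>s x. s \<in> {0..T + 1} \<Longrightarrow> r \<le> norm x \<Longrightarrow> \<rho> s x = 0"
    using r' by (auto simp: r_def)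
  note C1 = C1_slice[OF T1 r(3)]
  obtain \<Lambda> where \<Lambda>: "0 < \<Lambda>" "\<And>s t x. s \<in> {0..T+1} \<Longrightarrow> t \<in> {0..T+1} \<Longrightarrow> \<bar>\<rho> s x - \<rho> t x\<bar> \<le> \<Lambda> * \<bar>s - t\<bar>"
    using time_lipschitz[OF T1] by blast
  have cs: "continuous_on UNIV (\<rho> s)" if "0 \<le> s" for s
    by (rule has_derivative_continuous_on[OF has_derivative_at_withinI[OF space_deriv[OF that]]])
  \<comment> \<open>Lower bound for the margin of \<open>drift_inward\<close> on the annulus from
    \<open>R\<close> to \<open>r\<close>.\<close>
  define c where "c = R * r powr (- 1 / real DIM('a))"
  have c: "0 < c" unfolding c_def using Rp r by simp
  \<comment> \<open>Bounds the rate at which \<open>x \<bullet> velocity (\<rho> t) x\<close> can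
    change in time on the annulus; the 1 makes it positive, so that \<open>d\<close> can be at most
    \<open>c / Q\<close>.\<close>
  define Q where "Q = r * (\<Lambda> * K_mass (r + r)) + 1"
  have Q: "0 < Q" unfolding Q_def using r \<Lambda> K_mass_nonneg[of "r + r"] by (intro add_nonneg_pos mult_nonneg_nonneg) auto
  define d where "d = min 1 (c / Q)"
  have d: "0 < d" "d \<le> 1" "d * Q \<le> c" unfolding d_def using c Q by (auto simp: min_def field_simps)
  have inward: "0 \<le> x \<bullet> velocity (\<rho> t) x" if t: "t \<in> {T..T + d}" and x: "R \<le> norm x" "norm x \<le> r" for t x
  proof -
    have tT: "t \<in> {0..T+1}" "T \<in> {0..T+1}" using t d T by auto
    have "norm (velocity (\<rho> t) x - velocity (\<rho> T) x) \<le> (\<Lambda> * \<bar>t - T\<bar>) * K_mass (r + r)"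
      by (rule velocity_diff_bound[OF cs r(3) x(2) cs r(3) x(2)]) (use tT \<Lambda>(2) in auto)
    also have "\<dots> \<le> (\<Lambda> * d) * K_mass (r + r)"
      using t \<Lambda>(1) K_mass_nonneg by (intro mult_right_mono mult_left_mono) auto
    finally have "norm x * norm (velocity (\<rho> t) x - velocity (\<rho> T) x) \<le> r * ((\<Lambda> * d) * K_mass (r + r))"
      using x r by (intro mult_mono) auto
    also have "\<dots> \<le> d * Q" unfolding Q_def using d by (simp add: algebra_simps)
    also have "\<dots> \<le> c" by (rule d)
    finally have "\<bar>x \<bullet> (velocity (\<rho> t) x - velocity (\<rho> T) x)\<bar> \<le> c"
      using Cauchy_Schwarz_ineq2[of x "velocity (\<rho> t) x - velocity (\<rho> T) x"] by linarith
    moreover have "c \<le> x \<bullet> velocity (\<rho> T) x"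
    proof -
      have "r powr (- 1 / real DIM('a)) \<le> norm x powr (- 1 / real DIM('a))" using x Rp by (intro powr_mono2') auto
      then have "c \<le> norm x * norm x powr (- 1 / real DIM('a))"
        unfolding c_def using x Rp by (intro mult_mono) auto
      also have "\<dots> \<le> x \<bullet> velocity (\<rho> T) x" by (rule drift_inward[OF T supp x(1)])
      finally show ?thesis .
    qed
    ultimately show ?thesis by (simp add: inner_diff_right)
  qed
  \<comment> \<open>The square of this positive part is continuously differentiable, as
    \<open>moment_derivative\<close> demands of a weight.\<close>
  define m where "m x = max 0 (x \<bullet> x - R\<^sup>2)" for x :: 'a
  define \<zeta> where "\<zeta> x = (m x)\<^sup>2" for x
  define Z where "Z x = (4 * m x) *\<^sub>R x" for x
  have sq: "((\<lambda>s. (max 0 (s - R\<^sup>2))\<^sup>2) has_real_derivative 2 * max 0 (s - R\<^sup>2)) (at s)" for s :: real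
  proof -
    let ?h = "\<lambda>s. (max 0 (s - R\<^sup>2))\<^sup>2"
    consider "s < R\<^sup>2" | "R\<^sup>2 < s" | "s = R\<^sup>2" by linarith
    then show ?thesis
    proof cases
      case 1
      have ev: "eventually (\<lambda>y. ?h y = (\<lambda>_. 0) y) (nhds s)"
        using eventually_nhds_in_open[of "{..<R\<^sup>2}" s] 1 by (auto elim!: eventually_mono)
      show ?thesis using 1 by (subst DERIV_cong_ev[OF refl ev refl]) simp
    next
      case 2
      have ev: "eventually (\<lambda>y. ?h y = (\<lambda>y. (y - R\<^sup>2)\<^sup>2) y) (nhds s)"
        using eventually_nhds_in_open[of "{R\<^sup>2<..}" s] 2 by (auto elim!: eventually_mono)
      show ?thesis using 2 by (subst DERIV_cong_ev[OF refl ev refl]) (auto intro!: derivative_eq_intros)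
    next
      case 3
      have "((\<lambda>h. (max 0 h)\<^sup>2 / h) \<longlongrightarrow> (0::real)) (at 0)"
      proof (rule Lim_null_comparison)
        show "eventually (\<lambda>h::real. norm ((max 0 h)\<^sup>2 / h) \<le> \<bar>h\<bar>) (at 0)"
          by (auto simp: max_def power2_eq_square intro!: always_eventually)
        show "((\<lambda>h::real. \<bar>h\<bar>) \<longlongrightarrow> 0) (at 0)" by (auto intro!: tendsto_eq_intros)
      qed
      then show ?thesis using 3 by (simp add: DERIV_def)
    qed
  qed
  have d\<zeta>: "(\<zeta> has_derivative (\<lambda>h. Z x \<bullet> h)) (at x)" for x
    using has_derivative_radial[OF sq[of "x \<bullet> x"]] unfolding \<zeta>_def[abs_def] Z_def m_def
    by (rule has_derivative_eq_rhs) (simp add: fun_eq_iff)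
  have mc: "continuous_on UNIV m" unfolding m_def by (intro continuous_intros)
  have Zc: "continuous_on UNIV Z" and \<zeta>c: "continuous_on UNIV \<zeta>" unfolding Z_def \<zeta>_def by (intro continuous_intros mc)+
  have m_out: "m x = 0" if "norm x \<le> R" for x
    using power_mono[OF that norm_ge_zero, of 2] by (simp add: m_def power2_norm_eq_inner)
  let ?E = "\<lambda>t. \<integral>x. \<zeta> x * \<rho> t x \<partial>lborel"
  have ET: "?E T = 0"
  proof -
    have "\<zeta> x * \<rho> T x = 0" for x
      using m_out[of x] supp[of T x] T by (cases "norm x \<le> R") (auto simp: \<zeta>_def)
    then show ?thesis by (simp only: Bochner_Integration.integral_zero)
  qed
  have E_le: "?E t \<le> 0" if t: "T < t" "t \<le> T + d" for t
  proof -
    have "continuous_on {T..t} ?E"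
      by (rule continuous_on_subset[OF moment_continuous[OF T1 \<zeta>c]]) (use t d T in auto)
    moreover have der: "(?E has_real_derivative - (\<integral>x. \<rho> s x * (Z x \<bullet> velocity (\<rho> s) x) \<partial>lborel)) (at s)" if "T < s" for s
      using moment_derivative[OF _ d\<zeta> Zc, of s] that T by simp
    ultimately obtain l z where z: "T < z" "z < t" "(?E has_real_derivative l) (at z)" "?E t - ?E T = (t - T) * l"
      using MVT[OF t(1), of ?E] by (auto simp: real_differentiable_def)
    have "l = - (\<integral>x. \<rho> z x * (Z x \<bullet> velocity (\<rho> z) x) \<partial>lborel)" by (rule DERIV_unique[OF z(3) der[OF z(1)]])
    moreover have "0 \<le> (\<integral>x. \<rho> z x * (Z x \<bullet> velocity (\<rho> z) x) \<partial>lborel)"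
    proof (rule Bochner_Integration.integral_nonneg)
      fix x :: 'a
      have z1: "z \<in> {0..T+1}" "z \<in> {T..T+d}" using z t d T by auto
      consider "norm x \<le> R" | "r \<le> norm x" | "R \<le> norm x" "norm x \<le> r" by linarith
      then show "0 \<le> \<rho> z x * (Z x \<bullet> velocity (\<rho> z) x)"
      proof cases
        case 3
        then show ?thesis using inward[OF z1(2) 3] nonneg[of z x] z1(1) by (auto simp: Z_def m_def)
      qed (use m_out r(3)[OF z1(1)] in \<open>auto simp: Z_def\<close>)
    qed
    ultimately have "l \<le> 0" by simp
    then show ?thesis using z(4) ET t by (simp add: mult_nonneg_nonpos)
  qed
  show thesis
  proof
    show "\<rho> t x = 0" if t: "t \<in> {0..T + d}" and x: "R \<le> norm x" for t x
    proof (cases "t \<le> T")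
      case False
      then have tT: "T < t" "t \<le> T + d" "0 \<le> t" using t by auto
      have out: "\<rho> t y = 0" if y: "R < norm y" for y
      proof -
        have "\<zeta> y * \<rho> t y = 0"
        proof (rule continuous_nonneg_integral_zero[OF _ _ _ E_le[OF tT(1,2)]])
          show "continuous_on UNIV (\<lambda>x. \<zeta> x * \<rho> t x)" by (intro continuous_intros \<zeta>c cs tT)
          show "integrable lborel (\<lambda>x. \<zeta> x * \<rho> t x)" by (rule moment_integrable[OF tT(3) \<zeta>c])
          show "0 \<le> \<zeta> x * \<rho> t x" for x using nonneg[OF tT(3), of x] by (simp add: \<zeta>_def)
        qed
        moreover have "R\<^sup>2 < (norm y)\<^sup>2" using y Rp by (intro power_strict_mono) auto
        ultimately show ?thesis by (auto simp: \<zeta>_def m_def power2_norm_eq_inner)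
      qed
      \<comment> \<open>On the sphere |x| = R the weight vanishes and gives no information; the
        value there is a limit of values strictly outside.\<close>
      have "(\<lambda>n. \<rho> t ((1 + inverse (real (Suc n))) *\<^sub>R x)) \<longlonglongrightarrow> \<rho> t ((1 + 0) *\<^sub>R x)"
      proof (rule continuous_on_tendsto_compose[OF cs[OF tT(3)]])
        show "(\<lambda>n. (1 + inverse (real (Suc n))) *\<^sub>R x) \<longlonglongrightarrow> (1 + 0) *\<^sub>R x"
          by (intro tendsto_intros LIMSEQ_inverse_real_of_nat)
      qed auto
      moreover have "\<rho> t ((1 + inverse (real (Suc n))) *\<^sub>R x) = 0" for n
      proof (rule out)
        have "0 < norm x" using x Rp by linarith
        then have "0 < inverse (real (Suc n)) * norm x" by (intro mult_pos_pos) auto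
        then have "norm x < (1 + inverse (real (Suc n))) * norm x" unfolding distrib_right by linarith
        moreover have "norm ((1 + inverse (real (Suc n))) *\<^sub>R x) = (1 + inverse (real (Suc n))) * norm x"
          unfolding norm_scaleR by (subst abs_of_nonneg) (auto intro!: add_nonneg_nonneg)
        ultimately show "R < norm ((1 + inverse (real (Suc n))) *\<^sub>R x)" using x by linarith
      qed
      ultimately have "(\<lambda>n. 0) \<longlonglongrightarrow> \<rho> t x" by simp
      then show ?thesis using LIMSEQ_unique tendsto_const by blast
    qed (use t x supp in auto)
  qed (rule d)
qed

text \<open>Continuation: the times up to which the support is confined contain their supremum by
  continuity in time, and \<open>support_persists\<close> goes past it.\<close>

lemma support_confined:
  assumes "0 \<le> t" "R \<le> norm x"
  shows "\<rho> t x = 0"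
proof (rule ccontr)
  assume nz: "\<rho> t x \<noteq> 0"
  define S where "S = {T. 0 \<le> T \<and> (\<forall>t\<in>{0..T}. \<forall>x. R \<le> norm x \<longrightarrow> \<rho> t x = 0)}"
  have 0: "0 \<in> S" using init_supp R_ge by (auto simp: S_def)
  have ub: "T \<le> t" if "T \<in> S" for T
    using that nz assms by (auto simp: S_def not_le[symmetric])
  define T where "T = Sup S"
  have bdd: "bdd_above S" using ub by (auto simp: bdd_above_def)
  have T0: "0 \<le> T" unfolding T_def using 0 bdd by (rule cSup_upper)
  have before: "\<rho> s y = 0" if "0 \<le> s" "s < T" "R \<le> norm y" for s y
  proof -
    have "S \<noteq> {}" using 0 by blast
    then obtain T' where "T' \<in> S" "s < T'" using less_cSupD[of S s] \<open>s < T\<close> unfolding T_def by blast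
    then show ?thesis using that by (auto simp: S_def)
  qed
  have at_T: "\<rho> T y = 0" if y: "R \<le> norm y" for y
  proof (cases "T = 0")
    case True
    then show ?thesis using 0 y by (auto simp: S_def)
  next
    case False
    then have Tp: "0 < T" using T0 by simp
    obtain \<Lambda> where \<Lambda>: "0 < \<Lambda>" "\<And>s t x. s \<in> {0..T} \<Longrightarrow> t \<in> {0..T} \<Longrightarrow> \<bar>\<rho> s x - \<rho> t x\<bar> \<le> \<Lambda> * \<bar>s - t\<bar>"
      using time_lipschitz[OF Tp] by blast
    show ?thesis
    proof (rule ccontr)
      assume "\<rho> T y \<noteq> 0"
      then have p: "0 < \<bar>\<rho> T y\<bar>" by simp
      define h where "h = min T (\<bar>\<rho> T y\<bar> / (2 * \<Lambda>))"
      have h: "0 < h" "h \<le> T" "h * (2 * \<Lambda>) \<le> \<bar>\<rho> T y\<bar>" using Tp p \<Lambda>(1) by (auto simp: h_def min_def field_simps)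
      have "\<bar>\<rho> T y - \<rho> (T - h) y\<bar> \<le> \<Lambda> * h" using \<Lambda>(2)[of T "T - h" y] h T0 by simp
      moreover have "\<rho> (T - h) y = 0" by (rule before) (use h y in auto)
      ultimately show False using h p by (simp add: mult_ac)
    qed
  qed
  have "\<rho> s y = 0" if "s \<in> {0..T}" "R \<le> norm y" for s y
    using before[of s y] at_T[of y] that by (cases "s = T") auto
  then obtain d where d: "0 < d" "\<And>t x. t \<in> {0..T + d} \<Longrightarrow> R \<le> norm x \<Longrightarrow> \<rho> t x = 0"
    by (rule support_persists[OF T0]) blast+
  then have "T + d \<in> S" using T0 by (auto simp: S_def)
  then have "T + d \<le> T" unfolding T_def using bdd by (rule cSup_upper)
  then show False using d by simp
qed

end

text \<open>\<open>R\<close> is produced before any solution is given. \<open>r0\<close> comes from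
  the growth condition at the level \<open>attraction R0 L\<close>, and \<open>R\<close> is taken
  large last, which achieves \<open>small\<close> because (2R)^(-1/N) r0 tends to 0.\<close>

theorem (in confining_kernel) confinement:
  obtains R where "0 < R" "\<And>\<rho> D\<rho> t x. transport \<kappa> g \<rho> D\<rho> R0 L \<Longrightarrow> 0 \<le> t \<Longrightarrow> R \<le> norm x \<Longrightarrow> \<rho> t x = 0"
proof -
  let ?A = "attraction R0 L"
  have A: "0 < ?A" using attraction_ge_1[of R0 L] by simp
  have N: "0 < real DIM('a)" by simp
  obtain r1 where r1: "\<And>r. r1 \<le> r \<Longrightarrow> ?A \<le> \<kappa> r * r powr (1 / real DIM('a))"
    using \<kappa>_grow by (auto simp: filterlim_at_top eventually_at_top_linorder)
  define r0 where "r0 = max r1 0"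
  have strong: "?A * r powr (- 1 / real DIM('a)) \<le> \<kappa> r" if "r0 \<le> r" "0 < r" for r
  proof -
    have "?A * r powr (- 1 / real DIM('a)) \<le> (\<kappa> r * r powr (1 / real DIM('a))) * r powr (- 1 / real DIM('a))"
      using r1[of r] that by (intro mult_right_mono) (auto simp: r0_def)
    also have "\<dots> = \<kappa> r" using that by (simp add: mult.assoc powr_add[symmetric])
    finally show ?thesis .
  qed
  have "((\<lambda>R. ?A * (2 * R) powr (- 1 / real DIM('a)) * r0) \<longlongrightarrow> ?A * 0 * r0) at_top"
    by (intro tendsto_intros tendsto_neg_powr filterlim_tendsto_pos_mult_at_top[OF tendsto_const] filterlim_ident) auto
  then have "eventually (\<lambda>R. ?A * (2 * R) powr (- 1 / real DIM('a)) * r0 < virial_const L) at_top"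
    using virial_const_pos[of L] by (intro order_tendstoD) auto
  then obtain R1 where R1: "\<And>R. R1 \<le> R \<Longrightarrow> ?A * (2 * R) powr (- 1 / real DIM('a)) * r0 < virial_const L"
    by (auto simp: eventually_at_top_linorder)
  define R where "R = Max {2, R0, 2 * r0, R1}"
  show thesis
  proof
    show "0 < R" unfolding R_def by (simp add: less_max_iff_disj)
    fix \<rho> :: "real \<Rightarrow> 'a \<Rightarrow> real" and D\<rho> :: "real \<Rightarrow> 'a \<Rightarrow> 'a" and t :: real and x :: 'a
    assume "transport \<kappa> g \<rho> D\<rho> R0 L" "0 \<le> t" "R \<le> norm x"
    then interpret transport \<kappa> g \<rho> D\<rho> R0 L by simp
    interpret confined_transport \<kappa> g \<rho> D\<rho> R0 L r0 R
    proof
      show "attraction R0 L * (2 * R) powr (- 1 / real DIM('a)) * r0 \<le> virial_const L"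
        by (rule less_imp_le[OF R1]) (simp add: R_def)
      show "0 \<le> r0" by (simp add: r0_def)
    qed (use strong in \<open>auto simp: R_def\<close>)
    show "\<rho> t x = 0" using \<open>0 \<le> t\<close> \<open>R \<le> norm x\<close> by (rule support_confined)
  qed
qed

section \<open>Classical solutions\<close>

lemma gradient_eq:
  assumes "(f has_derivative (\<lambda>h. h \<bullet> D)) (at x)"
  shows "gradient f x = D"
proof -
  have D: "GDERIV f x :> D" using assms by (simp add: gderiv_def)
  have "D' = D" if "GDERIV f x :> D'" for D'
  proof -
    have "(\<lambda>h. h \<bullet> D') = (\<lambda>h. h \<bullet> D)"
      using that D has_derivative_unique by (simp add: gderiv_def)
    then have "(D' - D) \<bullet> D' = (D' - D) \<bullet> D" by metis
    then have "(D' - D) \<bullet> (D' - D) = 0" by (simp only: inner_diff_right)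
    then show ?thesis by simp
  qed
  with D show ?thesis unfolding gradient_def by (rule the_equality)
qed

lemma newtonian_has_derivative:
  fixes z :: "'a::euclidean_space"
  assumes dim: "2 \<le> DIM('a)" and z: "z \<noteq> 0"
  shows "(newtonian has_derivative (\<lambda>h. h \<bullet> ((1 / (sphere_area TYPE('a) * norm z ^ DIM('a))) *\<^sub>R z))) (at z)"
proof -
  define c where "c = unit_ball_vol (real DIM('a))"
  have c: "0 < c" by (simp add: c_def)
  have ball: "measure lborel (ball (0::'a) 1) = c" using content_ball[of 1 "0::'a"] by (simp add: c_def)
  have nz: "0 < norm z" using z by simp
  have nd: "(norm has_derivative (\<lambda>h. h \<bullet> sgn z)) (at z)" by (rule has_derivative_norm[OF z])
  have radial: "((\<lambda>x. F (norm x)) has_derivative (\<lambda>h. h \<bullet> ((F' / norm z) *\<^sub>R z))) (at z)"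
    if F: "(F has_real_derivative F') (at (norm z))" for F F'
    using has_derivative_compose[OF nd F[unfolded has_field_derivative_def]]
    by (rule has_derivative_eq_rhs) (auto simp: sgn_div_norm divide_inverse)
  show ?thesis
  proof (cases "DIM('a) = 2")
    case True
    have "((\<lambda>r. 1 / (2 * pi) * ln r) has_real_derivative 1 / (2 * pi) * (1 / norm z)) (at (norm z))"
      using nz by (intro DERIV_cmult DERIV_ln_divide)
    from radial[OF this] have "(newtonian has_derivative (\<lambda>h. h \<bullet> ((1 / (2 * pi) * (1 / norm z) / norm z) *\<^sub>R z))) (at z)"
      unfolding newtonian_def using True by simp
    moreover have "1 / (2 * pi) * (1 / norm z) / norm z = 1 / (sphere_area TYPE('a) * norm z ^ DIM('a))"
      using True nz by (simp add: sphere_area_def power2_eq_square unit_ball_vol_2 eval_unit_ball_vol)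
    ultimately show ?thesis by simp
  next
    case False
    define N where "N = real DIM('a)"
    have N: "2 < N" using dim False by (simp add: N_def)
    define F where "F r = - 1 / (N * (N - 2) * c) * r powr (2 - N)" for r
    have "(F has_real_derivative - 1 / (N * (N - 2) * c) * ((2 - N) * norm z powr (2 - N - 1))) (at (norm z))"
      unfolding F_def using nz by (intro DERIV_cmult has_real_derivative_powr)
    from radial[OF this] have d: "((\<lambda>x. F (norm x)) has_derivative
        (\<lambda>h. h \<bullet> ((- 1 / (N * (N - 2) * c) * ((2 - N) * norm z powr (2 - N - 1)) / norm z) *\<^sub>R z))) (at z)" .
    have "norm z powr (2 - N - 1) = norm z powr 1 * norm z powr (- N)"
      by (simp only: powr_add[symmetric]) simp
    also have "norm z powr (- N) = 1 / norm z ^ DIM('a)"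
      using nz by (simp add: N_def powr_minus_divide powr_realpow)
    finally have p: "norm z powr (2 - N - 1) = norm z powr 1 * (1 / norm z ^ DIM('a))" .
    have "- 1 / (a * (a - 2) * c) * ((2 - a) * (r * (1 / P))) / r = 1 / (a * c * P)" if "2 < a" "0 < r" "0 < P" for a r P :: real
    proof -
      have "- 1 / (a * (a - 2) * c) * ((2 - a) * (r * (1 / P))) / r = ((a - 2) / (a - 2)) * ((r / r) * (1 / (a * c * P)))"
        by (simp add: divide_simps)
      then show ?thesis using that by simp
    qed
    from this[of N "norm z" "norm z ^ DIM('a)"]
    have "- 1 / (N * (N - 2) * c) * ((2 - N) * norm z powr (2 - N - 1)) / norm z = 1 / (sphere_area TYPE('a) * norm z ^ DIM('a))"
      unfolding p using N nz by (simp add: sphere_area_def N_def c_def)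
    moreover have "newtonian = (\<lambda>x::'a. F (norm x))"
      using False by (simp add: fun_eq_iff newtonian_def F_def N_def ball)
    ultimately show ?thesis using d by simp
  qed
qed

text \<open>The assumptions on the potential become radial data here:
  \<open>radial_weak_laplacian\<close> links w' to the Laplacian, and the classical gradient is
  computed off the origin.\<close>

lemma kernel_from_assumptions:
  fixes Wa :: "'a::euclidean_space \<Rightarrow> real"
  assumes dim: "2 \<le> DIM('a)" and W2: "W2 Wa" and rad: "W_RAD Wa w" and conf: "W_CONF DIM('a) w"
  obtains g :: "'a \<Rightarrow> real" where "confining_kernel (deriv w) g"
    "\<And>z. z \<noteq> 0 \<Longrightarrow> gradient (\<lambda>x. - newtonian x + Wa x) z = confining_kernel.K (deriv w) z"
proof -
  obtain D where D: "\<And>r. 0 < r \<Longrightarrow> (w has_vector_derivative D r) (at r)" "continuous_on {0<..} D"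
    using rad by (auto simp: W_RAD_def C1_differentiable_on_def)
  have dw: "(w has_real_derivative deriv w r) (at r)" and Dw: "deriv w r = D r" if "0 < r" for r
  proof -
    have d: "(w has_real_derivative D r) (at r)"
      using D(1)[OF that] by (simp add: has_real_derivative_iff_has_vector_derivative)
    show "deriv w r = D r" by (rule DERIV_imp_deriv[OF d])
    with d show "(w has_real_derivative deriv w r) (at r)" by simp
  qed
  have cw: "continuous_on {0<..} (deriv w)"
    using D(2) by (rule continuous_on_eq) (simp add: Dw)
  have Wa: "Wa x = w (norm x)" if "x \<noteq> 0" for x using rad that by (simp add: W_RAD_def)
  obtain g0 where g0: "weak_laplacian Wa g0" "\<And>\<epsilon>. 0 < \<epsilon> \<Longrightarrow> \<exists>C. AE x in lebesgue. x \<notin> ball 0 \<epsilon> \<longrightarrow> \<bar>g0 x\<bar> \<le> C"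
    using W2 by (auto simp: W2_def)
  have "locally_integrable g0" using g0(1) by (simp add: weak_laplacian_def)
  then obtain g where g: "g \<in> borel_measurable borel" "AE x in lborel. g0 x = g x" "g0 \<in> borel_measurable lebesgue"
    "\<And>r. integrable lborel (\<lambda>x. indicator (cball 0 r) x * g x)"
    by (rule locally_integrable_borel_representative) blast
  interpret confining_kernel "deriv w" g
  proof
    show "0 \<le> deriv w r" if "0 < r" for r using rad that by (simp add: W_RAD_def)
    show "sphere_area TYPE('a) * r ^ (DIM('a) - 1) * deriv w r = (\<integral>x. indicator {x. norm x < r} x * g x \<partial>lborel)" if "0 < r" for r
      by (rule radial_weak_laplacian[OF g0(1) Wa dw cw g(1,2,3,4) that])
    show "\<exists>C. AE x in lborel. \<epsilon> \<le> norm x \<longrightarrow> \<bar>g x\<bar> \<le> C" if \<epsilon>: "0 < \<epsilon>" for \<epsilon>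
    proof -
      obtain C where "AE x in lebesgue. x \<notin> ball 0 \<epsilon> \<longrightarrow> \<bar>g0 x\<bar> \<le> C" using g0(2)[OF \<epsilon>] by blast
      then have "AE x in lborel. x \<notin> ball 0 \<epsilon> \<longrightarrow> \<bar>g0 x\<bar> \<le> C" by (simp only: AE_completion_iff)
      with g(2) have "AE x in lborel. \<epsilon> \<le> norm x \<longrightarrow> \<bar>g x\<bar> \<le> C" by eventually_elim auto
      then show ?thesis by blast
    qed
    show "filterlim (\<lambda>r. deriv w r * r powr (1 / real DIM('a))) at_top at_top" using conf by (simp add: W_CONF_def)
  qed (use dim cw g in auto)
  have "gradient (\<lambda>x. - newtonian x + Wa x) z = K z" if z: "z \<noteq> 0" for z
  proof (rule gradient_eq)
    have nd: "(norm has_derivative (\<lambda>h. h \<bullet> sgn z)) (at z)" by (rule has_derivative_norm[OF z])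
    have "((\<lambda>x. w (norm x)) has_derivative (\<lambda>h. h \<bullet> ((deriv w (norm z) / norm z) *\<^sub>R z))) (at z)"
      using has_derivative_compose[OF nd dw[of "norm z", unfolded has_field_derivative_def]] z
      by (auto elim!: has_derivative_eq_rhs simp: sgn_div_norm divide_inverse)
    then have "(Wa has_derivative (\<lambda>h. h \<bullet> ((deriv w (norm z) / norm z) *\<^sub>R z))) (at z)"
      by (rule has_derivative_transform_within_open[of _ _ _ _ "- {0}"]) (use z Wa in auto)
    from has_derivative_add[OF has_derivative_minus[OF newtonian_has_derivative[OF dim z]] this]
    show "((\<lambda>x. - newtonian x + Wa x) has_derivative (\<lambda>h. h \<bullet> K z)) (at z)"
      by (rule has_derivative_eq_rhs) (simp add: fun_eq_iff K_def z left_diff_distrib inner_diff_right)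
  qed
  then show thesis using that confining_kernel_axioms by blast
qed

text \<open>The value of \<open>gradient W\<close> at the origin is unspecified, but it affects the
  integrand at the single point y = x only.\<close>

lemma (in confining_kernel) grad_conv_eq_velocity:
  assumes grad: "\<And>z. z \<noteq> 0 \<Longrightarrow> gradient W z = K z" and u: "continuous_on UNIV u"
  shows "grad_conv W u x = velocity u x"
proof -
  have [measurable]: "u \<in> borel_measurable borel" using u by (rule borel_measurable_continuous_onI)
  have "gradient W = (\<lambda>z. if z = 0 then gradient W 0 else K z)" using grad by auto
  also have "\<dots> \<in> borel_measurable borel" by measurable
  finally have [measurable]: "gradient W \<in> borel_measurable borel" .
  have "grad_conv W u x = (\<integral>y. u y *\<^sub>R gradient W (x - y) \<partial>lborel)"
    unfolding grad_conv_def by (rule integral_completion) measurable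
  also have "\<dots> = (\<integral>y. u y *\<^sub>R K (x - y) \<partial>lborel)"
  proof (rule integral_cong_AE)
    have "AE y in lborel. y \<noteq> x" by (rule AE_lborel_singleton)
    then show "AE y in lborel. u y *\<^sub>R gradient W (x - y) = u y *\<^sub>R K (x - y)"
      by eventually_elim (simp add: grad)
  qed measurable
  also have "\<dots> = velocity u x" using velocity_eq(1)[OF u] by simp
  finally show ?thesis .
qed

text \<open>The gradient is assembled from the derivatives of the slices and not from
  \<open>f'\<close>, which varies with \<open>T\<close>; so one gradient serves all horizons. The
  bound in time comes from \<open>f'\<close> being bounded on a compact set containing the
  support.\<close>

lemma C1_on_slices:
  fixes \<rho> :: "real \<Rightarrow> 'a::euclidean_space \<Rightarrow> real"
  assumes "C1_on ({0..T} \<times> UNIV) (\<lambda>(t, x). \<rho> t x)"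
  defines "D \<equiv> \<lambda>t x. \<Sum>b\<in>Basis. frechet_derivative (\<rho> t) (at x) b *\<^sub>R b"
  shows "\<And>t x. t \<in> {0..T} \<Longrightarrow> (\<rho> t has_derivative (\<lambda>h. D t x \<bullet> h)) (at x)"
    and "continuous_on ({0..T} \<times> UNIV) (\<lambda>(t, x). \<rho> t x)"
    and "continuous_on ({0..T} \<times> UNIV) (\<lambda>(t, x). D t x)"
    and "(\<And>t x. t \<in> {0..T} \<Longrightarrow> r \<le> norm x \<Longrightarrow> \<rho> t x = 0) \<Longrightarrow>
      \<exists>\<Lambda>>0. \<forall>s\<in>{0..T}. \<forall>t\<in>{0..T}. \<forall>x. \<bar>\<rho> s x - \<rho> t x\<bar> \<le> \<Lambda> * \<bar>s - t\<bar>"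
proof -
  let ?F = "\<lambda>(t, x). \<rho> t x" and ?S = "{0..T} \<times> (UNIV :: 'a set)"
  obtain f' where f': "\<And>z. z \<in> ?S \<Longrightarrow> (?F has_derivative blinfun_apply (f' z)) (at z within ?S)" "continuous_on ?S f'"
    using assms(1) by (auto simp: C1_on_def)
  have slice: "(\<rho> t has_derivative (\<lambda>h. f' (t, x) (0, h))) (at x)" if t: "t \<in> {0..T}" for t x
  proof -
    have "((\<lambda>x. (t, x)) has_derivative (\<lambda>h. (0, h))) (at x within UNIV)" by (auto intro!: derivative_eq_intros)
    moreover have "(?F has_derivative blinfun_apply (f' (t, x))) (at (t, x) within (\<lambda>x. (t, x)) ` UNIV)"
      by (rule has_derivative_subset[OF f'(1)]) (use t in auto)
    ultimately have "((\<lambda>x. ?F (t, x)) has_derivative (\<lambda>h. f' (t, x) (0, h))) (at x within UNIV)"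
      by (rule has_derivative_in_compose)
    then show ?thesis by simp
  qed
  have D: "D t x = (\<Sum>b\<in>Basis. f' (t, x) (0, b) *\<^sub>R b)" if "t \<in> {0..T}" for t x
    unfolding D_def frechet_derivative_at[OF slice[OF that], symmetric] ..
  show "(\<rho> t has_derivative (\<lambda>h. D t x \<bullet> h)) (at x)" if t: "t \<in> {0..T}" for t x
    using slice[OF t]
  proof (rule has_derivative_eq_rhs)
    have lin: "linear (\<lambda>h. f' (t, x) (0, h))" using slice[OF t, of x] by (simp add: has_derivative_bounded_linear bounded_linear.linear)
    show "(\<lambda>h. f' (t, x) (0, h)) = (\<lambda>h. D t x \<bullet> h)"
    proof
      fix h :: 'a
      have "f' (t, x) (0, h) = f' (t, x) (0, \<Sum>b\<in>Basis. (h \<bullet> b) *\<^sub>R b)" by (simp add: euclidean_representation)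
      also have "\<dots> = (\<Sum>b\<in>Basis. (h \<bullet> b) * f' (t, x) (0, b))"
        using linear_sum[OF lin, of "\<lambda>b. (h \<bullet> b) *\<^sub>R b" Basis] linear_scale[OF lin] by simp
      also have "\<dots> = D t x \<bullet> h" unfolding D[OF t] by (simp add: inner_sum_left inner_commute[of h] mult.commute)
      finally show "f' (t, x) (0, h) = D t x \<bullet> h" .
    qed
  qed
  show "continuous_on ?S ?F" by (rule has_derivative_continuous_on[OF f'(1)])
  have "continuous_on ?S (\<lambda>z. \<Sum>b\<in>Basis. f' z (0, b) *\<^sub>R b)"
    by (intro continuous_intros f'(2))
  then show "continuous_on ?S (\<lambda>(t, x). D t x)"
    by (rule continuous_on_eq) (use D in auto)
  assume supp: "\<And>t x. t \<in> {0..T} \<Longrightarrow> r \<le> norm x \<Longrightarrow> \<rho> t x = 0"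
  have "compact (f' ` ({0..T} \<times> cball 0 r))"
    by (intro compact_continuous_image continuous_on_subset[OF f'(2)] compact_Times) auto
  then obtain B where B: "0 < B" "\<And>y. y \<in> f' ` ({0..T} \<times> cball 0 r) \<Longrightarrow> norm y \<le> B"
    using compact_imp_bounded bounded_pos by metis
  have "\<bar>\<rho> s x - \<rho> t x\<bar> \<le> B * \<bar>s - t\<bar>" if st: "s \<in> {0..T}" "t \<in> {0..T}" for s t x
  proof (cases "norm x \<le> r")
    case True
    have "norm (\<rho> s x - \<rho> t x) \<le> B * norm (s - t)"
    proof (rule differentiable_bound[of "{0..T}" "\<lambda>t. \<rho> t x" "\<lambda>t h. f' (t, x) (h, 0)"])
      fix q assume q: "q \<in> {0..T}"
      have "((\<lambda>t. (t, x)) has_derivative (\<lambda>h. (h, 0))) (at q within {0..T})" by (auto intro!: derivative_eq_intros)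
      moreover have "(?F has_derivative blinfun_apply (f' (q, x))) (at (q, x) within (\<lambda>t. (t, x)) ` {0..T})"
        by (rule has_derivative_subset[OF f'(1)]) (use q in auto)
      ultimately have "((\<lambda>t. ?F (t, x)) has_derivative (\<lambda>h. f' (q, x) (h, 0))) (at q within {0..T})"
        by (rule has_derivative_in_compose)
      then show "((\<lambda>t. \<rho> t x) has_derivative (\<lambda>h. f' (q, x) (h, 0))) (at q within {0..T})" by simp
      show "onorm (\<lambda>h. f' (q, x) (h, 0)) \<le> B"
      proof (rule onorm_le)
        fix h :: real
        have "norm (f' (q, x) (h, 0)) \<le> norm (f' (q, x)) * norm (h, 0::'a)" by (rule norm_blinfun)
        also have "\<dots> \<le> B * norm h"
          using B(2)[of "f' (q, x)"] q True less_imp_le[OF B(1)] by (intro mult_mono) (auto simp: norm_Pair)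
        finally show "norm (f' (q, x) (h, 0)) \<le> B * norm h" .
      qed
    qed (use st in auto)
    then show ?thesis by simp
  next
    case False
    then show ?thesis using supp[OF st(1)] supp[OF st(2)] B(1) by simp
  qed
  then show "\<exists>\<Lambda>>0. \<forall>s\<in>{0..T}. \<forall>t\<in>{0..T}. \<forall>x. \<bar>\<rho> s x - \<rho> t x\<bar> \<le> \<Lambda> * \<bar>s - t\<bar>"
    using B(1) by blast
qed

lemma (in confining_kernel) classical_solution_transport:
  fixes \<rho>0 :: "'a \<Rightarrow> real"
  assumes grad: "\<And>z. z \<noteq> 0 \<Longrightarrow> gradient W z = K z"
    and sol: "classical_solution W \<rho>0 \<rho>"
    and pos: "\<And>x. 0 \<le> \<rho>0 x" and R0: "supp \<rho>0 \<subseteq> ball 0 R0"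
    and mass: "(LINT x|lebesgue. \<rho>0 x) = 1" and center: "(LINT x|lebesgue. \<rho>0 x *\<^sub>R x) = 0"
    and L: "AE x in lebesgue. \<bar>\<rho>0 x\<bar> \<le> L"
  shows "transport \<kappa> g \<rho> (\<lambda>t x. \<Sum>b\<in>Basis. frechet_derivative (\<rho> t) (at x) b *\<^sub>R b) R0 L"
proof -
  let ?D = "\<lambda>t x. \<Sum>b\<in>Basis. frechet_derivative (\<rho> t) (at x) b *\<^sub>R b"
  have C1: "C1_on ({0..T} \<times> UNIV) (\<lambda>(t, x). \<rho> t x)" if "0 < T" for T
    using sol that by (simp add: classical_solution_def)
  have zero: "u x = 0" if "x \<notin> supp u" for u :: "'a \<Rightarrow> real" and x
    using that closure_subset[of "{x. u x \<noteq> 0}"] by (auto simp: supp_def)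
  have sp: "(\<rho> t has_derivative (\<lambda>h. ?D t x \<bullet> h)) (at x)" if "0 \<le> t" for t x
    by (rule C1_on_slices(1)[OF C1[of "t + 1"]]) (use that in auto)
  have ct: "continuous_on UNIV (\<rho> t)" if "0 \<le> t" for t
    by (rule has_derivative_continuous_on[OF has_derivative_at_withinI[OF sp[OF that]]])
  have init: "\<rho> 0 = \<rho>0" using sol by (auto simp: classical_solution_def)
  have c0: "continuous_on UNIV \<rho>0" using ct[of 0] init by simp
  then have [measurable]: "\<rho>0 \<in> borel_measurable borel" by (rule borel_measurable_continuous_onI)
  have cpt: "\<exists>r>0. \<forall>t\<in>{0..T}. \<forall>x. r \<le> norm x \<longrightarrow> \<rho> t x = 0" if T: "0 < T" for T
  proof -
    obtain S where S: "compact S" "\<forall>t\<in>{0..T}. supp (\<rho> t) \<subseteq> S"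
      using sol T by (auto simp: classical_solution_def compact_support_loc_def)
    obtain b where b: "0 < b" "\<And>x. x \<in> S \<Longrightarrow> norm x \<le> b"
      using compact_imp_bounded[OF S(1)] bounded_pos by metis
    have "\<rho> t x = 0" if "t \<in> {0..T}" "b + 1 \<le> norm x" for t x
    proof (rule zero)
      have "x \<notin> S" using b(2)[of x] that(2) by auto
      then show "x \<notin> supp (\<rho> t)" using S(2) that(1) by blast
    qed
    then show ?thesis using b(1) by (intro exI[of _ "b + 1"]) auto
  qed
  \<comment> \<open>The essential bound becomes pointwise because the initial datum is
    continuous.\<close>
  have le: "\<rho>0 x \<le> L" for x
  proof -
    have "AE x in lborel. \<bar>\<rho>0 x\<bar> \<le> L" using L by (simp only: AE_completion_iff)
    then have "AE x in lborel. x \<notin> {x. L < \<rho>0 x}" by eventually_elim auto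
    moreover have "open {x. L < \<rho>0 x}" by (rule open_Collect_less[OF continuous_on_const c0])
    ultimately have "{x. L < \<rho>0 x} = {}" by (rule open_AE_empty[rotated])
    then show ?thesis by (auto simp: not_less)
  qed
  show ?thesis
  proof
    show "\<exists>\<Lambda>>0. \<forall>s\<in>{0..T}. \<forall>t\<in>{0..T}. \<forall>x. \<bar>\<rho> s x - \<rho> t x\<bar> \<le> \<Lambda> * \<bar>s - t\<bar>" if T: "0 < T" for T
    proof -
      obtain r where "\<forall>t\<in>{0..T}. \<forall>x. r \<le> norm x \<longrightarrow> \<rho> t x = 0" using cpt[OF T] by blast
      then show ?thesis by (intro C1_on_slices(4)[OF C1[OF T], of r]) auto
    qed
    show "\<exists>d. ((\<lambda>s. \<rho> s x) has_real_derivative d) (at t) \<and>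
        has_divergence (\<lambda>y. \<rho> t y *\<^sub>R velocity (\<rho> t) y) d x" if t: "0 < t" for t x
    proof -
      have "grad_conv W (\<rho> t) = velocity (\<rho> t)"
        using grad_conv_eq_velocity[OF grad ct[of t]] t by auto
      moreover have "\<exists>d. ((\<lambda>s. \<rho> s x) has_real_derivative d) (at t) \<and>
        has_divergence (\<lambda>y. \<rho> t y *\<^sub>R grad_conv W (\<rho> t) y) d x"
        using sol t by (simp add: classical_solution_def)
      ultimately show ?thesis by simp
    qed
    show "(\<integral>x. \<rho> 0 x \<partial>lborel) = 1"
      using mass unfolding init by (subst (asm) integral_completion) auto
    show "(\<integral>x. \<rho> 0 x *\<^sub>R x \<partial>lborel) = 0"
      using center unfolding init by (subst (asm) integral_completion) auto
    show "\<rho> 0 x = 0" if "R0 \<le> norm x" for x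
      unfolding init by (rule zero) (use R0 that in auto)
  qed (use cpt sp pos le init C1_on_slices(2,3)[OF C1] in auto)
qed

theorem mainTheorem3:
  fixes Wa :: "real ^ 'n \<Rightarrow> real" and w :: "real \<Rightarrow> real"
  assumes "CARD('n) \<ge> 2"
    and "W1 Wa" and "W2 Wa" and "W_RAD Wa w" and "W_CONF CARD('n) w"
  shows "\<forall>R0>0. \<forall>L>0. \<exists>R>0. \<forall>(\<rho>0 :: real ^ 'n \<Rightarrow> real) (\<rho> :: real \<Rightarrow> real ^ 'n \<Rightarrow> real).
    sobolev_inf 2 \<rho>0 \<and> (\<forall>x. \<rho>0 x \<ge> 0) \<and> supp \<rho>0 \<subseteq> ball 0 R0 \<and>
    (LINT x|lebesgue. \<rho>0 x) = 1 \<and> (LINT x|lebesgue. \<rho>0 x *\<^sub>R x) = 0 \<and>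
    (AE x in lebesgue. \<bar>\<rho>0 x\<bar> \<le> L) \<and>
    classical_solution (\<lambda>x. - newtonian x + Wa x) \<rho>0 \<rho>
    \<longrightarrow> (\<forall>t\<ge>0. supp (\<rho> t) \<subseteq> ball 0 R)"
proof (intro allI impI)
  fix R0 L :: real assume "0 < R0" "0 < L"
  have dim: "2 \<le> DIM(real ^ 'n)" and conf: "W_CONF DIM(real ^ 'n) w" using assms(1,5) by auto
  obtain g :: "real ^ 'n \<Rightarrow> real" where g: "confining_kernel (deriv w) g"
    "\<And>z. z \<noteq> 0 \<Longrightarrow> gradient (\<lambda>x. - newtonian x + Wa x) z = confining_kernel.K (deriv w) z"
    by (rule kernel_from_assumptions[OF dim assms(3,4) conf]) blast
  interpret confining_kernel "deriv w" g by (rule g(1))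
  obtain R where R: "0 < R"
    "\<And>\<rho> D\<rho> t x. transport (deriv w) g \<rho> D\<rho> R0 L \<Longrightarrow> 0 \<le> t \<Longrightarrow> R \<le> norm x \<Longrightarrow> \<rho> t x = 0"
    by (rule confinement[of R0 L]) blast
  show "\<exists>R>0. \<forall>(\<rho>0 :: real ^ 'n \<Rightarrow> real) (\<rho> :: real \<Rightarrow> real ^ 'n \<Rightarrow> real).
    sobolev_inf 2 \<rho>0 \<and> (\<forall>x. \<rho>0 x \<ge> 0) \<and> supp \<rho>0 \<subseteq> ball 0 R0 \<and>
    (LINT x|lebesgue. \<rho>0 x) = 1 \<and> (LINT x|lebesgue. \<rho>0 x *\<^sub>R x) = 0 \<and>
    (AE x in lebesgue. \<bar>\<rho>0 x\<bar> \<le> L) \<and>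
    classical_solution (\<lambda>x. - newtonian x + Wa x) \<rho>0 \<rho>
    \<longrightarrow> (\<forall>t\<ge>0. supp (\<rho> t) \<subseteq> ball 0 R)"
  \<comment> \<open>The density vanishes for |x| >= R, so its support, a closure, may touch the
    sphere of radius \<open>R\<close>; an open ball containing it is given a larger radius.\<close>
  proof (intro exI[of _ "R + 1"] conjI allI impI)
    fix \<rho>0 :: "real ^ 'n \<Rightarrow> real" and \<rho> :: "real \<Rightarrow> real ^ 'n \<Rightarrow> real" and t :: real
    assume A: "sobolev_inf 2 \<rho>0 \<and> (\<forall>x. \<rho>0 x \<ge> 0) \<and> supp \<rho>0 \<subseteq> ball 0 R0 \<and>
      (LINT x|lebesgue. \<rho>0 x) = 1 \<and> (LINT x|lebesgue. \<rho>0 x *\<^sub>R x) = 0 \<and>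
      (AE x in lebesgue. \<bar>\<rho>0 x\<bar> \<le> L) \<and>
      classical_solution (\<lambda>x. - newtonian x + Wa x) \<rho>0 \<rho>" and t: "0 \<le> t"
    have "transport (deriv w) g \<rho> (\<lambda>t x. \<Sum>b\<in>Basis. frechet_derivative (\<rho> t) (at x) b *\<^sub>R b) R0 L"
      by (rule classical_solution_transport[where W="\<lambda>x. - newtonian x + Wa x" and ?\<rho>0.0=\<rho>0]) (use A g(2) in blast)+
    then have "\<rho> t x = 0" if "R \<le> norm x" for x using R(2) t that by blast
    then have "{x. \<rho> t x \<noteq> 0} \<subseteq> cball 0 R" by (force simp: not_le)
    then have "supp (\<rho> t) \<subseteq> cball 0 R" unfolding supp_def by (rule closure_minimal) simp
    then show "supp (\<rho> t) \<subseteq> ball 0 (R + 1)" by force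
  qed (use R(1) in simp)
qed

end
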